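(* Let $F:(M,g,J)\to(N,g')$ be a conformal Lagrangian submersion from a Kähler manifold $(M,g,J)$ to a Riemannian manifold $(N,g')$. Then $M$ is a locally product manifold if and only if $A_XJY=0$ and $T_VJW=0$ for all $X,Y\in\Gamma((\ker F_* )^\perp)$ and $V,W\in\Gamma(\ker F_* )$.
   Context: A Kähler manifold $(M,g,J)$ is a Riemannian manifold with a $(1,1)$-tensor field $J$ such that $J^2=-I$, $g(JX,JY)=g(X,Y)$ and $\nabla J=0$, where $\nabla$ is the Levi-Civita connection of $g$. A smooth submersion $F:(M,g)\to(N,g')$ is horizontally conformal with dilation $\lambda:M\to(0,\infty)$ if $g'(F_*X,F_*Y)=\lambda^2g(X,Y)$ for all $X,Y\in\Gamma((\ker F_* )^\perp)$. It is a conformal Lagrangian submersion if moreover $J(\ker F_* )=(\ker F_* )^\perp$. $\mathcal V,\mathcal H$ are the orthogonal projections onto the vertical distribution $\ker F_*$ and the horizontal distribution $(\ker F_* )^\perp$. O'Neill's tensors are $A_EG=\mathcal V\nabla_{\mathcal HE}\mathcal HG+\mathcal H\nabla_{\mathcal HE}\mathcal VG$ and $T_EG=\mathcal H\nabla_{\mathcal VE}\mathcal VG+\mathcal V\nabla_{\mathcal VE}\mathcal HG$ for vector fields $E,G$ on $M$. "$M$ is a locally product manifold" means that $M$ is locally the (usual) Riemannian product of integral manifolds of $\ker F_*$ and $(\ker F_* )^\perp$; equivalently both distributions define totally geodesic foliations. *)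

theory Defs
  imports "HOL-Analysis.Analysis"
begin

text \<open>
  A manifold is a type of points of class \<open>{t2_space, second_countable_topology}\<close> with a smooth atlas
  of charts into a Euclidean space \<open>'e\<close>; a chart is a pair \<open>(U, \<phi>)\<close>, where only the values of \<open>\<phi>\<close> on
  the open set \<open>U\<close> matter.

  Each point \<open>p\<close> has a preferred chart \<open>chart_at A p\<close> around it, and the tangent space at \<open>p\<close> is the
  model space \<open>'e\<close>, a vector being represented by its components in that preferred chart.
  Hence a vector field, a metric and an endomorphism field have the types \<open>'m \<Rightarrow> 'e\<close>,
  \<open>'m \<Rightarrow> 'e \<Rightarrow> 'e \<Rightarrow> real\<close> and \<open>'m \<Rightarrow> 'e \<Rightarrow> 'e\<close>. The preferred chart may jump from point to point,
  so smoothness is always read off in the charts of the atlas, never from these raw functions.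
\<close>

subsection \<open>Smooth manifolds\<close>

primrec Ck_on :: "nat \<Rightarrow> 'a::real_normed_vector set \<Rightarrow> ('a \<Rightarrow> 'b::real_normed_vector) \<Rightarrow> bool" where
  "Ck_on 0 S f \<longleftrightarrow> continuous_on S f"
| "Ck_on (Suc k) S f \<longleftrightarrow>
     (\<forall>x\<in>S. f differentiable (at x)) \<and> (\<forall>v. Ck_on k S (\<lambda>x. frechet_derivative f (at x) v))"

text \<open>Only used for open subsets \<open>S\<close> of finite-dimensional spaces.\<close>
definition smooth_on :: "'a::real_normed_vector set \<Rightarrow> ('a \<Rightarrow> 'b::real_normed_vector) \<Rightarrow> bool" where
  "smooth_on S f \<longleftrightarrow> (\<forall>k. Ck_on k S f)"

type_synonym ('m, 'e) chart = "'m set \<times> ('m \<Rightarrow> 'e)"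

abbreviation inv_chart :: "('m, 'e) chart \<Rightarrow> 'e \<Rightarrow> 'm" where
  "inv_chart c \<equiv> inv_into (fst c) (snd c)"

definition is_chart :: "('m::topological_space, 'e::euclidean_space) chart \<Rightarrow> bool" where
  "is_chart c \<longleftrightarrow> open (fst c) \<and> open (snd c ` fst c) \<and>
     homeomorphism (fst c) (snd c ` fst c) (snd c) (inv_chart c)"

definition smooth_transition ::
    "('m, 'e::euclidean_space) chart \<Rightarrow> ('m, 'e) chart \<Rightarrow> bool" where
  "smooth_transition c d \<longleftrightarrow> smooth_on (snd c ` (fst c \<inter> fst d)) (snd d \<circ> inv_chart c)"

definition smooth_atlas ::
    "('m::{t2_space,second_countable_topology}, 'e::euclidean_space) chart set \<Rightarrow> bool" where
  "smooth_atlas A \<longleftrightarrow> (\<forall>c\<in>A. is_chart c) \<and> (\<Union>c\<in>A. fst c) = UNIV \<and>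
     (\<forall>c\<in>A. \<forall>d\<in>A. smooth_transition c d)"

text \<open>The charts of the maximal atlas containing \<open>A\<close>.\<close>
definition smooth_chart ::
    "('m::{t2_space,second_countable_topology}, 'e::euclidean_space) chart set
      \<Rightarrow> ('m, 'e) chart \<Rightarrow> bool" where
  "smooth_chart A c \<longleftrightarrow>
     is_chart c \<and> (\<forall>d\<in>A. smooth_transition c d \<and> smooth_transition d c)"

definition chart_at :: "('m, 'e) chart set \<Rightarrow> 'm \<Rightarrow> ('m, 'e) chart" where
  "chart_at A p = (SOME c. c \<in> A \<and> p \<in> fst c)"

definition smooth_fun ::
    "('m, 'e::euclidean_space) chart set \<Rightarrow> ('m \<Rightarrow> real) \<Rightarrow> bool" where
  "smooth_fun A f \<longleftrightarrow> (\<forall>c\<in>A. smooth_on (snd c ` fst c) (f \<circ> inv_chart c))"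

definition smooth_map ::
    "('m::topological_space, 'e::euclidean_space) chart set
      \<Rightarrow> ('n::topological_space, 'f::euclidean_space) chart set \<Rightarrow> ('m \<Rightarrow> 'n) \<Rightarrow> bool" where
  "smooth_map A B F \<longleftrightarrow> continuous_on UNIV F \<and>
     (\<forall>c\<in>A. \<forall>d\<in>B. smooth_on (snd c ` (fst c \<inter> F -` fst d)) (snd d \<circ> F \<circ> inv_chart c))"

subsection \<open>Differentials and vector fields\<close>

text \<open>The differential at \<open>p\<close> of a vector-valued function defined near \<open>p\<close>. For a real-valued \<open>f\<close>,
  \<open>mderiv A f p v\<close> is the derivative of \<open>f\<close> in direction \<open>v\<close>; for a chart \<open>c\<close> around \<open>p\<close>,
  \<open>mderiv A (snd c) p v\<close> gives the components of the tangent vector \<open>v\<close> with respect to \<open>c\<close>.\<close>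
definition mderiv ::
    "('m, 'e::euclidean_space) chart set \<Rightarrow> ('m \<Rightarrow> 'b::real_normed_vector) \<Rightarrow> 'm \<Rightarrow> 'e \<Rightarrow> 'b" where
  "mderiv A f p = frechet_derivative (f \<circ> inv_chart (chart_at A p)) (at (snd (chart_at A p) p))"

text \<open>The differential \<open>F\<^sub>*\<close> at \<open>p\<close>.\<close>
definition tangent_map ::
    "('m, 'e::euclidean_space) chart set \<Rightarrow> ('n, 'f::euclidean_space) chart set
      \<Rightarrow> ('m \<Rightarrow> 'n) \<Rightarrow> 'm \<Rightarrow> 'e \<Rightarrow> 'f" where
  "tangent_map A B F p = mderiv A (snd (chart_at B (F p)) \<circ> F) p"

text \<open>The components of a vector field with respect to the chart \<open>c\<close>.\<close>
definition field_in_chart ::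
    "('m, 'e::euclidean_space) chart set \<Rightarrow> ('m, 'e) chart \<Rightarrow> ('m \<Rightarrow> 'e) \<Rightarrow> 'e \<Rightarrow> 'e" where
  "field_in_chart A c X x = mderiv A (snd c) (inv_chart c x) (X (inv_chart c x))"

definition smooth_field ::
    "('m, 'e::euclidean_space) chart set \<Rightarrow> ('m \<Rightarrow> 'e) \<Rightarrow> bool" where
  "smooth_field A X \<longleftrightarrow> (\<forall>c\<in>A. smooth_on (snd c ` fst c) (field_in_chart A c X))"

text \<open>The smooth sections \<open>\<Gamma>(D)\<close> of a distribution \<open>D\<close>.\<close>
definition sections ::
    "('m, 'e::euclidean_space) chart set \<Rightarrow> ('m \<Rightarrow> 'e set) \<Rightarrow> ('m \<Rightarrow> 'e) set" where
  "sections A D = {X. smooth_field A X \<and> (\<forall>p. X p \<in> D p)}"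

text \<open>\<open>[X, Y] = DY(X) - DX(Y)\<close>, computed at \<open>p\<close> in the preferred chart around \<open>p\<close>, where tangent
  vectors at \<open>p\<close> are their own components.\<close>
definition lie_bracket ::
    "('m, 'e::euclidean_space) chart set \<Rightarrow> ('m \<Rightarrow> 'e) \<Rightarrow> ('m \<Rightarrow> 'e) \<Rightarrow> 'm \<Rightarrow> 'e" where
  "lie_bracket A X Y p =
     (let c = chart_at A p in
        frechet_derivative (field_in_chart A c Y) (at (snd c p)) (X p)
        - frechet_derivative (field_in_chart A c X) (at (snd c p)) (Y p))"

subsection \<open>Riemannian and Kaehler manifolds\<close>

definition riemannian_metric ::
    "('m::{t2_space,second_countable_topology}, 'e::euclidean_space) chart set
      \<Rightarrow> ('m \<Rightarrow> 'e \<Rightarrow> 'e \<Rightarrow> real) \<Rightarrow> bool" where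
  "riemannian_metric A g \<longleftrightarrow>
     (\<forall>p. bilinear (g p) \<and> (\<forall>v w. g p v w = g p w v) \<and> (\<forall>v. v \<noteq> 0 \<longrightarrow> g p v v > 0)) \<and>
     (\<forall>X Y. smooth_field A X \<longrightarrow> smooth_field A Y \<longrightarrow> smooth_fun A (\<lambda>p. g p (X p) (Y p)))"

definition affine_connection ::
    "('m, 'e::euclidean_space) chart set
      \<Rightarrow> (('m \<Rightarrow> 'e) \<Rightarrow> ('m \<Rightarrow> 'e) \<Rightarrow> 'm \<Rightarrow> 'e) \<Rightarrow> bool" where
  "affine_connection A nabla \<longleftrightarrow>
     (\<forall>X Y. smooth_field A X \<longrightarrow> smooth_field A Y \<longrightarrow> smooth_field A (nabla X Y)) \<and>
     (\<forall>X X' Y p. smooth_field A X \<longrightarrow> smooth_field A X' \<longrightarrow> smooth_field A Y \<longrightarrow>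
        nabla (\<lambda>q. X q + X' q) Y p = nabla X Y p + nabla X' Y p) \<and>
     (\<forall>X Y Y' p. smooth_field A X \<longrightarrow> smooth_field A Y \<longrightarrow> smooth_field A Y' \<longrightarrow>
        nabla X (\<lambda>q. Y q + Y' q) p = nabla X Y p + nabla X Y' p) \<and>
     (\<forall>f X Y p. smooth_fun A f \<longrightarrow> smooth_field A X \<longrightarrow> smooth_field A Y \<longrightarrow>
        nabla (\<lambda>q. f q *\<^sub>R X q) Y p = f p *\<^sub>R nabla X Y p) \<and>
     (\<forall>f X Y p. smooth_fun A f \<longrightarrow> smooth_field A X \<longrightarrow> smooth_field A Y \<longrightarrow>
        nabla X (\<lambda>q. f q *\<^sub>R Y q) p = mderiv A f p (X p) *\<^sub>R Y p + f p *\<^sub>R nabla X Y p)"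

text \<open>This determines \<open>nabla X Y\<close> for smooth \<open>X\<close> and \<open>Y\<close>; on other arguments \<open>nabla\<close> is arbitrary.\<close>
definition levi_civita ::
    "('m, 'e::euclidean_space) chart set \<Rightarrow> ('m \<Rightarrow> 'e \<Rightarrow> 'e \<Rightarrow> real)
      \<Rightarrow> (('m \<Rightarrow> 'e) \<Rightarrow> ('m \<Rightarrow> 'e) \<Rightarrow> 'm \<Rightarrow> 'e) \<Rightarrow> bool" where
  "levi_civita A g nabla \<longleftrightarrow> affine_connection A nabla \<and>
     (\<forall>X Y p. smooth_field A X \<longrightarrow> smooth_field A Y \<longrightarrow>
        nabla X Y p - nabla Y X p = lie_bracket A X Y p) \<and>
     (\<forall>X Y Z p. smooth_field A X \<longrightarrow> smooth_field A Y \<longrightarrow> smooth_field A Z \<longrightarrow>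
        mderiv A (\<lambda>q. g q (Y q) (Z q)) p (X p) = g p (nabla X Y p) (Z p) + g p (Y p) (nabla X Z p))"

text \<open>A smooth \<open>(1,1)\<close>-tensor field.\<close>
definition endomorphism_field ::
    "('m, 'e::euclidean_space) chart set \<Rightarrow> ('m \<Rightarrow> 'e \<Rightarrow> 'e) \<Rightarrow> bool" where
  "endomorphism_field A J \<longleftrightarrow>
     (\<forall>p. linear (J p)) \<and> (\<forall>X. smooth_field A X \<longrightarrow> smooth_field A (\<lambda>p. J p (X p)))"

text \<open>\<open>nabla\<close> is the Levi-Civita connection; the last condition is \<open>\<nabla>J = 0\<close>.\<close>
definition kaehler_manifold ::
    "('m::{t2_space,second_countable_topology}, 'e::euclidean_space) chart set
      \<Rightarrow> ('m \<Rightarrow> 'e \<Rightarrow> 'e \<Rightarrow> real) \<Rightarrow> ('m \<Rightarrow> 'e \<Rightarrow> 'e)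
      \<Rightarrow> (('m \<Rightarrow> 'e) \<Rightarrow> ('m \<Rightarrow> 'e) \<Rightarrow> 'm \<Rightarrow> 'e) \<Rightarrow> bool" where
  "kaehler_manifold A g J nabla \<longleftrightarrow>
     smooth_atlas A \<and> riemannian_metric A g \<and> levi_civita A g nabla \<and> endomorphism_field A J \<and>
     (\<forall>p v. J p (J p v) = - v) \<and>
     (\<forall>p v w. g p (J p v) (J p w) = g p v w) \<and>
     (\<forall>X Y p. smooth_field A X \<longrightarrow> smooth_field A Y \<longrightarrow>
        nabla X (\<lambda>q. J q (Y q)) p = J p (nabla X Y p))"

subsection \<open>Conformal Lagrangian submersions\<close>

definition vertical ::
    "('m, 'e::euclidean_space) chart set \<Rightarrow> ('n, 'f::euclidean_space) chart set
      \<Rightarrow> ('m \<Rightarrow> 'n) \<Rightarrow> 'm \<Rightarrow> 'e set" where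
  "vertical A B F p = {v. tangent_map A B F p v = 0}"

definition horizontal ::
    "('m, 'e::euclidean_space) chart set \<Rightarrow> ('m \<Rightarrow> 'e \<Rightarrow> 'e \<Rightarrow> real)
      \<Rightarrow> ('n, 'f::euclidean_space) chart set \<Rightarrow> ('m \<Rightarrow> 'n) \<Rightarrow> 'm \<Rightarrow> 'e set" where
  "horizontal A g B F p = {w. \<forall>v\<in>vertical A B F p. g p v w = 0}"

definition smooth_submersion ::
    "('m::topological_space, 'e::euclidean_space) chart set
      \<Rightarrow> ('n::topological_space, 'f::euclidean_space) chart set \<Rightarrow> ('m \<Rightarrow> 'n) \<Rightarrow> bool" where
  "smooth_submersion A B F \<longleftrightarrow> smooth_map A B F \<and> (\<forall>p. surj (tangent_map A B F p))"

definition horizontally_conformal ::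
    "('m::topological_space, 'e::euclidean_space) chart set \<Rightarrow> ('m \<Rightarrow> 'e \<Rightarrow> 'e \<Rightarrow> real)
      \<Rightarrow> ('n::topological_space, 'f::euclidean_space) chart set \<Rightarrow> ('n \<Rightarrow> 'f \<Rightarrow> 'f \<Rightarrow> real)
      \<Rightarrow> ('m \<Rightarrow> 'n) \<Rightarrow> ('m \<Rightarrow> real) \<Rightarrow> bool" where
  "horizontally_conformal A g B g' F dil \<longleftrightarrow> (\<forall>p. dil p > 0) \<and>
     (\<forall>X\<in>sections A (horizontal A g B F). \<forall>Y\<in>sections A (horizontal A g B F). \<forall>p.
        g' (F p) (tangent_map A B F p (X p)) (tangent_map A B F p (Y p)) = (dil p)\<^sup>2 * g p (X p) (Y p))"

definition conformal_lagrangian_submersion ::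
    "('m::topological_space, 'e::euclidean_space) chart set \<Rightarrow> ('m \<Rightarrow> 'e \<Rightarrow> 'e \<Rightarrow> real)
      \<Rightarrow> ('m \<Rightarrow> 'e \<Rightarrow> 'e)
      \<Rightarrow> ('n::topological_space, 'f::euclidean_space) chart set \<Rightarrow> ('n \<Rightarrow> 'f \<Rightarrow> 'f \<Rightarrow> real)
      \<Rightarrow> ('m \<Rightarrow> 'n) \<Rightarrow> ('m \<Rightarrow> real) \<Rightarrow> bool" where
  "conformal_lagrangian_submersion A g J B g' F dil \<longleftrightarrow>
     smooth_submersion A B F \<and> horizontally_conformal A g B g' F dil \<and>
     (\<forall>p. J p ` vertical A B F p = horizontal A g B F p)"

subsection \<open>O'Neill's tensors\<close>

text \<open>The orthogonal projection of a tangent vector onto a subspace \<open>D\<close> for the inner product \<open>b\<close>.\<close>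
definition orth_proj :: "('e \<Rightarrow> 'e \<Rightarrow> real) \<Rightarrow> 'e::euclidean_space set \<Rightarrow> 'e \<Rightarrow> 'e" where
  "orth_proj b D w = (THE v. v \<in> D \<and> (\<forall>u\<in>D. b u (w - v) = 0))"

definition vert_part ::
    "('m, 'e::euclidean_space) chart set \<Rightarrow> ('m \<Rightarrow> 'e \<Rightarrow> 'e \<Rightarrow> real)
      \<Rightarrow> ('n, 'f::euclidean_space) chart set \<Rightarrow> ('m \<Rightarrow> 'n) \<Rightarrow> ('m \<Rightarrow> 'e) \<Rightarrow> 'm \<Rightarrow> 'e" where
  "vert_part A g B F E p = orth_proj (g p) (vertical A B F p) (E p)"

definition hor_part ::
    "('m, 'e::euclidean_space) chart set \<Rightarrow> ('m \<Rightarrow> 'e \<Rightarrow> 'e \<Rightarrow> real)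
      \<Rightarrow> ('n, 'f::euclidean_space) chart set \<Rightarrow> ('m \<Rightarrow> 'n) \<Rightarrow> ('m \<Rightarrow> 'e) \<Rightarrow> 'm \<Rightarrow> 'e" where
  "hor_part A g B F E p = orth_proj (g p) (horizontal A g B F p) (E p)"

definition oneill_A ::
    "('m, 'e::euclidean_space) chart set \<Rightarrow> ('m \<Rightarrow> 'e \<Rightarrow> 'e \<Rightarrow> real)
      \<Rightarrow> (('m \<Rightarrow> 'e) \<Rightarrow> ('m \<Rightarrow> 'e) \<Rightarrow> 'm \<Rightarrow> 'e)
      \<Rightarrow> ('n, 'f::euclidean_space) chart set \<Rightarrow> ('m \<Rightarrow> 'n)
      \<Rightarrow> ('m \<Rightarrow> 'e) \<Rightarrow> ('m \<Rightarrow> 'e) \<Rightarrow> 'm \<Rightarrow> 'e" where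
  "oneill_A A g nabla B F E G p =
     (let V = vert_part A g B F; H = hor_part A g B F
      in V (nabla (H E) (H G)) p + H (nabla (H E) (V G)) p)"

definition oneill_T ::
    "('m, 'e::euclidean_space) chart set \<Rightarrow> ('m \<Rightarrow> 'e \<Rightarrow> 'e \<Rightarrow> real)
      \<Rightarrow> (('m \<Rightarrow> 'e) \<Rightarrow> ('m \<Rightarrow> 'e) \<Rightarrow> 'm \<Rightarrow> 'e)
      \<Rightarrow> ('n, 'f::euclidean_space) chart set \<Rightarrow> ('m \<Rightarrow> 'n)
      \<Rightarrow> ('m \<Rightarrow> 'e) \<Rightarrow> ('m \<Rightarrow> 'e) \<Rightarrow> 'm \<Rightarrow> 'e" where
  "oneill_T A g nabla B F E G p =
     (let V = vert_part A g B F; H = hor_part A g B F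
      in H (nabla (V E) (V G)) p + V (nabla (V E) (H G)) p)"

subsection \<open>Locally product manifolds\<close>

text \<open>
  Around every point there is a chart \<open>(U, \<psi>)\<close> of the maximal atlas that identifies \<open>U\<close> with a product
  of \<open>P1\<close> and \<open>P2\<close>, open subsets of complementary linear subspaces \<open>S1\<close> and \<open>S2\<close> of the model space
  (the point \<open>(x, y)\<close> of the product being written \<open>x + y\<close>), such that
  the slices \<open>\<psi> -` (P1 + y)\<close> and \<open>\<psi> -` (x + P2)\<close> are integral manifolds of \<open>D1\<close> and \<open>D2\<close>, and the metric
  \<open>g\<close> on \<open>U\<close> is the product of a metric \<open>h1\<close> on \<open>P1\<close> and a metric \<open>h2\<close> on \<open>P2\<close>.
  Since \<open>h1\<close> and \<open>h2\<close> are the restrictions of \<open>g\<close> to slices, they are Riemannian metrics automatically.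
\<close>
definition locally_product ::
    "('m::{t2_space,second_countable_topology}, 'e::euclidean_space) chart set
      \<Rightarrow> ('m \<Rightarrow> 'e \<Rightarrow> 'e \<Rightarrow> real) \<Rightarrow> ('m \<Rightarrow> 'e set) \<Rightarrow> ('m \<Rightarrow> 'e set) \<Rightarrow> bool" where
  "locally_product A g D1 D2 \<longleftrightarrow>
     (\<forall>p. \<exists>U \<psi> S1 S2 P1 P2 (h1 :: 'e \<Rightarrow> 'e \<Rightarrow> 'e \<Rightarrow> real) (h2 :: 'e \<Rightarrow> 'e \<Rightarrow> 'e \<Rightarrow> real).
        p \<in> U \<and> smooth_chart A (U, \<psi>) \<and>
        subspace S1 \<and> subspace S2 \<and> S1 \<inter> S2 = {0} \<and> {a + b | a b. a \<in> S1 \<and> b \<in> S2} = UNIV \<and>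
        openin (top_of_set S1) P1 \<and> openin (top_of_set S2) P2 \<and>
        \<psi> ` U = {x + y | x y. x \<in> P1 \<and> y \<in> P2} \<and>
        (\<forall>q\<in>U. D1 q = {v. mderiv A \<psi> q v \<in> S1} \<and> D2 q = {v. mderiv A \<psi> q v \<in> S2}) \<and>
        (\<forall>q\<in>U. \<forall>x\<in>P1. \<forall>y\<in>P2. \<forall>v w. \<forall>a\<in>S1. \<forall>a'\<in>S1. \<forall>b\<in>S2. \<forall>b'\<in>S2.
           \<psi> q = x + y \<longrightarrow> mderiv A \<psi> q v = a + b \<longrightarrow> mderiv A \<psi> q w = a' + b' \<longrightarrow>
           g q v w = h1 x a a' + h2 y b b'))"

end

theory Submission
  imports Defs
begin

text \<open>
  \<^bold>\<open>Reduction to totally geodesic distributions.\<close> The structure \<open>J\<close> is parallel and interchanges vertical and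
  horizontal vectors. Hence \<open>A\<^sub>X J Y\<close> is the horizontal part of \<open>J (\<nabla>\<^sub>X Y)\<close>, which vanishes iff \<open>\<nabla>\<^sub>X Y\<close> is horizontal, and
  \<open>T\<^sub>V J W\<close> is the vertical part of \<open>J (\<nabla>\<^sub>V W)\<close>, which vanishes iff \<open>\<nabla>\<^sub>V W\<close> is vertical (\<open>oneill_A_zero_iff\<close>,
  \<open>oneill_T_zero_iff\<close>). So the two tensor conditions say that both distributions are totally geodesic.

  \<^bold>\<open>Products are geodesic.\<close> In a product chart the mixed metric coefficients vanish, and the coefficients along
  one factor are constant along the other one. By Koszul's formula the covariant derivative of fields tangent
  to one factor stays tangent to it (\<open>product_factor_geodesic\<close>).

  \<^bold>\<open>Geodesic splittings are products.\<close> Totally geodesic orthogonal distributions have a parallel projection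
  (\<open>P_parallel\<close>). The curvature commutes with this projection and with \<open>J\<close>. Therefore \<open>R(X, Y)\<close> vanishes for vertical \<open>X\<close> and
  horizontal \<open>Y\<close> by pair symmetry; for two vertical vectors it vanishes on horizontal ones by the Bianchi identity and
  on vertical ones because \<open>J\<close> makes them horizontal, and likewise for two horizontal vectors: the manifold is flat (\<open>curvature_vanishes\<close>). On a flat
  manifold there are functions with parallel differential: a function and its differential together solve a linear
  total differential equation, integrable by flatness and absence of torsion (\<open>linear_total_equation\<close>,
  \<open>affine_function\<close>). Such functions are coordinates in which the metric and the projection have constant
  coefficients (\<open>flat_coordinates\<close>), and a chart of this kind is a product chart
  (\<open>geodesic_imp_locally_product\<close>). Flatness thus replaces the integration of the two distributions by nonlinear
  equations.

  \<^bold>\<open>Analytic tools.\<close> The linear total equation is solved by a contraction for its integral form along rays from the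
  centre; a second order estimate then shows that the solution is differentiable. The vertical projection is smooth
  because it solves a linear system whose matrix \<open>(F\<^sub>*, F\<^sub>* J)\<close> is a smooth family of isomorphisms
  (\<open>P_endomorphism\<close>). Connections and metrics are given on global fields only; cutoff functions extend the
  coordinate fields of a chart and give access to their coefficients (\<open>nabla_in_chart\<close>).
\<close>

section \<open>Smooth functions on open sets\<close>

abbreviation FD :: "('a::real_normed_vector \<Rightarrow> 'b::real_normed_vector) \<Rightarrow> 'a \<Rightarrow> 'a \<Rightarrow> 'b" where
  "FD f x \<equiv> frechet_derivative f (at x)"

lemma FD_works: "f differentiable (at x) \<Longrightarrow> (f has_derivative FD f x) (at x)"
  by (simp add: frechet_derivative_works)

lemma FD_eq: "(f has_derivative f') (at x) \<Longrightarrow> FD f x = f'"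
  by (metis frechet_derivative_at)

lemma FD_cong_open:
  assumes "open S" "x \<in> S" "\<And>y. y \<in> S \<Longrightarrow> f y = g y"
  shows "FD f x = FD g x"
proof -
  have "(f has_derivative f') (at x) \<longleftrightarrow> (g has_derivative f') (at x)" for f'
    using assms has_derivative_transform_within_open[of f f' x UNIV S g]
      has_derivative_transform_within_open[of g f' x UNIV S f] by fastforce
  then show ?thesis by (simp add: frechet_derivative_def)
qed

lemma differentiable_cong_open:
  assumes "open S" "x \<in> S" "\<And>y. y \<in> S \<Longrightarrow> f y = g y"
  shows "f differentiable (at x) \<longleftrightarrow> g differentiable (at x)"
  using assms has_derivative_transform_within_open[of f _ x UNIV S g]
      has_derivative_transform_within_open[of g _ x UNIV S f]
  unfolding differentiable_def by metis

lemma Ck_on_cong: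
  assumes "open S" "\<And>x. x \<in> S \<Longrightarrow> f x = g x"
  shows "Ck_on k S f \<longleftrightarrow> Ck_on k S g"
  using assms
proof (induction k arbitrary: f g)
  case 0
  then show ?case by (simp cong: continuous_on_cong)
next
  case (Suc k)
  have "Ck_on k S (\<lambda>x. FD f x v) = Ck_on k S (\<lambda>x. FD g x v)" for v
    by (rule Suc.IH) (use Suc.prems FD_cong_open[of S _ f g] in auto)
  then show ?case using Suc.prems differentiable_cong_open[of S _ f g] by auto
qed

lemma Ck_on_SucI:
  assumes "open S" "\<And>x. x \<in> S \<Longrightarrow> (f has_derivative f' x) (at x)"
    "\<And>v. Ck_on k S (\<lambda>x. f' x v)"
  shows "Ck_on (Suc k) S f"
proof -
  have "Ck_on k S (\<lambda>x. FD f x v) = Ck_on k S (\<lambda>x. f' x v)" for v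
    by (rule Ck_on_cong) (use assms(1) FD_eq[OF assms(2)] in auto)
  then show ?thesis using assms by (auto simp: differentiable_def)
qed

lemma Ck_on_imp_continuous_on: "Ck_on k S f \<Longrightarrow> continuous_on S f"
  proof (cases k)
  case (Suc m)
  assume "Ck_on k S f"
  then have "f differentiable (at x)" if "x \<in> S" for x using Suc that by simp
  then show ?thesis by (intro continuous_at_imp_continuous_on ballI differentiable_imp_continuous_within)
qed auto

lemma Ck_on_Suc_imp: "Ck_on (Suc k) S f \<Longrightarrow> Ck_on k S f"
proof (induction k arbitrary: f)
  case 0
  from Ck_on_imp_continuous_on[OF 0] show ?case by simp
qed auto

lemma Ck_on_subset: "Ck_on k S f \<Longrightarrow> T \<subseteq> S \<Longrightarrow> Ck_on k T f"
  by (induction k arbitrary: f) (auto intro: continuous_on_subset)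

lemma Ck_on_local:
  assumes "open S" "\<And>x. x \<in> S \<Longrightarrow> \<exists>T. open T \<and> x \<in> T \<and> Ck_on k T f"
  shows "Ck_on k S f"
  using assms
proof (induction k arbitrary: f)
  case 0
  have "isCont f x" if x: "x \<in> S" for x
    using 0(2)[OF x] continuous_on_eq_continuous_at by auto
  then show ?case by (simp add: continuous_at_imp_continuous_on)
next
  case (Suc k)
  have d: "f differentiable (at x)" if x: "x \<in> S" for x
    using Suc.prems(2)[OF x] by auto
  have "Ck_on k S (\<lambda>x. FD f x v)" for v
    by (rule Suc.IH[OF Suc.prems(1)]) (use Suc.prems(2) in fastforce)
  with d show ?case by auto
qed

lemma Ck_on_const: "Ck_on k S (\<lambda>x. c)"
proof (induction k arbitrary: c)
  case (Suc k)
  show ?case using Suc[of 0] by simp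
qed auto

lemma Ck_on_linear:
  assumes "open S" "bounded_linear L" "Ck_on k S f"
  shows "Ck_on k S (\<lambda>x. L (f x))"
  using assms(3)
proof (induction k arbitrary: f)
  case 0
  then show ?case using assms(2)
    by (auto intro: bounded_linear.continuous_on)
next
  case (Suc k)
  show ?case
  proof (rule Ck_on_SucI[OF assms(1), where f' = "\<lambda>x v. L (FD f x v)"])
    show "((\<lambda>x. L (f x)) has_derivative (\<lambda>v. L (FD f x v))) (at x)" if "x \<in> S" for x
      using Suc.prems that by (auto intro!: bounded_linear.has_derivative[OF assms(2)] FD_works)
    show "Ck_on k S (\<lambda>x. L (FD f x v))" for v
      using Suc by auto
  qed
qed

lemma Ck_on_add:
  assumes "open S" "Ck_on k S f" "Ck_on k S g"
  shows "Ck_on k S (\<lambda>x. f x + g x)"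
  using assms(2,3)
proof (induction k arbitrary: f g)
  case 0
  then show ?case by (auto intro: continuous_on_add)
next
  case (Suc k)
  show ?case
  proof (rule Ck_on_SucI[OF assms(1), where f' = "\<lambda>x v. FD f x v + FD g x v"])
    show "((\<lambda>x. f x + g x) has_derivative (\<lambda>v. FD f x v + FD g x v)) (at x)" if "x \<in> S" for x
      using Suc.prems that by (auto intro!: has_derivative_add FD_works)
    show "Ck_on k S (\<lambda>x. FD f x v + FD g x v)" for v
      using Suc by auto
  qed
qed

lemma Ck_on_bilinear:
  assumes "open S" "bounded_bilinear P" "Ck_on k S f" "Ck_on k S g"
  shows "Ck_on k S (\<lambda>x. P (f x) (g x))"
  using assms(3,4)
proof (induction k arbitrary: f g)
  case 0
  then show ?case using assms(2) by (auto intro: bounded_bilinear.continuous_on)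
next
  case (Suc k)
  show ?case
  proof (rule Ck_on_SucI[OF assms(1), where f' = "\<lambda>x v. P (f x) (FD g x v) + P (FD f x v) (g x)"])
    show "((\<lambda>x. P (f x) (g x)) has_derivative (\<lambda>v. P (f x) (FD g x v) + P (FD f x v) (g x))) (at x)"
      if "x \<in> S" for x
      using Suc.prems that by (auto intro!: bounded_bilinear.FDERIV[OF assms(2)] FD_works)
    show "Ck_on k S (\<lambda>x. P (f x) (FD g x v) + P (FD f x v) (g x))" for v
      using Suc.prems Suc.IH Ck_on_Suc_imp[OF Suc.prems(1)] Ck_on_Suc_imp[OF Suc.prems(2)]
      by (intro Ck_on_add assms(1)) auto
  qed
qed

lemma Ck_on_sum:
  assumes "open S" "\<And>i. i \<in> I \<Longrightarrow> Ck_on k S (f i)"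
  shows "Ck_on k S (\<lambda>x. \<Sum>i\<in>I. f i x)"
proof (cases "finite I")
  case True
  then show ?thesis using assms(2)
    by (induction I) (auto intro: Ck_on_const Ck_on_add[OF assms(1)])
qed (simp add: Ck_on_const)

lemma linear_basis_expand:
  fixes L :: "'a::euclidean_space \<Rightarrow> 'b::real_vector"
  assumes "linear L" shows "L v = (\<Sum>i\<in>Basis. (v \<bullet> i) *\<^sub>R L i)"
  by (subst euclidean_representation[of v, symmetric])
     (simp only: linear_sum[OF assms] linear_cmul[OF assms])

text \<open>The chain rule involves the differential of \<open>g\<close> at a moving point in a moving direction. Expanded in an
  orthonormal basis it becomes a sum of products of functions of lower order, the factors
  \<open>FD g (f x) i\<close> being compositions again; so the induction runs over all \<open>g\<close> at once.\<close>

lemma Ck_on_compose: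
  fixes f :: "'a::euclidean_space \<Rightarrow> 'b::euclidean_space" and g :: "'b \<Rightarrow> 'c::real_normed_vector"
  assumes S: "open S" and "Ck_on k T g" "Ck_on k S f" and im: "f ` S \<subseteq> T"
  shows "Ck_on k S (\<lambda>x. g (f x))"
  using assms(2,3)
proof (induction k arbitrary: g)
  case 0
  then show ?case using im by (auto intro: continuous_on_compose2)
next
  case (Suc k)
  have dg: "g differentiable (at (f x))" if "x \<in> S" for x using Suc.prems that im by auto
  show ?case
  proof (rule Ck_on_SucI[OF S, where f' = "\<lambda>x v. \<Sum>i\<in>Basis. (FD f x v \<bullet> i) *\<^sub>R FD g (f x) i"])
    fix x assume x: "x \<in> S"
    have "((\<lambda>x. g (f x)) has_derivative (\<lambda>v. FD g (f x) (FD f x v))) (at x)"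
      using Suc.prems x dg[OF x] by (intro has_derivative_compose[of f _ x UNIV g] FD_works) auto
    moreover have "(\<lambda>v. FD g (f x) (FD f x v)) = (\<lambda>v. \<Sum>i\<in>Basis. (FD f x v \<bullet> i) *\<^sub>R FD g (f x) i)"
      by (rule ext, rule linear_basis_expand[OF linear_frechet_derivative[OF dg[OF x]]])
    ultimately show "((\<lambda>x. g (f x)) has_derivative (\<lambda>v. \<Sum>i\<in>Basis. (FD f x v \<bullet> i) *\<^sub>R FD g (f x) i)) (at x)"
      by metis
  next
    fix v
    have "Ck_on k S (\<lambda>x. FD f x v)" "Ck_on k S f"
      using Suc.prems Ck_on_Suc_imp by auto
    moreover have "Ck_on k S (\<lambda>x. FD g (f x) i)" for i
      using Suc.prems(1) \<open>Ck_on k S f\<close> by (intro Suc.IH) auto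
    ultimately show "Ck_on k S (\<lambda>x. \<Sum>i\<in>Basis. (FD f x v \<bullet> i) *\<^sub>R FD g (f x) i)"
      by (intro Ck_on_sum S Ck_on_bilinear[OF S bounded_bilinear_scaleR]
          Ck_on_linear[OF S bounded_linear_inner_left])
  qed
qed

lemma Ck_on_ident:
  fixes S :: "'a::euclidean_space set"
  assumes "open S" shows "Ck_on k S (\<lambda>x. x)"
proof (cases k)
  case (Suc m)
  show ?thesis unfolding Suc
    by (rule Ck_on_SucI[OF assms, where f' = "\<lambda>x v. v"]) (auto intro: Ck_on_const)
qed auto

lemma smooth_on_cong: "open S \<Longrightarrow> (\<And>x. x \<in> S \<Longrightarrow> f x = g x) \<Longrightarrow> smooth_on S f \<longleftrightarrow> smooth_on S g"
  by (simp add: smooth_on_def Ck_on_cong[of S f g])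

lemma smooth_on_subset: "smooth_on S f \<Longrightarrow> T \<subseteq> S \<Longrightarrow> smooth_on T f"
  by (auto simp: smooth_on_def intro: Ck_on_subset)

lemma smooth_on_local:
  assumes "open S" "\<And>x. x \<in> S \<Longrightarrow> \<exists>T. open T \<and> x \<in> T \<and> smooth_on T f"
  shows "smooth_on S f"
  unfolding smooth_on_def
proof
  show "Ck_on k S f" for k
  proof (rule Ck_on_local[OF assms(1)])
    show "\<exists>T. open T \<and> x \<in> T \<and> Ck_on k T f" if "x \<in> S" for x
      using assms(2)[OF that] by (auto simp: smooth_on_def)
  qed
qed

lemma smooth_on_Un:
  assumes "open S" "open T" "smooth_on S f" "smooth_on T f" shows "smooth_on (S \<union> T) f"
  using assms by (intro smooth_on_local) auto

lemma smooth_on_continuous: "smooth_on S f \<Longrightarrow> continuous_on S f"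
  unfolding smooth_on_def using Ck_on_imp_continuous_on by blast

lemma smooth_on_Ck: "smooth_on S f \<Longrightarrow> Ck_on k S f"
  by (simp add: smooth_on_def)

lemma smooth_on_differentiable: "smooth_on S f \<Longrightarrow> x \<in> S \<Longrightarrow> f differentiable (at x)"
  by (drule smooth_on_Ck[where k = "Suc 0"]) simp

lemma smooth_on_has_derivative: "smooth_on S f \<Longrightarrow> x \<in> S \<Longrightarrow> (f has_derivative FD f x) (at x)"
  by (rule FD_works[OF smooth_on_differentiable])

lemma smooth_on_FD: "smooth_on S f \<Longrightarrow> smooth_on S (\<lambda>x. FD f x v)"
  unfolding smooth_on_def[of S "\<lambda>x. FD f x v"] by (metis Ck_on.simps(2) smooth_on_Ck)

lemma smooth_on_linear_FD: "smooth_on S f \<Longrightarrow> x \<in> S \<Longrightarrow> linear (FD f x)"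
  by (rule linear_frechet_derivative[OF smooth_on_differentiable])

lemma smooth_on_const: "smooth_on S (\<lambda>x. c)"
  by (simp add: smooth_on_def Ck_on_const)

lemma smooth_on_ident: "open S \<Longrightarrow> smooth_on S (\<lambda>x::'a::euclidean_space. x)"
  by (simp add: smooth_on_def Ck_on_ident)

lemma smooth_on_linear:
  "open S \<Longrightarrow> bounded_linear L \<Longrightarrow> smooth_on S f \<Longrightarrow> smooth_on S (\<lambda>x. L (f x))"
  by (simp add: smooth_on_def Ck_on_linear)

lemma smooth_on_add:
  "open S \<Longrightarrow> smooth_on S f \<Longrightarrow> smooth_on S g \<Longrightarrow> smooth_on S (\<lambda>x. f x + g x)"
  by (simp add: smooth_on_def Ck_on_add)

lemma smooth_on_bilinear:
  "open S \<Longrightarrow> bounded_bilinear P \<Longrightarrow> smooth_on S f \<Longrightarrow> smooth_on S g \<Longrightarrow> smooth_on S (\<lambda>x. P (f x) (g x))"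
  by (simp add: smooth_on_def Ck_on_bilinear)

lemma smooth_on_scaleR:
  "open S \<Longrightarrow> smooth_on S f \<Longrightarrow> smooth_on S g \<Longrightarrow> smooth_on S (\<lambda>x. f x *\<^sub>R g x)"
  by (rule smooth_on_bilinear[OF _ bounded_bilinear_scaleR])

lemma smooth_on_inner:
  "open S \<Longrightarrow> smooth_on S f \<Longrightarrow> smooth_on S g \<Longrightarrow> smooth_on S (\<lambda>x. f x \<bullet> g x)"
  by (rule smooth_on_bilinear[OF _ bounded_bilinear_inner])

lemma smooth_on_minus:
  "open S \<Longrightarrow> smooth_on S f \<Longrightarrow> smooth_on S (\<lambda>x. - f x)"
  by (rule smooth_on_linear[OF _ bounded_linear_minus[OF bounded_linear_ident]])

lemma smooth_on_diff:
  "open S \<Longrightarrow> smooth_on S f \<Longrightarrow> smooth_on S g \<Longrightarrow> smooth_on S (\<lambda>x. f x - g x)"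
  using smooth_on_add[of S f "\<lambda>x. - g x"] smooth_on_minus[of S g] by simp

lemma smooth_on_sum:
  "open S \<Longrightarrow> (\<And>i. i \<in> I \<Longrightarrow> smooth_on S (f i)) \<Longrightarrow> smooth_on S (\<lambda>x. \<Sum>i\<in>I. f i x)"
  by (simp add: smooth_on_def Ck_on_sum)

lemma smooth_on_compose:
  fixes f :: "'a::euclidean_space \<Rightarrow> 'b::euclidean_space" and g :: "'b \<Rightarrow> 'c::real_normed_vector"
  assumes "open S" "smooth_on T g" "smooth_on S f" "f ` S \<subseteq> T"
  shows "smooth_on S (\<lambda>x. g (f x))"
  unfolding smooth_on_def
  by (rule allI, rule Ck_on_compose[OF assms(1) smooth_on_Ck[OF assms(2)] smooth_on_Ck[OF assms(3)] assms(4)])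

text \<open>A family of linear maps enters the differential calculus through its values on fixed vectors
  only. Expanding the argument in an orthonormal basis gives the product rule for it.\<close>

lemma Ck_on_family_apply:
  fixes K :: "'a::euclidean_space \<Rightarrow> 'b::euclidean_space \<Rightarrow> 'c::real_normed_vector"
  assumes S: "open S" and "\<And>x. x \<in> S \<Longrightarrow> linear (K x)" "\<And>w. Ck_on k S (\<lambda>x. K x w)"
    and "Ck_on k S a"
  shows "Ck_on k S (\<lambda>x. K x (a x))"
proof -
  have "Ck_on k S (\<lambda>x. \<Sum>i\<in>Basis. (a x \<bullet> i) *\<^sub>R K x i)"
    using assms by (intro Ck_on_sum S Ck_on_bilinear[OF S bounded_bilinear_scaleR]
          Ck_on_linear[OF S bounded_linear_inner_left])
  moreover have "Ck_on k S (\<lambda>x. K x (a x)) \<longleftrightarrow> Ck_on k S (\<lambda>x. \<Sum>i\<in>Basis. (a x \<bullet> i) *\<^sub>R K x i)"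
    by (rule Ck_on_cong[OF S], rule linear_basis_expand[OF assms(2)])
  ultimately show ?thesis by simp
qed

lemma smooth_on_family_apply:
  fixes K :: "'a::euclidean_space \<Rightarrow> 'b::euclidean_space \<Rightarrow> 'c::real_normed_vector"
  assumes "open S" "\<And>x. x \<in> S \<Longrightarrow> linear (K x)" "\<And>w. smooth_on S (\<lambda>x. K x w)" "smooth_on S a"
  shows "smooth_on S (\<lambda>x. K x (a x))"
  unfolding smooth_on_def
  by (rule allI, rule Ck_on_family_apply[OF assms(1,2) smooth_on_Ck[OF assms(3)] smooth_on_Ck[OF assms(4)]])

lemma has_derivative_family_apply:
  fixes K :: "'a::real_normed_vector \<Rightarrow> 'b::euclidean_space \<Rightarrow> 'c::real_normed_vector"
  assumes lin: "\<And>y. y \<in> S \<Longrightarrow> linear (K y)" and S: "open S" "x \<in> S"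
    and K': "\<And>w. ((\<lambda>y. K y w) has_derivative (\<lambda>h. K' h w)) (at x)"
    and a: "(a has_derivative a') (at x)"
  shows "((\<lambda>y. K y (a y)) has_derivative (\<lambda>h. K' h (a x) + K x (a' h))) (at x)"
proof -
  have linK': "linear (K' h)" for h
  proof (rule linearI)
    show "K' h (v + w) = K' h v + K' h w" for v w
    proof -
      have "((\<lambda>y. K y v + K y w) has_derivative (\<lambda>h. K' h v + K' h w)) (at x)"
        by (intro has_derivative_add K')
      then have "((\<lambda>y. K y (v + w)) has_derivative (\<lambda>h. K' h v + K' h w)) (at x)"
        by (rule has_derivative_transform_within_open[OF _ S]) (simp add: linear_add lin)
      from has_derivative_unique[OF K' this] show ?thesis by meson
    qed
    show "K' h (c *\<^sub>R v) = c *\<^sub>R K' h v" for c v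
    proof -
      have "((\<lambda>y. c *\<^sub>R K y v) has_derivative (\<lambda>h. c *\<^sub>R K' h v)) (at x)"
        by (intro has_derivative_scaleR_right K')
      then have "((\<lambda>y. K y (c *\<^sub>R v)) has_derivative (\<lambda>h. c *\<^sub>R K' h v)) (at x)"
        by (rule has_derivative_transform_within_open[OF _ S]) (simp add: linear_cmul lin)
      from has_derivative_unique[OF K' this] show ?thesis by meson
    qed
  qed
  have "((\<lambda>y. \<Sum>i\<in>Basis. (a y \<bullet> i) *\<^sub>R K y i) has_derivative
     (\<lambda>h. \<Sum>i\<in>Basis. (a x \<bullet> i) *\<^sub>R K' h i + (a' h \<bullet> i) *\<^sub>R K x i)) (at x)"
    by (intro has_derivative_sum has_derivative_scaleR K'
        bounded_linear.has_derivative[OF bounded_linear_inner_left] a)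
  moreover have "(\<lambda>h. \<Sum>i\<in>Basis. (a x \<bullet> i) *\<^sub>R K' h i + (a' h \<bullet> i) *\<^sub>R K x i)
      = (\<lambda>h. K' h (a x) + K x (a' h))"
  proof
    show "(\<Sum>i\<in>Basis. (a x \<bullet> i) *\<^sub>R K' h i + (a' h \<bullet> i) *\<^sub>R K x i) = K' h (a x) + K x (a' h)" for h
      unfolding linear_basis_expand[OF linK', of h "a x"]
        linear_basis_expand[OF lin[OF S(2)], of "a' h"] by (rule sum.distrib)
  qed
  ultimately have "((\<lambda>y. \<Sum>i\<in>Basis. (a y \<bullet> i) *\<^sub>R K y i) has_derivative
      (\<lambda>h. K' h (a x) + K x (a' h))) (at x)" by simp
  then show ?thesis
    by (rule has_derivative_transform_within_open[OF _ S]) (rule linear_basis_expand[OF lin, symmetric])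
qed

lemma smooth_on_FD_apply:
  fixes f :: "'a::euclidean_space \<Rightarrow> 'b::real_normed_vector"
  assumes "open S" "smooth_on S f" "smooth_on S a"
  shows "smooth_on S (\<lambda>x. FD f x (a x))"
  by (rule smooth_on_family_apply[OF assms(1) smooth_on_linear_FD[OF assms(2)] smooth_on_FD[OF assms(2)] assms(3)])

section \<open>Cutoff functions\<close>

text \<open>The powers of \<open>1 / t\<close> make the family closed under differentiation.\<close>

definition flat_exp :: "nat \<Rightarrow> real \<Rightarrow> real" where
  "flat_exp n t = (if t \<le> 0 then 0 else exp (- inverse t) * inverse t ^ n)"

lemma flat_exp_tendsto_0: "(flat_exp n \<longlongrightarrow> 0) (at_right 0)"
proof -
  have "((\<lambda>t. (inverse t) ^ n / exp (inverse t)) \<longlongrightarrow> (0::real)) (at_right 0)"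
    by (rule filterlim_compose[OF tendsto_power_div_exp_0 filterlim_inverse_at_top_right])
  then show ?thesis
    by (rule Lim_transform_eventually)
       (auto simp: flat_exp_def eventually_at_right_field exp_minus divide_inverse mult.commute intro!: exI[of _ 1])
qed

lemma flat_exp_has_derivative:
  "(flat_exp n has_real_derivative flat_exp (n + 2) t - n * flat_exp (n + 1) t) (at t)"
proof -
  consider "t < 0" | "t = 0" | "t > 0" by linarith
  then show ?thesis
  proof cases
    case 1
    have "((\<lambda>t. 0) has_real_derivative 0) (at t)" by simp
    then have "(flat_exp n has_real_derivative 0) (at t)"
      by (rule has_field_derivative_transform_within_open[where S = "{..<0}"])
         (use 1 in \<open>auto simp: flat_exp_def\<close>)
    then show ?thesis using 1 by (simp add: flat_exp_def)
  next
    case 2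
    have "((\<lambda>h. (flat_exp n (0 + h) - flat_exp n 0) / h) \<longlongrightarrow> 0) (at 0)"
      unfolding filterlim_at_split
    proof
      show "((\<lambda>h. (flat_exp n (0 + h) - flat_exp n 0) / h) \<longlongrightarrow> 0) (at_left 0)"
        by (rule Lim_transform_eventually[of "\<lambda>_. 0"])
           (auto simp: flat_exp_def eventually_at_left_field intro!: exI[of _ "-1"])
      show "((\<lambda>h. (flat_exp n (0 + h) - flat_exp n 0) / h) \<longlongrightarrow> 0) (at_right 0)"
        by (rule Lim_transform_eventually[OF flat_exp_tendsto_0[of "n + 1"]])
           (auto simp: flat_exp_def eventually_at_right_field divide_inverse intro!: exI[of _ 1])
    qed
    then have "(flat_exp n has_real_derivative 0) (at 0)" unfolding DERIV_def .
    then show ?thesis using 2 by (simp add: flat_exp_def)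
  next
    case 3
    have "((\<lambda>t. exp (- inverse t) * inverse t ^ n) has_real_derivative
        flat_exp (n + 2) t - n * flat_exp (n + 1) t) (at t)"
    proof (cases n)
      case 0
      show ?thesis using 3
        by (auto intro!: derivative_eq_intros simp: 0 flat_exp_def power2_eq_square field_simps)
    next
      case (Suc m)
      have inv: "(inverse has_real_derivative - (inverse t ^ Suc (Suc 0))) (at t)"
        using 3 by (intro DERIV_inverse) simp
      note e = DERIV_fun_exp[OF DERIV_minus[OF inv]]
      show ?thesis unfolding Suc
        by (rule DERIV_cong[OF DERIV_mult[OF e DERIV_power_Suc[OF inv]]])
           (use 3 in \<open>simp add: flat_exp_def algebra_simps\<close>)
    qed
    then show ?thesis
      by (rule has_field_derivative_transform_within_open[where S = "{0<..}"])
         (use 3 in \<open>auto simp: flat_exp_def\<close>)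
  qed
qed

lemma smooth_on_flat_exp: "smooth_on UNIV (flat_exp n)"
proof -
  have "Ck_on k UNIV (flat_exp n)" for k
  proof (induction k arbitrary: n)
    case 0
    then show ?case
      using flat_exp_has_derivative by (auto intro!: continuous_at_imp_continuous_on DERIV_isCont)
  next
    case (Suc k)
    show ?case
    proof (rule Ck_on_SucI[where f' = "\<lambda>t v. v *\<^sub>R (flat_exp (n + 2) t + (- real n) *\<^sub>R flat_exp (n + 1) t)"])
      show "(flat_exp n has_derivative (\<lambda>v. v *\<^sub>R (flat_exp (n + 2) t + (- real n) *\<^sub>R flat_exp (n + 1) t))) (at t)" for t
        using flat_exp_has_derivative[of n t]
        by (simp add: has_field_derivative_def mult.commute[of _ "flat_exp _ _ - _"])
      show "Ck_on k UNIV (\<lambda>t. v *\<^sub>R (flat_exp (n + 2) t + (- real n) *\<^sub>R flat_exp (n + 1) t))" for v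
        by (rule Ck_on_linear[OF open_UNIV bounded_linear_scaleR_right],
            rule Ck_on_add[OF open_UNIV Suc],
            rule Ck_on_linear[OF open_UNIV bounded_linear_scaleR_right], rule Suc)
    qed simp
  qed
  then show ?thesis by (simp add: smooth_on_def)
qed

text \<open>Composing the flat function with itself yields a plateau without any division of functions.\<close>

lemma smooth_step:
  obtains \<phi> :: "real \<Rightarrow> real" where "smooth_on UNIV \<phi>" "\<And>t. t \<le> 0 \<Longrightarrow> \<phi> t = 1" "\<And>t. t \<ge> 1 \<Longrightarrow> \<phi> t = 0"
proof -
  let ?h = "flat_exp 0"
  let ?c = "?h 1"
  define \<phi> where "\<phi> t = inverse (?h ?c) *\<^sub>R ?h (?c - ?h t)" for t
  have pos: "?c > 0" "?h ?c > 0" by (auto simp: flat_exp_def)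
  have "smooth_on UNIV (\<lambda>t. ?h (?c - ?h t))"
    by (rule smooth_on_compose[OF open_UNIV smooth_on_flat_exp])
       (auto intro: smooth_on_diff smooth_on_const smooth_on_flat_exp)
  then have "smooth_on UNIV \<phi>"
    unfolding \<phi>_def by (rule smooth_on_linear[OF open_UNIV bounded_linear_scaleR_right])
  moreover have "\<phi> t = 1" if "t \<le> 0" for t
  proof -
    have "?h t = 0" using that by (simp add: flat_exp_def)
    then show ?thesis using pos by (simp add: \<phi>_def)
  qed
  moreover have "\<phi> t = 0" if "t \<ge> 1" for t
  proof -
    have "?h t \<ge> ?c" using that by (simp add: flat_exp_def inverse_le_1_iff)
    then show ?thesis by (simp add: \<phi>_def flat_exp_def[of 0 "_ - _"])
  qed
  ultimately show thesis by (rule that)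
qed

lemma smooth_bump:
  fixes x0 :: "'a::euclidean_space"
  assumes "0 < r" "r < R"
  obtains \<beta> :: "'a \<Rightarrow> real" where "smooth_on UNIV \<beta>" "\<And>x. x \<in> cball x0 r \<Longrightarrow> \<beta> x = 1"
    "\<And>x. x \<notin> ball x0 R \<Longrightarrow> \<beta> x = 0"
proof -
  obtain \<phi> :: "real \<Rightarrow> real" where \<phi>: "smooth_on UNIV \<phi>" "\<And>t. t \<le> 0 \<Longrightarrow> \<phi> t = 1" "\<And>t. t \<ge> 1 \<Longrightarrow> \<phi> t = 0"
    using smooth_step by blast
  define q where "q x = inverse (R\<^sup>2 - r\<^sup>2) *\<^sub>R (((x - x0) \<bullet> (x - x0)) - r\<^sup>2)" for x
  have d: "R\<^sup>2 - r\<^sup>2 > 0" using assms by (simp add: power_strict_mono)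
  have sm: "smooth_on UNIV q" unfolding q_def
    by (rule smooth_on_linear[OF open_UNIV bounded_linear_scaleR_right], rule smooth_on_diff[OF open_UNIV],
        rule smooth_on_inner[OF open_UNIV])
       (rule smooth_on_diff smooth_on_ident smooth_on_const open_UNIV)+
  show thesis
  proof (rule that[of "\<lambda>x. \<phi> (q x)"])
    show "smooth_on UNIV (\<lambda>x. \<phi> (q x))"
      by (rule smooth_on_compose[OF open_UNIV \<phi>(1) sm]) auto
    show "\<phi> (q x) = 1" if "x \<in> cball x0 r" for x
    proof -
      have "(norm (x - x0))\<^sup>2 \<le> r\<^sup>2" using that by (intro power_mono) (auto simp: dist_norm norm_minus_commute)
      then show ?thesis using d
        by (intro \<phi>(2)) (simp add: q_def power2_norm_eq_inner[symmetric] mult_nonneg_nonpos)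
    qed
    show "\<phi> (q x) = 0" if "x \<notin> ball x0 R" for x
    proof -
      have "(norm (x - x0))\<^sup>2 \<ge> R\<^sup>2" using that assms by (intro power_mono) (auto simp: dist_norm norm_minus_commute)
      then show ?thesis using d
        by (intro \<phi>(3)) (simp add: q_def power2_norm_eq_inner[symmetric] field_simps)
    qed
  qed
qed

section \<open>Symmetry of second derivatives\<close>

text \<open>Two applications of the mean value theorem, first along \<open>u\<close>, then along \<open>v\<close>. The left hand side is
  symmetric in \<open>u\<close> and \<open>v\<close>, so both mixed derivatives are limits of the same second difference quotient.\<close>

lemma second_difference_mean_value:
  fixes f :: "'a::euclidean_space \<Rightarrow> real"
  assumes f: "smooth_on (ball x \<delta>) f" and t: "t > 0" "t * (norm u + norm v) < \<delta>"
  obtains y where "y \<in> ball x \<delta>"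
    "f (x + t *\<^sub>R u + t *\<^sub>R v) - f (x + t *\<^sub>R u) - (f (x + t *\<^sub>R v) - f x) = t * (t * FD (\<lambda>y. FD f y u) y v)"
proof -
  have inb: "x + a *\<^sub>R u + b *\<^sub>R v \<in> ball x \<delta>" if "0 \<le> a" "a \<le> t" "0 \<le> b" "b \<le> t" for a b
  proof -
    have "norm (a *\<^sub>R u + b *\<^sub>R v) \<le> a * norm u + b * norm v"
      using that by (intro order_trans[OF norm_triangle_ineq]) simp
    also have "\<dots> \<le> t * norm u + t * norm v" using that by (intro add_mono mult_right_mono) auto
    finally show ?thesis using t by (simp add: dist_norm algebra_simps norm_minus_commute)
  qed
  have d1: "((\<lambda>s. f (x + s *\<^sub>R u + b *\<^sub>R v)) has_real_derivative FD f (x + s *\<^sub>R u + b *\<^sub>R v) u) (at s)"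
    if "0 \<le> s" "s \<le> t" "0 \<le> b" "b \<le> t" for s b
  proof -
    have "((\<lambda>s. x + s *\<^sub>R u + b *\<^sub>R v) has_derivative (\<lambda>h. h *\<^sub>R u)) (at s)"
      by (auto intro!: derivative_eq_intros)
    from has_derivative_compose[OF this smooth_on_has_derivative[OF f inb[OF that]]]
    show ?thesis using linear_cmul[OF smooth_on_linear_FD[OF f inb[OF that]]]
      by (simp add: has_field_derivative_def mult.commute[of _ "FD f _ u"] )
  qed
  have "((\<lambda>s. f (x + s *\<^sub>R u + t *\<^sub>R v) - f (x + s *\<^sub>R u + 0 *\<^sub>R v)) has_real_derivative
      FD f (x + s *\<^sub>R u + t *\<^sub>R v) u - FD f (x + s *\<^sub>R u + 0 *\<^sub>R v) u) (at s)" if "0 \<le> s" "s \<le> t" for s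
    by (rule DERIV_diff) (rule d1; use that t in simp)+
  from MVT2[OF t(1) this] obtain s where s: "0 < s" "s < t"
    "f (x + t *\<^sub>R u + t *\<^sub>R v) - f (x + t *\<^sub>R u + 0 *\<^sub>R v) - (f (x + 0 *\<^sub>R u + t *\<^sub>R v) - f (x + 0 *\<^sub>R u + 0 *\<^sub>R v))
      = (t - 0) * (FD f (x + s *\<^sub>R u + t *\<^sub>R v) u - FD f (x + s *\<^sub>R u + 0 *\<^sub>R v) u)" by blast
  note f' = smooth_on_FD[OF f, of u]
  have "((\<lambda>b. FD f (x + s *\<^sub>R u + b *\<^sub>R v) u) has_real_derivative
      FD (\<lambda>y. FD f y u) (x + s *\<^sub>R u + b *\<^sub>R v) v) (at b)" if "0 \<le> b" "b \<le> t" for b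
  proof -
    have i: "x + s *\<^sub>R u + b *\<^sub>R v \<in> ball x \<delta>" using inb[of s b] that s by simp
    have "((\<lambda>b. x + s *\<^sub>R u + b *\<^sub>R v) has_derivative (\<lambda>h. h *\<^sub>R v)) (at b)"
      by (auto intro!: derivative_eq_intros)
    from has_derivative_compose[OF this smooth_on_has_derivative[OF f' i]]
    show ?thesis using linear_cmul[OF smooth_on_linear_FD[OF f' i]]
      by (simp add: has_field_derivative_def mult.commute[of _ "FD _ _ v"])
  qed
  from MVT2[OF t(1) this] obtain b where b: "0 < b" "b < t"
    "FD f (x + s *\<^sub>R u + t *\<^sub>R v) u - FD f (x + s *\<^sub>R u + 0 *\<^sub>R v) u
      = (t - 0) * FD (\<lambda>y. FD f y u) (x + s *\<^sub>R u + b *\<^sub>R v) v" by blast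
  show thesis
    by (rule that[of "x + s *\<^sub>R u + b *\<^sub>R v"]) (use inb[of s b] s b in auto)
qed

lemma second_derivative_symmetric_real:
  fixes f :: "'a::euclidean_space \<Rightarrow> real"
  assumes S: "open S" and f: "smooth_on S f" and x: "x \<in> S"
  shows "FD (\<lambda>y. FD f y u) x v = FD (\<lambda>y. FD f y v) x u"
proof (rule ccontr)
  let ?G = "\<lambda>u v y. FD (\<lambda>y. FD f y u) y v"
  assume ne: "?G u v x \<noteq> ?G v u x"
  define e where "e = \<bar>?G u v x - ?G v u x\<bar> / 2"
  have e: "e > 0" using ne by (simp add: e_def)
  have cont: "isCont (?G u v) x" for u v
    using smooth_on_continuous[OF smooth_on_FD[OF smooth_on_FD[OF f]]] S x
    by (simp add: continuous_on_eq_continuous_at)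
  have ev: "\<forall>\<^sub>F y in nhds x. dist (?G u v y) (?G u v x) < e" for u v
    using tendstoD[OF tendsto_at_iff_tendsto_nhds[THEN iffD1, OF cont[of u v, unfolded isCont_def]] e] .
  have "\<forall>\<^sub>F y in nhds x. dist (?G u v y) (?G u v x) < e \<and> dist (?G v u y) (?G v u x) < e \<and> y \<in> S"
    by (rule eventually_conj[OF ev eventually_conj[OF ev eventually_nhds_in_open[OF S x]]])
  then obtain \<delta> where \<delta>: "\<delta> > 0"
    "\<And>y. dist y x < \<delta> \<Longrightarrow> dist (?G u v y) (?G u v x) < e \<and> dist (?G v u y) (?G v u x) < e \<and> y \<in> S"
    unfolding eventually_nhds_metric by blast
  have fb: "smooth_on (ball x \<delta>) f"
    by (rule smooth_on_subset[OF f]) (use \<delta>(2) in \<open>auto simp: dist_commute\<close>)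
  define t where "t = \<delta> / (2 * (norm u + norm v + 1))"
  have t: "t > 0" "t * (norm u + norm v) < \<delta>"
  proof -
    have p: "norm u + norm v + 1 > 0" by (simp add: add_nonneg_pos)
    then show "t > 0" using \<delta>(1) by (simp add: t_def)
    then have "t * (norm u + norm v) < t * (2 * (norm u + norm v + 1))"
      using p by (intro mult_strict_left_mono) (auto simp: algebra_simps)
    also have "\<dots> = \<delta>" using p by (simp add: t_def)
    finally show "t * (norm u + norm v) < \<delta>" .
  qed
  obtain y where y: "y \<in> ball x \<delta>"
    "f (x + t *\<^sub>R u + t *\<^sub>R v) - f (x + t *\<^sub>R u) - (f (x + t *\<^sub>R v) - f x) = t * (t * ?G u v y)"
    using second_difference_mean_value[OF fb t] .
  obtain z where z: "z \<in> ball x \<delta>"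
    "f (x + t *\<^sub>R v + t *\<^sub>R u) - f (x + t *\<^sub>R v) - (f (x + t *\<^sub>R u) - f x) = t * (t * ?G v u z)"
    using second_difference_mean_value[OF fb t(1), of v u] t(2) by (auto simp: add.commute)
  have "x + t *\<^sub>R v + t *\<^sub>R u = x + t *\<^sub>R u + t *\<^sub>R v" by (simp add: algebra_simps)
  then have z': "f (x + t *\<^sub>R u + t *\<^sub>R v) - f (x + t *\<^sub>R v) - (f (x + t *\<^sub>R u) - f x) = t * (t * ?G v u z)"
    using z(2) by (simp only: \<open>x + t *\<^sub>R v + t *\<^sub>R u = x + t *\<^sub>R u + t *\<^sub>R v\<close>)
  have "P = Q" if "p - a - (b - c) = P" "p - b - (a - c) = Q" for p a b c P Q :: real using that by linarith
  from this[OF y(2) z'] have "t * (t * ?G u v y) = t * (t * ?G v u z)" .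
  then have "?G u v y = ?G v u z" using t(1) by simp
  moreover have "\<bar>?G u v y - ?G u v x\<bar> < e" "\<bar>?G v u z - ?G v u x\<bar> < e"
    using \<delta>(2)[of y] \<delta>(2)[of z] y(1) z(1) by (auto simp: dist_real_def dist_commute)
  ultimately show False by (simp add: e_def abs_if split: if_splits)
qed

lemma second_derivative_symmetric:
  fixes f :: "'a::euclidean_space \<Rightarrow> 'b::euclidean_space"
  assumes S: "open S" and f: "smooth_on S f" and x: "x \<in> S"
  shows "FD (\<lambda>y. FD f y u) x v = FD (\<lambda>y. FD f y v) x u"
proof (rule euclidean_eqI)
  fix i :: 'b assume i: "i \<in> Basis"
  have fi: "smooth_on S (\<lambda>y. f y \<bullet> i)"
    by (rule smooth_on_linear[OF S bounded_linear_inner_left f])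
  have 1: "FD (\<lambda>y. f y \<bullet> i) y w = FD f y w \<bullet> i" if "y \<in> S" for y w
    using FD_eq[OF bounded_linear.has_derivative[OF bounded_linear_inner_left smooth_on_has_derivative[OF f that], of i]]
    by simp
  have 2: "FD (\<lambda>y. FD (\<lambda>y. f y \<bullet> i) y w) x w' = FD (\<lambda>y. FD f y w) x w' \<bullet> i" for w w'
  proof -
    have "FD (\<lambda>y. FD (\<lambda>y. f y \<bullet> i) y w) x = FD (\<lambda>y. FD f y w \<bullet> i) x"
      by (rule FD_cong_open[OF S x]) (rule 1)
    also have "\<dots> = (\<lambda>w'. FD (\<lambda>y. FD f y w) x w' \<bullet> i)"
      by (rule FD_eq, rule bounded_linear.has_derivative[OF bounded_linear_inner_left],
          rule smooth_on_has_derivative[OF smooth_on_FD[OF f] x])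
    finally show ?thesis by (rule fun_cong)
  qed
  show "FD (\<lambda>y. FD f y u) x v \<bullet> i = FD (\<lambda>y. FD f y v) x u \<bullet> i"
    using second_derivative_symmetric_real[OF S fi x, of u v] 2[of u v] 2[of v u] by (rule_tac trans[OF sym[OF 2]]) (rule trans, assumption, rule 2)
qed

section \<open>Inverses of smooth families and of smooth maps\<close>

lemma linear_FD_family:
  assumes lin: "\<And>y. y \<in> S \<Longrightarrow> linear (K y)" and S: "open S" "x \<in> S"
    and d: "\<And>w. (\<lambda>y. K y w) differentiable (at x)"
  shows "linear (\<lambda>w. FD (\<lambda>y. K y w) x h)"
proof (rule linearI)
  show "FD (\<lambda>y. K y (v + w)) x h = FD (\<lambda>y. K y v) x h + FD (\<lambda>y. K y w) x h" for v w
  proof -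
    have "FD (\<lambda>y. K y (v + w)) x = FD (\<lambda>y. K y v + K y w) x"
      by (rule FD_cong_open[OF S]) (simp add: linear_add lin)
    also have "\<dots> = (\<lambda>h. FD (\<lambda>y. K y v) x h + FD (\<lambda>y. K y w) x h)"
      by (rule FD_eq, rule has_derivative_add) (rule FD_works[OF d])+
    finally show ?thesis by (rule fun_cong)
  qed
  show "FD (\<lambda>y. K y (c *\<^sub>R w)) x h = c *\<^sub>R FD (\<lambda>y. K y w) x h" for c w
  proof -
    have "FD (\<lambda>y. K y (c *\<^sub>R w)) x = FD (\<lambda>y. c *\<^sub>R K y w) x"
      by (rule FD_cong_open[OF S]) (simp add: linear_cmul lin)
    also have "\<dots> = (\<lambda>h. c *\<^sub>R FD (\<lambda>y. K y w) x h)"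
      by (rule FD_eq, rule has_derivative_scaleR_right) (rule FD_works[OF d])
    finally show ?thesis by (rule fun_cong)
  qed
qed

lemma has_derivative_zero_dominated:
  fixes r :: "'a::real_normed_vector \<Rightarrow> 'b::real_normed_vector" and s :: "'a \<Rightarrow> real"
  assumes s: "(s has_derivative (\<lambda>h. 0)) (at x)" "s x = 0"
    and ev: "\<forall>\<^sub>F y in nhds x. norm (r y) \<le> s y"
  shows "(r has_derivative (\<lambda>h. 0)) (at x)"
proof -
  have r0: "r x = 0" using eventually_nhds_x_imp_x[OF ev] s by simp
  have "((\<lambda>y. (s y - s x - 0) /\<^sub>R norm (y - x)) \<longlongrightarrow> 0) (at x)"
    using s(1) unfolding has_derivative_at_within by blast
  then have lim: "((\<lambda>y. s y / norm (y - x)) \<longlongrightarrow> 0) (at x)"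
    using s(2) by (simp add: divide_inverse mult.commute)
  have ev': "\<forall>\<^sub>F y in at x. norm (r y) \<le> s y"
    using ev by (simp add: eventually_at_filter eventually_mono)
  have "((\<lambda>y. (r y - r x - 0) /\<^sub>R norm (y - x)) \<longlongrightarrow> 0) (at x)"
    by (rule Lim_null_comparison[OF _ lim])
       (rule eventually_mono[OF ev'], simp add: r0 divide_inverse mult.commute mult_right_mono)
  then show ?thesis unfolding has_derivative_at_within by simp
qed

text \<open>With \<open>w\<^sub>0 = u x z\<close> one has \<open>u y z = w\<^sub>0 - u x (K y w\<^sub>0 - z) + r y\<close>, where \<open>r\<close> is of second order in \<open>K y - K x\<close>.
  This gives the derivative, and since the derivative \<open>- u (DK) u\<close> is built from \<open>u\<close> itself, its regularity
  is raised step by step.\<close>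

lemma smooth_on_family_inverse:
  fixes K :: "'a::euclidean_space \<Rightarrow> 'b::euclidean_space \<Rightarrow> 'c::euclidean_space"
  assumes S: "open S" and lin: "\<And>x. x \<in> S \<Longrightarrow> linear (K x)" and sm: "\<And>w. smooth_on S (\<lambda>x. K x w)"
    and Ku: "\<And>x z. x \<in> S \<Longrightarrow> K x (u x z) = z" and uK: "\<And>x w. x \<in> S \<Longrightarrow> u x (K x w) = w"
  shows "smooth_on S (\<lambda>x. u x z)"
proof -
  have linu: "linear (u x)" if x: "x \<in> S" for x
  proof (rule linearI)
    show "u x (v + w) = u x v + u x w" for v w
      using uK[OF x, of "u x v + u x w"] by (simp add: linear_add[OF lin[OF x]] Ku[OF x])
    show "u x (c *\<^sub>R v) = c *\<^sub>R u x v" for c v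
      using uK[OF x, of "c *\<^sub>R u x v"] by (simp add: linear_cmul[OF lin[OF x]] Ku[OF x])
  qed
  have der: "((\<lambda>x. u x z) has_derivative (\<lambda>h. - u x (FD (\<lambda>y. K y (u x z)) x h))) (at x)"
    if x: "x \<in> S" for x z
  proof -
    define w0 where "w0 = u x z"
    obtain C where C: "C > 0" "\<And>v. norm (u x v) \<le> C * norm v"
      using linear_bounded_pos[OF linu[OF x]] by blast
    define \<eta> where "\<eta> y = (\<Sum>i\<in>Basis. norm (K y i - K x i))" for y
    have \<eta>0: "\<eta> x = 0" "\<And>y. \<eta> y \<ge> 0" by (auto simp: \<eta>_def sum_nonneg)
    have bd: "norm (K y w - K x w) \<le> \<eta> y * norm w" if y: "y \<in> S" for y w
    proof -
      have "K y w - K x w = (\<Sum>i\<in>Basis. (w \<bullet> i) *\<^sub>R (K y i - K x i))"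
        unfolding linear_basis_expand[OF lin[OF y], of w] linear_basis_expand[OF lin[OF x], of w]
        by (simp only: scaleR_diff_right sum_subtractf)
      also have "norm \<dots> \<le> (\<Sum>i\<in>Basis. norm w * norm (K y i - K x i))"
        by (rule sum_norm_le) (simp add: mult_right_mono Basis_le_norm)
      finally show ?thesis by (simp add: \<eta>_def sum_distrib_left mult.commute)
    qed
    have K_cont: "isCont (\<lambda>y. K y i) x" for i
      using smooth_on_continuous[OF sm] S x by (simp add: continuous_on_eq_continuous_at)
    have "isCont \<eta> x" unfolding \<eta>_def by (intro continuous_intros K_cont)
    then have "\<forall>\<^sub>F y in nhds x. \<eta> y < inverse (2 * C)"
      using order_tendstoD(2)[OF tendsto_at_iff_tendsto_nhds[THEN iffD1, OF \<open>isCont \<eta> x\<close>[unfolded isCont_def]],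
          of "inverse (2 * C)"] C \<eta>0 by simp
    then have ev: "\<forall>\<^sub>F y in nhds x. C * \<eta> y \<le> 1 / 2 \<and> y \<in> S"
      using eventually_nhds_in_open[OF S x] by eventually_elim (use C in \<open>auto simp: field_simps\<close>)
    have ubd: "norm (u y v) \<le> 2 * C * norm v" if y: "C * \<eta> y \<le> 1 / 2" "y \<in> S" for y v
    proof -
      have "u y v = u x (K x (u y v))" by (simp add: uK x)
      also have "K x (u y v) = v - (K y (u y v) - K x (u y v))" by (simp add: Ku y)
      also have "norm (u x \<dots>) \<le> C * (norm v + \<eta> y * norm (u y v))"
        using C(1) by (intro order_trans[OF C(2)] mult_left_mono order_trans[OF norm_triangle_ineq4] add_left_mono bd y) auto
      also have "\<dots> \<le> C * norm v + 1 / 2 * norm (u y v)"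
        using mult_right_mono[OF y(1), of "norm (u y v)"] by (simp add: algebra_simps)
      finally show ?thesis by simp
    qed
    define r where "r y = u x (K x (u y z - w0) - K y (u y z - w0))" for y
    have exp: "u y z = w0 - u x (K y w0 - z) + r y" if y: "y \<in> S" for y
    proof -
      have "r y = u x ((K x (u y z) - z) + (K y w0 - z))"
        using y x unfolding r_def
        by (simp add: linear_diff[OF lin] Ku w0_def) (simp add: algebra_simps)
      also have "\<dots> = u y z - w0 + u x (K y w0 - z)"
        by (simp add: linear_add[OF linu[OF x]] linear_diff[OF linu[OF x]] uK x) (simp add: w0_def)
      finally show ?thesis by (simp add: algebra_simps)
    qed
    (* The square of a norm is differentiable where the norm itself is not; s dominates the remainder. *)
    define s where "s y = 2 * C\<^sup>2 * norm w0 * (DIM('b) * (\<Sum>i\<in>Basis. (K y i - K x i) \<bullet> (K y i - K x i)))" for y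
    have r_le: "norm (r y) \<le> s y" if y: "C * \<eta> y \<le> 1 / 2" "y \<in> S" for y
    proof -
      have "u y z - w0 = u y (K x w0 - K y w0)"
        using x y by (simp add: linear_diff[OF linu] Ku uK w0_def)
      then have "norm (u y z - w0) \<le> 2 * C * (\<eta> y * norm w0)"
        using order_trans[OF ubd[OF y, of "K x w0 - K y w0"]
            mult_left_mono[OF bd[OF y(2), of w0, unfolded norm_minus_commute[of "K y w0"]], of "2 * C"]] C(1)
        by simp
      then have "norm (r y) \<le> C * (\<eta> y * (2 * C * (\<eta> y * norm w0)))"
      proof -
        have "norm (r y) \<le> C * (\<eta> y * norm (u y z - w0))"
          unfolding r_def using C(1) bd[OF y(2), of "u y z - w0"]
          by (intro order_trans[OF C(2)] mult_left_mono) (auto simp: norm_minus_commute)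
        also have "\<dots> \<le> C * (\<eta> y * (2 * C * (\<eta> y * norm w0)))"
          using C(1) \<eta>0 \<open>norm (u y z - w0) \<le> _\<close> by (intro mult_left_mono) auto
        finally show ?thesis .
      qed
      also have "\<dots> = 2 * C\<^sup>2 * norm w0 * (\<eta> y)\<^sup>2" by (simp add: power2_eq_square algebra_simps)
      also have "\<dots> \<le> s y"
      proof -
        have "(\<eta> y)\<^sup>2 \<le> DIM('b) * (\<Sum>i\<in>Basis. (norm (K y i - K x i))\<^sup>2)"
          unfolding \<eta>_def using sum_squared_le_sum_of_squares[of "\<lambda>i. norm (K y i - K x i)" "Basis :: 'b set"] by (simp add: mult.commute)
        then show ?thesis unfolding s_def power2_norm_eq_inner using C(1) by (intro mult_left_mono) auto
      qed
      finally show ?thesis .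
    qed
    have "(s has_derivative (\<lambda>h. 2 * C\<^sup>2 * norm w0 * (DIM('b) * (\<Sum>i\<in>Basis.
       (K x i - K x i) \<bullet> (FD (\<lambda>y. K y i) x h - 0) + (FD (\<lambda>y. K y i) x h - 0) \<bullet> (K x i - K x i))))) (at x)"
      unfolding s_def
      by (intro has_derivative_mult_right has_derivative_sum has_derivative_inner has_derivative_diff
          has_derivative_const smooth_on_has_derivative[OF sm x])
    then have s': "(s has_derivative (\<lambda>h. 0)) (at x)" by simp
    have "(r has_derivative (\<lambda>h. 0)) (at x)"
      by (rule has_derivative_zero_dominated[OF s']) (use ev r_le in \<open>auto simp: s_def elim: eventually_mono\<close>)
    moreover have "((\<lambda>y. u x (K y w0 - z)) has_derivative (\<lambda>h. u x (FD (\<lambda>y. K y w0) x h - 0))) (at x)"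
      by (intro bounded_linear.has_derivative[OF linear_conv_bounded_linear[THEN iffD1, OF linu[OF x]]]
          has_derivative_diff has_derivative_const smooth_on_has_derivative[OF sm x])
    ultimately have "((\<lambda>y. w0 - u x (K y w0 - z) + r y) has_derivative (\<lambda>h. 0 - u x (FD (\<lambda>y. K y w0) x h - 0) + 0)) (at x)"
      by (intro has_derivative_add has_derivative_diff has_derivative_const)
    then have "((\<lambda>y. w0 - u x (K y w0 - z) + r y) has_derivative (\<lambda>h. - u x (FD (\<lambda>y. K y (u x z)) x h))) (at x)"
      by (simp add: w0_def)
    then show ?thesis
      by (rule has_derivative_transform_within_open[OF _ S x]) (rule exp[symmetric])
  qed
  have "Ck_on k S (\<lambda>x. u x z)" for k z
  proof (induction k arbitrary: z)
    case 0
    show ?case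
      by (auto intro!: continuous_at_imp_continuous_on has_derivative_continuous[OF der])
  next
    case (Suc k)
    show ?case
    proof (rule Ck_on_SucI[OF S der])
      fix v
      have "Ck_on k S (\<lambda>x. FD (\<lambda>y. K y (u x z)) x v)"
        by (rule Ck_on_family_apply[OF S, of "\<lambda>x w. FD (\<lambda>y. K y w) x v"])
           (auto intro!: linear_FD_family[OF lin S] smooth_on_differentiable[OF sm] smooth_on_Ck[OF smooth_on_FD[OF sm]] Suc)
      then have "Ck_on k S (\<lambda>x. u x (FD (\<lambda>y. K y (u x z)) x v))"
        by (rule Ck_on_family_apply[OF S linu Suc, rotated]) assumption
      then show "Ck_on k S (\<lambda>x. - u x (FD (\<lambda>y. K y (u x z)) x v))"
        by (rule Ck_on_linear[OF S bounded_linear_minus[OF bounded_linear_ident]])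
    qed
  qed
  then show ?thesis by (simp add: smooth_on_def)
qed

text \<open>The derivative of \<open>g\<close> is the smooth family \<open>u\<close> evaluated along \<open>g\<close>, so \<open>g\<close> has one order of differentiability
  more than it is known to have.\<close>

lemma smooth_on_inverse_map:
  fixes f :: "'a::euclidean_space \<Rightarrow> 'b::euclidean_space"
  assumes S: "open S" and T: "open T" and f: "smooth_on S f"
    and g: "\<And>y. y \<in> T \<Longrightarrow> g y \<in> S" "continuous_on T g"
    and g': "\<And>y. y \<in> T \<Longrightarrow> (g has_derivative u (g y)) (at y)"
    and u: "\<And>x z. x \<in> S \<Longrightarrow> FD f x (u x z) = z" "\<And>x w. x \<in> S \<Longrightarrow> u x (FD f x w) = w"
  shows "smooth_on T g"
proof -
  have su: "smooth_on S (\<lambda>x. u x z)" for z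
    by (rule smooth_on_family_inverse[OF S smooth_on_linear_FD[OF f] smooth_on_FD[OF f] u])
  have "Ck_on k T g" for k
  proof (induction k)
    case 0
    then show ?case using g by simp
  next
    case (Suc k)
    show ?case
      by (rule Ck_on_SucI[OF T g'], assumption, rule Ck_on_compose[OF T smooth_on_Ck[OF su] Suc]) (use g in auto)
  qed
  then show ?thesis by (simp add: smooth_on_def)
qed

theorem smooth_inverse_function:
  fixes f :: "'a::euclidean_space \<Rightarrow> 'a"
  assumes S: "open S" and f: "smooth_on S f" and x0: "x0 \<in> S" and inj: "inj (FD f x0)"
  obtains U V g where "open U" "x0 \<in> U" "U \<subseteq> S" "open V" "homeomorphism U V f g" "smooth_on V g"
proof -
  define f' where "f' x = Blinfun (FD f x)" for x
  have f'_app: "blinfun_apply (f' x) = FD f x" if "x \<in> S" for x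
    unfolding f'_def
    by (rule bounded_linear_Blinfun_apply) (use smooth_on_linear_FD[OF f that] linear_conv_bounded_linear in blast)
  obtain L where L: "linear L" "L \<circ> FD f x0 = id"
    using linear_injective_left_inverse[OF smooth_on_linear_FD[OF f x0] inj] by blast
  define invf where "invf = Blinfun L"
  have inva: "blinfun_apply invf = L"
    unfolding invf_def by (rule bounded_linear_Blinfun_apply) (use L linear_conv_bounded_linear in blast)
  have cont: "continuous_on S f'"
  proof (rule continuous_on_blinfun_componentwise)
    fix i :: 'a
    have "continuous_on S (\<lambda>x. FD f x i)" by (rule smooth_on_continuous[OF smooth_on_FD[OF f]])
    then show "continuous_on S (\<lambda>x. blinfun_apply (f' x) i)"
      by (rule continuous_on_eq) (simp add: f'_app)
  qed
  have der: "(f has_derivative blinfun_apply (f' x)) (at x)" if "x \<in> S" for x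
    using smooth_on_has_derivative[OF f that] f'_app[OF that] by simp
  have invf_left: "invf o\<^sub>L f' x0 = id_blinfun"
    using L(2) by (intro blinfun_eqI) (simp add: inva f'_app[OF x0] fun_eq_iff)
  obtain U V g g' where *: "open U" "U \<subseteq> S" "x0 \<in> U" "open V" "f x0 \<in> V"
    "homeomorphism U V f g" "\<And>y. y \<in> V \<Longrightarrow> (g has_derivative (g' y)) (at y)"
    "\<And>y. y \<in> V \<Longrightarrow> g' y = inv (blinfun_apply (f' (g y)))"
    "\<And>y. y \<in> V \<Longrightarrow> bij (blinfun_apply (f' (g y)))"
    by (rule inverse_function_theorem[OF S der cont x0 invf_left]; (rule that; assumption)?)
  have gU: "g y \<in> U" if "y \<in> V" for y using *(6) that by (auto simp: homeomorphism_def)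
  have bij: "bij (FD f x)" if "x \<in> U" for x
  proof -
    have "f x \<in> V" "g (f x) = x" using *(6) that by (auto simp: homeomorphism_def)
    then show ?thesis using *(9)[of "f x"] f'_app[of x] that *(2) by auto
  qed
  have "smooth_on V g"
  proof (rule smooth_on_inverse_map[OF *(1,4) smooth_on_subset[OF f *(2)], where u = "\<lambda>x. inv (FD f x)"])
    show "continuous_on V g" using *(6) by (auto simp: homeomorphism_def)
    show "(g has_derivative inv (FD f (g y))) (at y)" if "y \<in> V" for y
      using *(7)[OF that] *(8)[OF that] f'_app[of "g y"] gU[OF that] *(2) by auto
    show "FD f x (inv (FD f x) z) = z" if "x \<in> U" for x z
      using bij[OF that] by (simp add: bij_is_surj surj_f_inv_f)
    show "inv (FD f x) (FD f x w) = w" if "x \<in> U" for x w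
      using bij[OF that] by (simp add: bij_is_inj)
  qed (rule gU)
  with * show thesis using that by blast
qed

section \<open>Linear total differential equations\<close>

text \<open>One constant serves for the size, the Lipschitz and the Taylor estimates, which keeps the later
  integral estimates readable.\<close>

lemma smooth_on_second_order_bound:
  fixes b :: "'a::euclidean_space \<Rightarrow> 'b::euclidean_space"
  assumes W: "open W" "cball 0 R \<subseteq> W" and b: "smooth_on W b"
  obtains k where "k \<ge> 0"
    "\<And>x. x \<in> cball 0 R \<Longrightarrow> norm (b x) \<le> k"
    "\<And>x h. x \<in> cball 0 R \<Longrightarrow> norm (FD b x h) \<le> k * norm h"
    "\<And>x y. x \<in> cball 0 R \<Longrightarrow> y \<in> cball 0 R \<Longrightarrow> norm (b y - b x) \<le> k * norm (y - x)"
    "\<And>x y. x \<in> cball 0 R \<Longrightarrow> y \<in> cball 0 R \<Longrightarrow> norm (b y - b x - FD b x (y - x)) \<le> k * (norm (y - x))\<^sup>2"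
proof -
  let ?D = "cball (0::'a) R"
  have bounded: "\<exists>m\<ge>0. \<forall>x\<in>?D. norm (f x) \<le> m" if f: "smooth_on W f" for f :: "'a \<Rightarrow> 'b"
  proof -
    have "compact (f ` ?D)"
      by (intro compact_continuous_image compact_cball continuous_on_subset[OF smooth_on_continuous[OF f] W(2)])
    then obtain m where "m > 0" "\<forall>y\<in>f ` ?D. norm y \<le> m"
      using compact_imp_bounded bounded_pos by blast
    then show ?thesis by (intro exI[of _ m]) auto
  qed
  have comp: "norm (L h) \<le> (\<Sum>i\<in>Basis. m i) * norm h"
    if L: "linear L" and m: "\<And>i. i \<in> Basis \<Longrightarrow> norm (L i) \<le> m i" for L :: "'a \<Rightarrow> 'b" and m h
  proof -
    have "norm (\<Sum>i\<in>Basis. (h \<bullet> i) *\<^sub>R L i) \<le> (\<Sum>i\<in>Basis. m i * norm h)"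
    proof (rule sum_norm_le)
      fix i :: 'a assume i: "i \<in> Basis"
      have "\<bar>h \<bullet> i\<bar> * norm (L i) \<le> norm h * m i"
        using m[OF i] Basis_le_norm[OF i] by (intro mult_mono) auto
      then show "norm ((h \<bullet> i) *\<^sub>R L i) \<le> m i * norm h" by (simp add: mult.commute)
    qed
    then show ?thesis unfolding linear_basis_expand[OF L, of h] by (simp add: sum_distrib_right)
  qed
  have onb: "\<exists>m\<ge>0. \<forall>x\<in>?D. \<forall>h. norm (FD f x h) \<le> m * norm h" if f: "smooth_on W f" for f :: "'a \<Rightarrow> 'b"
  proof -
    have "\<exists>m. m \<ge> 0 \<and> (\<forall>x\<in>?D. norm (FD f x i) \<le> m)" for i
      using bounded[OF smooth_on_FD[OF f]] by blast
    then obtain m where m: "\<And>i. m i \<ge> 0" "\<And>i x. x \<in> ?D \<Longrightarrow> norm (FD f x i) \<le> m i"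
      using choice[of "\<lambda>i m. m \<ge> 0 \<and> (\<forall>x\<in>?D. norm (FD f x i) \<le> m)"] by blast
    have "norm (FD f x h) \<le> (\<Sum>i\<in>Basis. m i) * norm h" if "x \<in> ?D" for x h
      by (rule comp[OF smooth_on_linear_FD[OF f] m(2)]) (use W(2) that in auto)
    moreover have "(\<Sum>i\<in>Basis. m i) \<ge> 0" using m by (simp add: sum_nonneg)
    ultimately show ?thesis by blast
  qed
  have lip: "\<exists>m\<ge>0. \<forall>x\<in>?D. \<forall>y\<in>?D. norm (f y - f x) \<le> m * norm (y - x)" if f: "smooth_on W f" for f :: "'a \<Rightarrow> 'b"
  proof -
    obtain m where m: "m \<ge> 0" "\<And>x h. x \<in> ?D \<Longrightarrow> norm (FD f x h) \<le> m * norm h" using onb[OF f] by blast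
    have "norm (f y - f x) \<le> m * norm (y - x)" if "x \<in> ?D" "y \<in> ?D" for x y
    proof (rule differentiable_bound[of ?D f "FD f"])
      show "(f has_derivative FD f z) (at z within ?D)" if "z \<in> ?D" for z
        by (rule has_derivative_at_withinI[OF smooth_on_has_derivative[OF f]]) (use W(2) that in blast)
      show "onorm (FD f z) \<le> m" if "z \<in> ?D" for z using m that by (intro onorm_bound) auto
    qed (use that in auto)
    then show ?thesis using m by blast
  qed
  obtain k1 where k1: "k1 \<ge> 0" "\<And>x. x \<in> ?D \<Longrightarrow> norm (b x) \<le> k1" using bounded[OF b] by blast
  obtain k2 where k2: "k2 \<ge> 0" "\<And>x h. x \<in> ?D \<Longrightarrow> norm (FD b x h) \<le> k2 * norm h" using onb[OF b] by blast
  obtain k3 where k3: "k3 \<ge> 0" "\<And>x y. x \<in> ?D \<Longrightarrow> y \<in> ?D \<Longrightarrow> norm (b y - b x) \<le> k3 * norm (y - x)"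
    using lip[OF b] by blast
  have "\<exists>m. m \<ge> 0 \<and> (\<forall>x\<in>?D. \<forall>y\<in>?D. norm (FD b y i - FD b x i) \<le> m * norm (y - x))" for i
    by (rule lip[OF smooth_on_FD[OF b]])
  then obtain m where m: "\<And>i. m i \<ge> 0" "\<And>i x y. x \<in> ?D \<Longrightarrow> y \<in> ?D \<Longrightarrow> norm (FD b y i - FD b x i) \<le> m i * norm (y - x)"
    using choice[of "\<lambda>i m. m \<ge> 0 \<and> (\<forall>x\<in>?D. \<forall>y\<in>?D. norm (FD b y i - FD b x i) \<le> m * norm (y - x))"] by blast
  define k4 where "k4 = (\<Sum>i\<in>Basis. m i)"
  have k4: "k4 \<ge> 0" using m by (simp add: k4_def sum_nonneg)
  have taylor: "norm (b y - b x - FD b x (y - x)) \<le> k4 * (norm (y - x))\<^sup>2" if x: "x \<in> ?D" and y: "y \<in> ?D" for x y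
  proof -
    let ?S = "closed_segment x y"
    have S: "?S \<subseteq> ?D" using x y by (intro closed_segment_subset) auto
    have "norm (b y - b x - FD b x (y - x)) \<le> norm (y - x) * (k4 * norm (y - x))"
    proof (rule differentiable_bound_linearization[of x y ?S b "FD b"])
      show "x + t *\<^sub>R (y - x) \<in> ?S" if "t \<in> {0..1}" for t
        using that unfolding in_segment by (intro exI[of _ t]) (auto simp: algebra_simps)
      show "(b has_derivative FD b z) (at z within ?S)" if "z \<in> ?S" for z
        by (rule has_derivative_at_withinI[OF smooth_on_has_derivative[OF b]]) (use W(2) S that in blast)
      show "onorm (FD b z - FD b x) \<le> k4 * norm (y - x)" if z: "z \<in> ?S" for z
      proof (rule onorm_bound)
        show "norm ((FD b z - FD b x) h) \<le> k4 * norm (y - x) * norm h" for h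
        proof -
          have zD: "z \<in> ?D" using z S by blast
          have le: "norm (z - x) \<le> norm (y - x)" using segment_bound1[OF z] by simp
          have lin: "linear (\<lambda>h. FD b z h - FD b x h)"
            using zD x W(2) by (intro linear_compose_sub smooth_on_linear_FD[OF b]) auto
          have "norm (FD b z i - FD b x i) \<le> m i * norm (y - x)" for i
            using order_trans[OF m(2)[OF x zD] mult_left_mono[OF le m(1)]] .
          from comp[OF lin this, of h] show ?thesis by (simp add: k4_def sum_distrib_right)
        qed
      qed (use k4 in simp)
    qed simp
    then show ?thesis by (simp add: power2_eq_square mult.commute mult.left_commute)
  qed
  show thesis
  proof (rule that[of "k1 + k2 + k3 + k4"])
    show "norm (b x) \<le> k1 + k2 + k3 + k4" if "x \<in> ?D" for x
      using k1(1) k2(1) k3(1) k4 k1(2)[OF that] by linarith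
    show "norm (FD b x h) \<le> (k1 + k2 + k3 + k4) * norm h" if "x \<in> ?D" for x h
      by (rule order_trans[OF k2(2)[OF that] mult_right_mono]) (use k1 k3 k4 in auto)
    show "norm (b y - b x) \<le> (k1 + k2 + k3 + k4) * norm (y - x)" if "x \<in> ?D" "y \<in> ?D" for x y
      by (rule order_trans[OF k3(2)[OF that] mult_right_mono]) (use k1 k2 k4 in auto)
    show "norm (b y - b x - FD b x (y - x)) \<le> (k1 + k2 + k3 + k4) * (norm (y - x))\<^sup>2" if "x \<in> ?D" "y \<in> ?D" for x y
      by (rule order_trans[OF taylor[OF that] mult_right_mono]) (use k1 k2 k3 in auto)
  qed (use k1 k2 k3 k4 in auto)
qed

lemma norm_add3_le:
  "norm a \<le> x \<Longrightarrow> norm b \<le> y \<Longrightarrow> norm c \<le> z \<Longrightarrow> norm (a + b + c) \<le> x + y + z"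
  by (intro norm_triangle_le add_mono) auto

lemma bilinear_basis_expand:
  fixes T :: "'a::euclidean_space \<Rightarrow> 'b::euclidean_space \<Rightarrow> 'c::real_vector"
  assumes "\<And>z. linear (\<lambda>v. T v z)" "\<And>v. linear (T v)"
  shows "T v z = (\<Sum>i\<in>Basis. \<Sum>j\<in>Basis. ((v \<bullet> i) * (z \<bullet> j)) *\<^sub>R T i j)"
proof -
  have "T v z = (\<Sum>i\<in>Basis. (v \<bullet> i) *\<^sub>R T i z)" by (rule linear_basis_expand[OF assms(1)])
  also have "\<dots> = (\<Sum>i\<in>Basis. (v \<bullet> i) *\<^sub>R (\<Sum>j\<in>Basis. (z \<bullet> j) *\<^sub>R T i j))"
    by (intro sum.cong refl arg_cong[where f = "scaleR _"] linear_basis_expand[OF assms(2)])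
  finally show ?thesis by (simp add: scaleR_sum_right)
qed

lemma bilinear_basis_bound:
  fixes T :: "'a::euclidean_space \<Rightarrow> 'b::euclidean_space \<Rightarrow> 'c::real_normed_vector"
  assumes lin: "\<And>z. linear (\<lambda>v. T v z)" "\<And>v. linear (T v)"
    and k: "\<And>i j. i \<in> Basis \<Longrightarrow> j \<in> Basis \<Longrightarrow> norm (T i j) \<le> k i j * c" 
  shows "norm (T v z) \<le> (\<Sum>i\<in>Basis. \<Sum>j\<in>Basis. k i j) * c * norm v * norm z"
proof -
  have "norm (\<Sum>i\<in>Basis. \<Sum>j\<in>Basis. ((v \<bullet> i) * (z \<bullet> j)) *\<^sub>R T i j)
      \<le> (\<Sum>i\<in>Basis. \<Sum>j\<in>Basis. k i j * c * norm v * norm z)"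
  proof (intro sum_norm_le)
    fix i :: 'a and j :: 'b assume ij: "i \<in> Basis" "j \<in> Basis"
    have "(\<bar>v \<bullet> i\<bar> * \<bar>z \<bullet> j\<bar>) * norm (T i j) \<le> (norm v * norm z) * (k i j * c)"
      using ij k[OF ij] by (intro mult_mono mult_nonneg_nonneg) (auto simp: Basis_le_norm)
    then show "norm (((v \<bullet> i) * (z \<bullet> j)) *\<^sub>R T i j) \<le> k i j * c * norm v * norm z"
      by (simp add: abs_mult mult.commute mult.left_commute)
  qed
  then show ?thesis unfolding bilinear_basis_expand[OF lin, of v z] by (simp add: sum_distrib_right)
qed

text \<open>The equation \<open>D\<theta>(x) v = B x v (\<theta> x)\<close> on a ball around the origin, with the bounds that make its
  integral form along rays a contraction.\<close>

locale linear_system =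
  fixes B :: "'a::euclidean_space \<Rightarrow> 'a \<Rightarrow> 'b::euclidean_space \<Rightarrow> 'b"
    and W :: "'a set" and r K :: real
  assumes W: "open W" "cball 0 r \<subseteq> W" and r: "0 < r" "r \<le> 1" "K * r \<le> 1 / 2" and K: "K \<ge> 0"
    and lin1: "\<And>x z. x \<in> W \<Longrightarrow> linear (\<lambda>v. B x v z)" and lin2: "\<And>x v. x \<in> W \<Longrightarrow> linear (B x v)"
    and sm: "\<And>v z. smooth_on W (\<lambda>x. B x v z)"
    and bound: "\<And>x v z. x \<in> cball 0 r \<Longrightarrow> norm (B x v z) \<le> K * norm v * norm z"
    and bound_FD: "\<And>x h v z. x \<in> cball 0 r \<Longrightarrow> norm (FD (\<lambda>x. B x v z) x h) \<le> K * norm h * norm v * norm z"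
    and lipschitz: "\<And>x y v z. x \<in> cball 0 r \<Longrightarrow> y \<in> cball 0 r \<Longrightarrow>
       norm (B y v z - B x v z) \<le> K * norm (y - x) * norm v * norm z"
    and taylor: "\<And>x y v z. x \<in> cball 0 r \<Longrightarrow> y \<in> cball 0 r \<Longrightarrow>
       norm (B y v z - B x v z - FD (\<lambda>x. B x v z) x (y - x)) \<le> K * (norm (y - x))\<^sup>2 * norm v * norm z"
begin

lemma scale_in_cball: "(x::'a) \<in> cball 0 r \<Longrightarrow> 0 \<le> t \<Longrightarrow> t \<le> 1 \<Longrightarrow> t *\<^sub>R x \<in> cball 0 r"
  using order_trans[OF mult_left_le_one_le[of "norm x" t], of r] by (simp add: dist_norm)

lemma continuous_on_B:
  assumes "continuous_on S p" "continuous_on S v" "continuous_on S z" "p ` S \<subseteq> W"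
  shows "continuous_on S (\<lambda>s. B (p s) (v s) (z s))"
proof -
  have "continuous_on S (\<lambda>s. \<Sum>i\<in>Basis. \<Sum>j\<in>Basis. ((v s \<bullet> i) * (z s \<bullet> j)) *\<^sub>R B (p s) i j)"
    by (intro continuous_intros assms continuous_on_compose2[OF smooth_on_continuous[OF sm] assms(1,4)])
  then show ?thesis
  proof (rule continuous_on_eq)
    fix s assume "s \<in> S"
    then have "p s \<in> W" using assms(4) by blast
    from bilinear_basis_expand[OF lin1[OF this] lin2[OF this], of "v s" "z s"]
    show "(\<Sum>i\<in>Basis. \<Sum>j\<in>Basis. ((v s \<bullet> i) * (z s \<bullet> j)) *\<^sub>R B (p s) i j) = B (p s) (v s) (z s)" by (rule sym)
  qed
qed

text \<open>The retraction onto the ball makes the integral operator act on bounded continuous functions on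
  the whole space, a complete metric space.\<close>

lemma ray_integral_equation_solvable:
  obtains \<theta> C where "continuous_on UNIV \<theta>" "\<And>x. norm (\<theta> x) \<le> C" "C \<ge> 0"
    "\<And>x. x \<in> cball 0 r \<Longrightarrow> \<theta> x = z0 + integral {0..1} (\<lambda>t. B (t *\<^sub>R x) x (\<theta> (t *\<^sub>R x)))"
proof -
  define \<rho> where "\<rho> x = (r / max r (norm x)) *\<^sub>R x" for x :: 'a
  have \<rho>_in: "\<rho> x \<in> cball 0 r" for x
  proof -
    have "r * norm x \<le> r * max r (norm x)" using r by (intro mult_left_mono) auto
    moreover have "max r (norm x) > 0" using r by auto
    ultimately show ?thesis using r by (simp add: \<rho>_def dist_norm divide_le_eq)
  qed
  have \<rho>_id: "\<rho> x = x" if "x \<in> cball 0 r" for x using that r by (simp add: \<rho>_def max_def)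
  have \<rho>_cont: "continuous_on S f \<Longrightarrow> continuous_on S (\<lambda>s. \<rho> (f s))" for f :: "'c::topological_space \<Rightarrow> 'a" and S
  proof -
    assume f: "continuous_on S f"
    have "max r (norm x) \<noteq> 0" for x :: 'a using r by (auto simp: max_def)
    then show ?thesis unfolding \<rho>_def using f by (intro continuous_intros) auto
  qed
  define f where "f \<theta> x t = B (t *\<^sub>R \<rho> x) (\<rho> x) (\<theta> (t *\<^sub>R \<rho> x))" for \<theta> :: "'a \<Rightarrow> 'b" and x t
  have fcont: "continuous_on S (\<lambda>s. f \<theta> (p s) (q s))"
    if "continuous_on UNIV \<theta>" "continuous_on S p" "continuous_on S q" "q ` S \<subseteq> {0..1}"
    for \<theta> and S :: "'c::topological_space set" and p q
    unfolding f_def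
  proof (rule continuous_on_B)
    show "(\<lambda>s. q s *\<^sub>R \<rho> (p s)) ` S \<subseteq> W"
    proof
      fix y assume "y \<in> (\<lambda>s. q s *\<^sub>R \<rho> (p s)) ` S"
      then obtain s where s: "s \<in> S" "y = q s *\<^sub>R \<rho> (p s)" by blast
      then have "q s \<in> {0..1}" using that(4) by blast
      then show "y \<in> W" using scale_in_cball[OF \<rho>_in, of "q s" "p s"] s(2) W(2) by auto
    qed
    show "continuous_on S (\<lambda>s. \<theta> (q s *\<^sub>R \<rho> (p s)))"
      by (intro continuous_on_compose2[OF that(1)] continuous_intros \<rho>_cont that) simp
  qed (intro continuous_intros \<rho>_cont that)+
  define \<Phi> where "\<Phi> \<theta> x = z0 + integral {0..1} (f \<theta> x)" for \<theta> and x :: 'a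
  have half: "norm (f \<theta> x t - f \<theta>' x t) \<le> 1 / 2 * m" if t: "t \<in> {0..1}" and m: "\<And>x. norm (\<theta> x - \<theta>' x) \<le> m"
    for \<theta> \<theta>' x t m
  proof -
    have i: "t *\<^sub>R \<rho> x \<in> cball 0 r" using scale_in_cball[OF \<rho>_in] t by auto
    then have "f \<theta> x t - f \<theta>' x t = B (t *\<^sub>R \<rho> x) (\<rho> x) (\<theta> (t *\<^sub>R \<rho> x) - \<theta>' (t *\<^sub>R \<rho> x))"
      using W(2) by (simp add: f_def linear_diff[OF lin2] subset_iff)
    also have "norm \<dots> \<le> K * r * m"
      by (rule order_trans[OF bound[OF i]], intro mult_mono) (use K \<rho>_in[of x] m r in \<open>auto simp: dist_norm\<close>)
    also have "\<dots> \<le> 1 / 2 * m" using r(3) order_trans[OF norm_ge_zero m] by (intro mult_right_mono) auto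
    finally show ?thesis .
  qed
  have fc1: "continuous_on {0..1} (f \<theta> x)" if "continuous_on UNIV \<theta>" for \<theta> x
    using fcont[OF that, of "{0..1}" "\<lambda>_. x" "\<lambda>t. t"] by (auto intro: continuous_intros)
  have int: "f \<theta> x integrable_on {0..1}" if "continuous_on UNIV \<theta>" for \<theta> x
    by (rule integrable_continuous_real[OF fc1[OF that]])
  have \<Phi>_contraction: "norm (\<Phi> \<theta> x - \<Phi> \<theta>' x) \<le> 1 / 2 * m"
    if "continuous_on UNIV \<theta>" "continuous_on UNIV \<theta>'" "\<And>x. norm (\<theta> x - \<theta>' x) \<le> m" for \<theta> \<theta>' x m
  proof -
    have "\<Phi> \<theta> x - \<Phi> \<theta>' x = integral {0..1} (\<lambda>t. f \<theta> x t - f \<theta>' x t)"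
      by (simp add: \<Phi>_def integral_diff[OF int int] that)
    also have "norm \<dots> \<le> (1 / 2 * m) * (1 - 0)"
      by (rule integral_bound) (use half that(3) fc1 that in \<open>auto intro: continuous_on_diff\<close>)
    finally show ?thesis by simp
  qed
  have \<Phi>_cont: "continuous_on UNIV (\<Phi> \<theta>)" if "continuous_on UNIV \<theta>" for \<theta>
  proof -
    have "continuous_on (UNIV \<times> cbox 0 1) (\<lambda>(x, t). f \<theta> x t)"
      unfolding split_beta by (rule fcont[OF that]) (auto intro: continuous_intros)
    from integral_continuous_on_param[OF this] show ?thesis
      unfolding \<Phi>_def by (auto intro: continuous_intros)
  qed
  have \<Phi>_mem: "\<Phi> (apply_bcontfun \<theta>) \<in> bcontfun" for \<theta>
  proof (rule bcontfun_normI)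
    show "continuous_on UNIV (\<Phi> (apply_bcontfun \<theta>))" by (rule \<Phi>_cont) simp
    show "norm (\<Phi> (apply_bcontfun \<theta>) x) \<le> norm z0 + 1 / 2 * norm \<theta>" for x
    proof -
      have "\<Phi> (\<lambda>_. 0) x = z0"
      proof -
        have "f (\<lambda>_. 0) x t = 0" if "t \<in> {0..1}" for t
        proof -
          have "t *\<^sub>R \<rho> x \<in> W" using scale_in_cball[OF \<rho>_in, of t x] that W(2) by auto
          then show ?thesis unfolding f_def by (rule linear_0[OF lin2])
        qed
        then have "integral {0..1} (f (\<lambda>_. 0) x) = integral {0..1} (\<lambda>t::real. 0)"
          by (intro integral_cong) auto
        then show ?thesis by (simp add: \<Phi>_def)
      qed
      moreover have "norm (\<Phi> (apply_bcontfun \<theta>) x - \<Phi> (\<lambda>_. 0) x) \<le> 1 / 2 * norm \<theta>"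
        by (rule \<Phi>_contraction) (auto simp: norm_bounded)
      ultimately show ?thesis using norm_triangle_sub[of "\<Phi> (apply_bcontfun \<theta>) x" z0] by simp
    qed
  qed
  have "\<exists>!\<theta>. Bcontfun (\<Phi> (apply_bcontfun \<theta>)) = \<theta>"
  proof (rule banach_fix_type[of "1/2"])
    show "\<forall>\<theta> \<theta>'. dist (Bcontfun (\<Phi> (apply_bcontfun \<theta>))) (Bcontfun (\<Phi> (apply_bcontfun \<theta>'))) \<le> 1/2 * dist \<theta> \<theta>'"
    proof (intro allI dist_bound)
      fix \<theta> \<theta>' :: "'a \<Rightarrow>\<^sub>C 'b" and x
      have "norm (\<Phi> (apply_bcontfun \<theta>) x - \<Phi> (apply_bcontfun \<theta>') x) \<le> 1 / 2 * dist \<theta> \<theta>'"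
        by (rule \<Phi>_contraction) (use dist_bounded[of \<theta> _ \<theta>'] in \<open>auto simp: dist_norm\<close>)
      then show "dist (apply_bcontfun (Bcontfun (\<Phi> (apply_bcontfun \<theta>))) x) (apply_bcontfun (Bcontfun (\<Phi> (apply_bcontfun \<theta>'))) x)
          \<le> 1 / 2 * dist \<theta> \<theta>'"
        by (simp add: Bcontfun_inverse[OF \<Phi>_mem] dist_norm)
    qed
  qed auto
  then obtain \<theta> where "Bcontfun (\<Phi> (apply_bcontfun \<theta>)) = \<theta>" by blast
  from arg_cong[OF this, of apply_bcontfun]
  have eq: "\<Phi> (apply_bcontfun \<theta>) = apply_bcontfun \<theta>" by (simp only: Bcontfun_inverse[OF \<Phi>_mem])
  show thesis
  proof (rule that[of "apply_bcontfun \<theta>" "norm \<theta>"])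
    show "apply_bcontfun \<theta> x = z0 + integral {0..1} (\<lambda>t. B (t *\<^sub>R x) x (apply_bcontfun \<theta> (t *\<^sub>R x)))" if "x \<in> cball 0 r" for x
      using fun_cong[OF eq, of x] by (simp add: \<Phi>_def f_def[abs_def] \<rho>_id[OF that])
  qed (auto simp: norm_bounded)
qed

end

text \<open>A continuous solution of the integral form along rays from the origin. The integrability condition makes
  it a solution in all directions.\<close>

locale ray_solution = linear_system B W r K
  for B :: "'a::euclidean_space \<Rightarrow> 'a \<Rightarrow> 'b::euclidean_space \<Rightarrow> 'b" and W r K +
  fixes C :: real and \<theta> :: "'a \<Rightarrow> 'b" and z0 :: 'b
  assumes C: "C \<ge> 0"
    and integrable: "\<And>x v w z. x \<in> W \<Longrightarrow>
       FD (\<lambda>x. B x w z) x v + B x w (B x v z) = FD (\<lambda>x. B x v z) x w + B x v (B x w z)"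
    and \<theta>_cont: "continuous_on UNIV \<theta>" and \<theta>_bound: "\<And>x. norm (\<theta> x) \<le> C"
    and \<theta>_fix: "\<And>x. x \<in> cball 0 r \<Longrightarrow> \<theta> x = z0 + integral {0..1} (\<lambda>t. B (t *\<^sub>R x) x (\<theta> (t *\<^sub>R x)))"
begin

lemma continuous_on_\<theta>: "continuous_on S p \<Longrightarrow> continuous_on S (\<lambda>s. \<theta> (p s))"
  by (rule continuous_on_compose2[OF \<theta>_cont]) auto

lemma continuous_on_ray:
  assumes "x \<in> cball 0 r" shows "continuous_on {0..1} (\<lambda>t. B (t *\<^sub>R x) y (\<theta> (t *\<^sub>R x)))"
  by (intro continuous_on_B continuous_on_\<theta> continuous_intros)
     (use scale_in_cball[OF assms] W(2) in auto)

lemma ray_derivative: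
  assumes x: "x \<in> cball 0 r" and t: "t \<in> {0<..<1}"
  shows "((\<lambda>t. \<theta> (t *\<^sub>R x)) has_vector_derivative B (t *\<^sub>R x) x (\<theta> (t *\<^sub>R x))) (at t)"
proof -
  let ?f = "\<lambda>t. B (t *\<^sub>R x) x (\<theta> (t *\<^sub>R x))"
  have ray: "\<theta> (s *\<^sub>R x) = z0 + integral {0..s} ?f" if s: "s \<in> {0..1}" for s
  proof -
    have "((\<lambda>t. s *\<^sub>R ?f (s * t)) has_integral integral {s * 0..s * 1} ?f) {0..1}"
    proof (rule has_integral_substitution[where c = 0 and d = 1 and g = "\<lambda>t. s * t" and f = ?f and g' = "\<lambda>_. s"])
      show "(\<lambda>t. s * t) ` {0..1} \<subseteq> {0..1}" using s by (auto simp: mult_le_one)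
      show "continuous_on {0..1} ?f" by (rule continuous_on_ray[OF x])
      show "((\<lambda>t. s * t) has_real_derivative s) (at t within {0..1})" for t
        by (auto intro!: derivative_eq_intros)
    qed (use s in auto)
    moreover have "B (t *\<^sub>R s *\<^sub>R x) (s *\<^sub>R x) (\<theta> (t *\<^sub>R s *\<^sub>R x)) = s *\<^sub>R ?f (s * t)" if "t \<in> {0..1}" for t
    proof -
      have "(s * t) *\<^sub>R x \<in> W" using scale_in_cball[OF x, of "s * t"] s that W(2) by (auto simp: mult_le_one)
      then show ?thesis using linear_cmul[OF lin1[of "(s * t) *\<^sub>R x" "\<theta> ((s * t) *\<^sub>R x)"], of s x]
        by (simp add: mult.commute)
    qed
    ultimately have "integral {0..1} (\<lambda>t. B (t *\<^sub>R s *\<^sub>R x) (s *\<^sub>R x) (\<theta> (t *\<^sub>R s *\<^sub>R x))) = integral {0..s} ?f"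
      by (subst integral_cong[of "{0..1}" _ "\<lambda>t. s *\<^sub>R ?f (s * t)"]) (auto dest: integral_unique)
    then show ?thesis using \<theta>_fix[OF scale_in_cball[OF x, of s]] s by simp
  qed
  have "((\<lambda>s. z0 + integral {0..s} ?f) has_vector_derivative 0 + ?f t) (at t within {0..1})"
    by (intro has_vector_derivative_add has_vector_derivative_const
        integral_has_vector_derivative[OF continuous_on_ray[OF x]]) (use t in auto)
  then have "((\<lambda>s. z0 + integral {0..s} ?f) has_vector_derivative ?f t) (at t)"
    using at_within_interior[of t "{0..1}"] t by simp
  then show ?thesis
    by (rule has_vector_derivative_transform_within_open[where S = "{0<..<1}"]) (use t ray in auto)
qed

text \<open>An estimate in which the unknown quantity reappears, on the segment towards the origin, with
  factor one half can be applied where that quantity is largest; so the factor is absorbed.\<close>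

lemma absorb_half:
  fixes E :: "'a \<Rightarrow> 'a \<Rightarrow> 'b"
  assumes cont: "\<And>x h. x \<in> cball 0 r \<Longrightarrow> x + h \<in> cball 0 r \<Longrightarrow> continuous_on {0..1} (\<lambda>t. E (t *\<^sub>R x) (t *\<^sub>R h))"
    and est: "\<And>x h m. x \<in> cball 0 r \<Longrightarrow> x + h \<in> cball 0 r \<Longrightarrow>
       (\<And>t. t \<in> {0..1} \<Longrightarrow> norm (E (t *\<^sub>R x) (t *\<^sub>R h)) \<le> m) \<Longrightarrow> norm (E x h) \<le> 1 / 2 * m + c * norm h ^ p"
    and c: "c \<ge> 0" and x: "x \<in> cball 0 r" "x + h \<in> cball 0 r"
  shows "norm (E x h) \<le> 2 * c * norm h ^ p"
proof -
  have "continuous_on {0..1} (\<lambda>t. norm (E (t *\<^sub>R x) (t *\<^sub>R h)))"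
    by (intro continuous_on_norm cont x)
  from continuous_attains_sup[OF compact_Icc _ this] obtain s where s: "s \<in> {0..1}"
    and max: "\<And>t. t \<in> {0..1} \<Longrightarrow> norm (E (t *\<^sub>R x) (t *\<^sub>R h)) \<le> norm (E (s *\<^sub>R x) (s *\<^sub>R h))" by auto
  let ?m = "norm (E (s *\<^sub>R x) (s *\<^sub>R h))"
  have "?m \<le> 1 / 2 * ?m + c * norm (s *\<^sub>R h) ^ p"
  proof (rule est)
    show "s *\<^sub>R x \<in> cball 0 r" using scale_in_cball[OF x(1), of s] s by simp
    show "s *\<^sub>R x + s *\<^sub>R h \<in> cball 0 r" using scale_in_cball[OF x(2), of s] s by (simp add: scaleR_add_right)
    show "norm (E (t *\<^sub>R s *\<^sub>R x) (t *\<^sub>R s *\<^sub>R h)) \<le> ?m" if "t \<in> {0..1}" for t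
      using max[of "t * s"] that s by (auto simp: mult_le_one)
  qed
  moreover have "c * norm (s *\<^sub>R h) ^ p \<le> c * norm h ^ p"
    using s c by (intro mult_left_mono power_mono) (auto simp: mult_left_le_one_le)
  ultimately have "?m \<le> 2 * c * norm h ^ p" by simp
  then show ?thesis using max[of 1] by simp
qed

lemma solution_lipschitz:
  assumes x: "x \<in> cball 0 r" "x + h \<in> cball 0 r"
  shows "norm (\<theta> (x + h) - \<theta> x) \<le> 2 * (2 * K * C) * norm h ^ 1"
proof (rule absorb_half[where E = "\<lambda>x h. \<theta> (x + h) - \<theta> x", OF _ _ _ x])
  show "continuous_on {0..1} (\<lambda>t. \<theta> (t *\<^sub>R x + t *\<^sub>R h) - \<theta> (t *\<^sub>R x))" for x h
    by (intro continuous_intros continuous_on_\<theta>)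
  show "0 \<le> 2 * K * C" using K C by simp
  fix x h m assume x: "x \<in> cball 0 r" "x + h \<in> cball 0 r"
    and m: "\<And>t. t \<in> {0..1} \<Longrightarrow> norm (\<theta> (t *\<^sub>R x + t *\<^sub>R h) - \<theta> (t *\<^sub>R x)) \<le> m"
  let ?f = "\<lambda>t. B (t *\<^sub>R (x + h)) (x + h) (\<theta> (t *\<^sub>R (x + h)))"
  let ?g = "\<lambda>t. B (t *\<^sub>R x) x (\<theta> (t *\<^sub>R x))"
  have int: "?f integrable_on {0..1}" "?g integrable_on {0..1}"
    using continuous_on_ray x by (auto intro: integrable_continuous_real)
  have "\<theta> (x + h) - \<theta> x = integral {0..1} (\<lambda>t. ?f t - ?g t)"
    unfolding integral_diff[OF int] \<theta>_fix[OF x(2)] by (subst \<theta>_fix[OF x(1)]) simp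
  also have "norm \<dots> \<le> (1 / 2 * m + 2 * K * C * norm h) * (1 - 0)"
  proof (rule integral_bound)
    show "continuous_on {0..1} (\<lambda>t. ?f t - ?g t)" by (intro continuous_intros continuous_on_ray x)
    show "norm (?f t - ?g t) \<le> 1 / 2 * m + 2 * K * C * norm h" if t: "t \<in> {0..1}" for t
    proof -
      define a where "a = t *\<^sub>R x"
      define y where "y = t *\<^sub>R (x + h)"
      have ab: "a \<in> cball 0 r" "y \<in> cball 0 r" "a \<in> W" "y \<in> W"
        unfolding a_def y_def using scale_in_cball[OF x(1), of t] scale_in_cball[OF x(2), of t] t W(2) by auto
      have ya: "norm (y - a) \<le> norm h" unfolding a_def y_def using t
        by (simp add: scaleR_add_right mult_left_le_one_le)
      have nx: "norm (x + h) \<le> r" using x by simp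
      have d: "norm (\<theta> y - \<theta> a) \<le> m" using m[OF t] by (simp add: a_def y_def scaleR_add_right)
      have eq: "?f t - ?g t = B y (x + h) (\<theta> y - \<theta> a) + (B y (x + h) (\<theta> a) - B a (x + h) (\<theta> a)) + B a h (\<theta> a)"
        unfolding a_def[symmetric] y_def[symmetric]
        by (simp add: linear_diff[OF lin2] linear_add[OF lin1] ab)
      have "norm (B y (x + h) (\<theta> y - \<theta> a)) \<le> K * r * m"
        by (rule order_trans[OF bound[OF ab(2)]], intro mult_mono) (use K nx d r in auto)
      also have "\<dots> \<le> 1 / 2 * m" using r(3) order_trans[OF norm_ge_zero d] by (intro mult_right_mono) auto
      finally have 1: "norm (B y (x + h) (\<theta> y - \<theta> a)) \<le> 1 / 2 * m" .
      have "norm (B y (x + h) (\<theta> a) - B a (x + h) (\<theta> a)) \<le> K * norm h * 1 * C"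
        by (rule order_trans[OF lipschitz[OF ab(1,2)]], intro mult_mono) (use K ya nx r \<theta>_bound in auto)
      moreover have "norm (B a h (\<theta> a)) \<le> K * norm h * C"
        by (rule order_trans[OF bound[OF ab(1)]], intro mult_mono) (use K \<theta>_bound in auto)
      ultimately have "norm (?f t - ?g t) \<le> 1 / 2 * m + K * norm h * 1 * C + K * norm h * C"
        unfolding eq by (intro norm_add3_le 1)
      then show ?thesis by (simp add: algebra_simps)
    qed
  qed simp
  finally show "norm (\<theta> (x + h) - \<theta> x) \<le> 1 / 2 * m + 2 * K * C * norm h ^ 1" by simp
qed

text \<open>The defect of the expected first order expansion satisfies an integral equation. Subtracting the
  derivative of \<open>t B(tx) h \<theta>(tx)\<close> and using the integrability condition cancels every term of first order
  in \<open>h\<close>; what remains is the defect at smaller scale, with factor one half, and quadratic terms.\<close>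

lemma solution_quadratic:
  assumes x: "x \<in> cball 0 r" "x + h \<in> cball 0 r"
  shows "norm (\<theta> (x + h) - \<theta> x - B x h (\<theta> x)) \<le> 2 * (2 * K * C + 2 * K * (4 * K * C)) * norm h ^ 2"
proof (rule absorb_half[where E = "\<lambda>x h. \<theta> (x + h) - \<theta> x - B x h (\<theta> x)", OF _ _ _ x])
  show "continuous_on {0..1} (\<lambda>t. \<theta> (t *\<^sub>R x + t *\<^sub>R h) - \<theta> (t *\<^sub>R x) - B (t *\<^sub>R x) (t *\<^sub>R h) (\<theta> (t *\<^sub>R x)))"
    if "x \<in> cball 0 r" for x h
    by (intro continuous_intros continuous_on_\<theta> continuous_on_B) (use scale_in_cball[OF that] W(2) in auto)
  show "0 \<le> 2 * K * C + 2 * K * (4 * K * C)" using K C by simp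
  fix x h m assume x: "x \<in> cball 0 r" "x + h \<in> cball 0 r"
    and m: "\<And>t. t \<in> {0..1} \<Longrightarrow> norm (\<theta> (t *\<^sub>R x + t *\<^sub>R h) - \<theta> (t *\<^sub>R x) - B (t *\<^sub>R x) (t *\<^sub>R h) (\<theta> (t *\<^sub>R x))) \<le> m"
  let ?f = "\<lambda>t. B (t *\<^sub>R (x + h)) (x + h) (\<theta> (t *\<^sub>R (x + h)))"
  let ?g = "\<lambda>t. B (t *\<^sub>R x) x (\<theta> (t *\<^sub>R x))"
  let ?G = "\<lambda>t. t *\<^sub>R B (t *\<^sub>R x) h (\<theta> (t *\<^sub>R x))"
  let ?G' = "\<lambda>t. B (t *\<^sub>R x) h (\<theta> (t *\<^sub>R x)) + t *\<^sub>R (FD (\<lambda>y. B y h (\<theta> (t *\<^sub>R x))) (t *\<^sub>R x) x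
      + B (t *\<^sub>R x) h (B (t *\<^sub>R x) x (\<theta> (t *\<^sub>R x))))"
  have inW: "t *\<^sub>R x \<in> W" if "t \<in> {0..1}" for t using scale_in_cball[OF x(1), of t] that W(2) by auto
  have "(?G' has_integral ?G 1 - ?G 0) {0..1}"
  proof (rule fundamental_theorem_of_calculus_interior)
    show "continuous_on {0..1} ?G" by (intro continuous_intros continuous_on_ray x)
    show "(?G has_vector_derivative ?G' t) (at t)" if t: "t \<in> {0<..<1}" for t
    proof -
      have "((\<lambda>t. B (t *\<^sub>R x) h (\<theta> (t *\<^sub>R x))) has_derivative
        (\<lambda>s. s *\<^sub>R FD (\<lambda>y. B y h (\<theta> (t *\<^sub>R x))) (t *\<^sub>R x) x + B (t *\<^sub>R x) h (s *\<^sub>R B (t *\<^sub>R x) x (\<theta> (t *\<^sub>R x))))) (at t)"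
      proof (rule has_derivative_family_apply[where S = "{0<..<1}" and K = "\<lambda>t. B (t *\<^sub>R x) h"
            and K' = "\<lambda>s w. s *\<^sub>R FD (\<lambda>y. B y h w) (t *\<^sub>R x) x"])
        show "linear (B (t *\<^sub>R x) h)" if "t \<in> {0<..<1}" for t using inW that by (intro lin2) auto
        have tW: "t *\<^sub>R x \<in> W" using inW t by auto
        show "((\<lambda>t. B (t *\<^sub>R x) h w) has_derivative (\<lambda>s. s *\<^sub>R FD (\<lambda>y. B y h w) (t *\<^sub>R x) x)) (at t)" for w
        proof -
          have "((\<lambda>t. t *\<^sub>R x) has_derivative (\<lambda>s. s *\<^sub>R x)) (at t)" by (auto intro!: derivative_eq_intros)
          from has_derivative_compose[OF this smooth_on_has_derivative[OF sm tW]]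
          show ?thesis by (simp add: linear_cmul[OF smooth_on_linear_FD[OF sm tW]])
        qed
        show "((\<lambda>t. \<theta> (t *\<^sub>R x)) has_derivative (\<lambda>s. s *\<^sub>R B (t *\<^sub>R x) x (\<theta> (t *\<^sub>R x)))) (at t)"
          using ray_derivative[OF x(1) t] by (simp add: has_vector_derivative_def)
      qed (use t in auto)
      from has_derivative_scaleR[OF has_derivative_ident this]
      show ?thesis unfolding has_vector_derivative_def
        by (rule has_derivative_eq_rhs)
           (use inW t in \<open>auto simp: linear_cmul[OF lin2] algebra_simps\<close>)
    qed
  qed simp
  then have G: "(?G' has_integral B x h (\<theta> x)) {0..1}" by simp
  have f: "(?f has_integral integral {0..1} ?f) {0..1}" and g: "(?g has_integral integral {0..1} ?g) {0..1}"
    using continuous_on_ray x by (auto intro: integrable_integral integrable_continuous_real)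
  have "\<theta> (x + h) - \<theta> x - B x h (\<theta> x) = integral {0..1} ?f - integral {0..1} ?g - B x h (\<theta> x)"
    unfolding \<theta>_fix[OF x(2)] by (subst \<theta>_fix[OF x(1)]) simp
  then have I: "((\<lambda>t. ?f t - ?g t - ?G' t) has_integral \<theta> (x + h) - \<theta> x - B x h (\<theta> x)) {0..1}"
    using has_integral_diff[OF has_integral_diff[OF f g] G] by simp
  have pt: "norm (?f t - ?g t - ?G' t) \<le> 1 / 2 * m + (2 * K * C + 2 * K * (4 * K * C)) * (norm h)\<^sup>2" if t: "t \<in> {0..1}" for t
  proof -
    define a where "a = t *\<^sub>R x"
    define y where "y = t *\<^sub>R (x + h)"
    define \<Delta> where "\<Delta> = \<theta> y - \<theta> a"
    define e where "e = \<Delta> - B a (t *\<^sub>R h) (\<theta> a)"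
    have ab: "a \<in> cball 0 r" "y \<in> cball 0 r" "a \<in> W" "y \<in> W"
      unfolding a_def y_def using scale_in_cball[OF x(1), of t] scale_in_cball[OF x(2), of t] t W(2) by auto
    have ya: "y - a = t *\<^sub>R h" by (simp add: a_def y_def scaleR_add_right)
    have yn: "norm (y - a) \<le> norm h" unfolding ya using t by (simp add: mult_left_le_one_le)
    have nx: "norm (x + h) \<le> 1" "norm x \<le> r" using x r by auto
    have em: "norm e \<le> m" using m[OF t] by (simp add: e_def \<Delta>_def a_def y_def scaleR_add_right)
    have \<Delta>: "norm \<Delta> \<le> 4 * K * C * norm h"
    proof -
      have "norm (\<theta> (a + (y - a)) - \<theta> a) \<le> 2 * (2 * K * C) * norm (y - a) ^ 1"
        using ab by (intro solution_lipschitz) auto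
      also have "\<dots> \<le> 2 * (2 * K * C) * norm h" using yn K C by (auto intro!: mult_left_mono)
      finally show ?thesis by (simp add: \<Delta>_def)
    qed
    have linFD: "linear (\<lambda>v. FD (\<lambda>y. B y v z) a w)" for z w
      by (rule linear_FD_family[OF lin1 W(1) ab(3) smooth_on_differentiable[OF sm ab(3)]])
    (* T4 reproduces the defect; all the other terms are quadratic in h. *)
    let ?T1 = "B y (x + h) (\<theta> a) - B a (x + h) (\<theta> a) - FD (\<lambda>y. B y (x + h) (\<theta> a)) a (y - a)"
    let ?T2 = "B y (x + h) \<Delta> - B a (x + h) \<Delta>"
    let ?T3 = "B a h \<Delta>" let ?T4 = "B a x e"
    let ?T5 = "FD (\<lambda>y. B y h (\<theta> a)) a (y - a)"
    have "?f t = B y (x + h) (\<theta> a) + B y (x + h) \<Delta>"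
      unfolding \<Delta>_def y_def[symmetric] by (simp add: linear_diff[OF lin2[OF ab(4)]])
    moreover have "?g t = B a x (\<theta> a)" by (simp add: a_def)
    moreover have "?G' t = B a h (\<theta> a) + (FD (\<lambda>y. B y x (\<theta> a)) a (y - a) + B a x (B a (t *\<^sub>R h) (\<theta> a)))"
    proof -
      have "?G' t = B a h (\<theta> a) + t *\<^sub>R (FD (\<lambda>y. B y x (\<theta> a)) a h + B a x (B a h (\<theta> a)))"
        unfolding a_def[symmetric] integrable[OF ab(3)] ..
      then show ?thesis
        by (simp add: ya linear_cmul[OF smooth_on_linear_FD[OF sm ab(3)]] linear_cmul[OF lin1[OF ab(3)]]
            linear_cmul[OF lin2[OF ab(3)]] scaleR_add_right)
    qed
    moreover have "B a (x + h) z = B a x z + B a h z" for z by (rule linear_add[OF lin1[OF ab(3)]])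
    moreover have "FD (\<lambda>y. B y (x + h) (\<theta> a)) a (y - a) = FD (\<lambda>y. B y x (\<theta> a)) a (y - a) + FD (\<lambda>y. B y h (\<theta> a)) a (y - a)"
      by (rule linear_add[OF linFD])
    moreover have "B a x e = B a x \<Delta> - B a x (B a (t *\<^sub>R h) (\<theta> a))"
      unfolding e_def by (rule linear_diff[OF lin2[OF ab(3)]])
    ultimately have eq: "?f t - ?g t - ?G' t = (?T4 + ?T1 + ?T2) + ?T3 + ?T5" by (simp add: algebra_simps)
    have y2: "(norm (y - a))\<^sup>2 \<le> (norm h)\<^sup>2" using yn by (intro power_mono) auto
    have 1: "norm ?T1 \<le> K * (norm h)\<^sup>2 * 1 * C"
      by (rule order_trans[OF taylor[OF ab(1,2)]], intro mult_mono) (use K y2 nx \<theta>_bound in auto)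
    have 2: "norm ?T2 \<le> K * norm h * 1 * (4 * K * C * norm h)"
      by (rule order_trans[OF lipschitz[OF ab(1,2)]], intro mult_mono) (use K yn nx \<Delta> in auto)
    have 3: "norm ?T3 \<le> K * norm h * (4 * K * C * norm h)"
      by (rule order_trans[OF bound[OF ab(1)]], intro mult_mono) (use K \<Delta> in auto)
    have "norm ?T4 \<le> K * r * m"
      by (rule order_trans[OF bound[OF ab(1)]], intro mult_mono) (use K nx em r in auto)
    also have "\<dots> \<le> 1 / 2 * m" using r(3) order_trans[OF norm_ge_zero em] by (intro mult_right_mono) auto
    finally have 4: "norm ?T4 \<le> 1 / 2 * m" .
    have 5: "norm ?T5 \<le> K * norm h * norm h * C"
      by (rule order_trans[OF bound_FD[OF ab(1)]], intro mult_mono) (use K yn \<theta>_bound in auto)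
    have "norm (?f t - ?g t - ?G' t) \<le> (1 / 2 * m + K * (norm h)\<^sup>2 * 1 * C + K * norm h * 1 * (4 * K * C * norm h))
        + K * norm h * (4 * K * C * norm h) + K * norm h * norm h * C"
      unfolding eq by (intro norm_add3_le 1 2 3 4 5)
    then show ?thesis by (simp add: algebra_simps power2_eq_square)
  qed
  have "0 \<le> 1 / 2 * m + (2 * K * C + 2 * K * (4 * K * C)) * (norm h)\<^sup>2"
    using order_trans[OF norm_ge_zero pt[of 0]] by simp
  from has_integral_bound_real[OF this finite.emptyI I] pt
  have "norm (\<theta> (x + h) - \<theta> x - B x h (\<theta> x))
      \<le> (1 / 2 * m + (2 * K * C + 2 * K * (4 * K * C)) * (norm h)\<^sup>2) * Henstock_Kurzweil_Integration.content {0..1::real}"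
    by blast
  then show "norm (\<theta> (x + h) - \<theta> x - B x h (\<theta> x)) \<le> 1 / 2 * m + (2 * K * C + 2 * K * (4 * K * C)) * norm h ^ 2"
    by (simp only: content_real zero_le_one diff_zero mult_1_right)
qed

lemma solution_derivative:
  assumes x: "x \<in> ball 0 r"
  shows "(\<theta> has_derivative (\<lambda>v. B x v (\<theta> x))) (at x)"
proof -
  have xW: "x \<in> W" using x W(2) by auto
  have bl: "bounded_linear (\<lambda>v. B x v (\<theta> x))"
    using lin1[OF xW] linear_conv_bounded_linear by blast
  define c where "c = 2 * (2 * K * C + 2 * K * (4 * K * C))"
  have "((\<lambda>y. \<theta> y - B x y (\<theta> x)) has_derivative (\<lambda>h. 0)) (at x)"
  proof -
    have "((\<lambda>y. (\<theta> y - B x y (\<theta> x)) - (\<theta> x - B x x (\<theta> x))) has_derivative (\<lambda>h. 0)) (at x)"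
    proof (rule has_derivative_zero_dominated)
      show "((\<lambda>y. c * ((y - x) \<bullet> (y - x))) has_derivative (\<lambda>h. 0)) (at x)"
        by (auto intro!: derivative_eq_intros)
      have "norm (\<theta> y - B x y (\<theta> x) - (\<theta> x - B x x (\<theta> x))) \<le> c * ((y - x) \<bullet> (y - x))" if "y \<in> ball 0 r" for y
        using solution_quadratic[of x "y - x"] x that
        by (simp add: c_def power2_norm_eq_inner linear_diff[OF lin1[OF xW]] algebra_simps)
      then show "\<forall>\<^sub>F y in nhds x. norm (\<theta> y - B x y (\<theta> x) - (\<theta> x - B x x (\<theta> x))) \<le> c * ((y - x) \<bullet> (y - x))"
        using eventually_nhds_in_open[of "ball 0 r" x] x by (auto elim: eventually_mono)
    qed simp
    from has_derivative_add[OF this has_derivative_const[of "\<theta> x - B x x (\<theta> x)"]]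
    show ?thesis by simp
  qed
  from has_derivative_add[OF this bounded_linear_imp_has_derivative[OF bl]] show ?thesis by simp
qed

end

lemma linear_total_equation_at_origin:
  fixes B :: "'a::euclidean_space \<Rightarrow> 'a \<Rightarrow> 'b::euclidean_space \<Rightarrow> 'b"
  assumes W: "open W" "0 \<in> W"
    and lin1: "\<And>x z. x \<in> W \<Longrightarrow> linear (\<lambda>v. B x v z)" and lin2: "\<And>x v. x \<in> W \<Longrightarrow> linear (B x v)"
    and sm: "\<And>v z. smooth_on W (\<lambda>x. B x v z)"
    and integrable: "\<And>x v w z. x \<in> W \<Longrightarrow>
       FD (\<lambda>x. B x w z) x v + B x w (B x v z) = FD (\<lambda>x. B x v z) x w + B x v (B x w z)"
  obtains r \<theta> where "0 < r" "ball 0 r \<subseteq> W" "\<theta> 0 = z0"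
    "\<And>x. x \<in> ball 0 r \<Longrightarrow> (\<theta> has_derivative (\<lambda>v. B x v (\<theta> x))) (at x)"
proof -
  obtain R where R: "R > 0" "cball 0 R \<subseteq> W" using W open_contains_cball by blast
  define P where "P i j k \<longleftrightarrow> k \<ge> 0 \<and> (\<forall>x\<in>cball 0 R. norm (B x i j) \<le> k \<and>
       (\<forall>h. norm (FD (\<lambda>x. B x i j) x h) \<le> k * norm h) \<and>
       (\<forall>y\<in>cball 0 R. norm (B y i j - B x i j) \<le> k * norm (y - x) \<and>
          norm (B y i j - B x i j - FD (\<lambda>x. B x i j) x (y - x)) \<le> k * (norm (y - x))\<^sup>2))" for i j k
  define k where "k i j = (SOME k. P i j k)" for i j
  have "\<exists>k. P i j k" for i j
    by (rule smooth_on_second_order_bound[OF W(1) R(2) sm[of i j]]) (rule exI, unfold P_def, blast)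
  then have P: "P i j (k i j)" for i j unfolding k_def by (rule someI_ex)
  have k0: "k i j \<ge> 0" for i j using P[of i j] by (simp add: P_def)
  have k: "\<And>i j x. x \<in> cball 0 R \<Longrightarrow> norm (B x i j) \<le> k i j"
      "\<And>i j x h. x \<in> cball 0 R \<Longrightarrow> norm (FD (\<lambda>x. B x i j) x h) \<le> k i j * norm h"
      "\<And>i j x y. x \<in> cball 0 R \<Longrightarrow> y \<in> cball 0 R \<Longrightarrow> norm (B y i j - B x i j) \<le> k i j * norm (y - x)"
      "\<And>i j x y. x \<in> cball 0 R \<Longrightarrow> y \<in> cball 0 R \<Longrightarrow>
         norm (B y i j - B x i j - FD (\<lambda>x. B x i j) x (y - x)) \<le> k i j * (norm (y - x))\<^sup>2"
    subgoal for i j x using P[of i j] by (simp add: P_def)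
    subgoal for i j x h using P[of i j] by (simp add: P_def)
    subgoal for i j x y using P[of i j] by (simp add: P_def)
    subgoal for i j x y using P[of i j] by (simp add: P_def)
    done
  define K where "K = (\<Sum>i\<in>Basis. \<Sum>j\<in>Basis. k i j)"
  have K: "K \<ge> 0" using k0 by (simp add: K_def sum_nonneg)
  (* The radius makes the integral operator a contraction with factor one half. *)
  define b where "b = 1 / (2 * (K + 1))"
  have b: "b > 0" using K by (simp add: b_def)
  define r where "r = min R (min 1 b)"
  have r: "0 < r" "r \<le> R" "r \<le> 1" "r \<le> 1 / (2 * (K + 1))"
    using R(1) b unfolding b_def[symmetric] r_def by linarith+
  have "K * r \<le> K * (1 / (2 * (K + 1)))" using r(4) K by (rule mult_left_mono)
  also have "\<dots> \<le> 1 / 2" using K by (simp add: field_simps)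
  finally have Kr: "K * r \<le> 1 / 2" .
  have cR: "x \<in> cball 0 R" "x \<in> W" if "x \<in> cball 0 r" for x :: 'a using that r(2) R(2) by auto
  have linFD: "linear (\<lambda>v. FD (\<lambda>y. B y v z) x w)" "linear (\<lambda>z. FD (\<lambda>y. B y v z) x w)" if "x \<in> W" for x v z w
    subgoal by (rule linear_FD_family[OF lin1 W(1) that smooth_on_differentiable[OF sm that]])
    subgoal by (rule linear_FD_family[OF lin2 W(1) that smooth_on_differentiable[OF sm that]])
    done
  have "linear_system B W r K"
  proof (rule linear_system.intro)
    show "open W" "cball 0 r \<subseteq> W" "0 < r" "r \<le> 1" "K * r \<le> 1 / 2" "0 \<le> K"
      using W cR r Kr K by auto
    fix x y h v :: 'a and z :: 'b assume x: "x \<in> cball 0 r"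
    note xR = cR[OF x]
    have "norm (B x v z) \<le> K * 1 * norm v * norm z" unfolding K_def
      by (rule bilinear_basis_bound[OF lin1[OF xR(2)] lin2[OF xR(2)]]) (simp add: k(1)[OF xR(1)])
    then show "norm (B x v z) \<le> K * norm v * norm z" by simp
    show "norm (FD (\<lambda>x. B x v z) x h) \<le> K * norm h * norm v * norm z" unfolding K_def
      by (rule bilinear_basis_bound[OF linFD[OF xR(2)]]) (rule k(2)[OF xR(1)])
    assume y: "y \<in> cball 0 r"
    note yR = cR[OF y]
    show "norm (B y v z - B x v z) \<le> K * norm (y - x) * norm v * norm z" unfolding K_def
      by (rule bilinear_basis_bound[of "\<lambda>v z. B y v z - B x v z"])
         (intro linear_compose_sub lin1 lin2 xR yR k(3))+
    show "norm (B y v z - B x v z - FD (\<lambda>x. B x v z) x (y - x)) \<le> K * (norm (y - x))\<^sup>2 * norm v * norm z" unfolding K_def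
      by (rule bilinear_basis_bound[of "\<lambda>v z. B y v z - B x v z - FD (\<lambda>x. B x v z) x (y - x)"])
         (intro linear_compose_sub lin1 lin2 xR yR linFD k(4))+
  qed (rule lin1 lin2 sm; assumption?)+
  then interpret linear_system B W r K .
  obtain \<theta> C where \<theta>: "continuous_on UNIV \<theta>" "\<And>x. norm (\<theta> x) \<le> C" "C \<ge> 0"
    "\<And>x. x \<in> cball 0 r \<Longrightarrow> \<theta> x = z0 + integral {0..1} (\<lambda>t. B (t *\<^sub>R x) x (\<theta> (t *\<^sub>R x)))"
    by (rule ray_integral_equation_solvable[of z0]) (rule that; assumption)
  interpret ray_solution B W r K C \<theta> z0
    by (intro ray_solution.intro ray_solution_axioms.intro linear_system_axioms)
       (rule \<theta> integrable; assumption?)+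
  show thesis
  proof (rule that[of r \<theta>])
    have "B (t *\<^sub>R 0) 0 (\<theta> (t *\<^sub>R 0)) = 0" for t :: real using linear_0[OF lin1[OF \<open>0 \<in> W\<close>]] by simp
    then have "integral {0..1} (\<lambda>t. B (t *\<^sub>R 0) 0 (\<theta> (t *\<^sub>R 0))) = 0" by (simp only: integral_0)
    moreover have "0 \<in> cball (0::'a) r" using r by simp
    ultimately show "\<theta> 0 = z0" by (rule_tac trans[OF \<theta>(4)]) (assumption, simp only: add_0_right)
    show "ball 0 r \<subseteq> W" using cR by auto
    show "(\<theta> has_derivative (\<lambda>v. B x v (\<theta> x))) (at x)" if "x \<in> ball 0 r" for x
      by (rule solution_derivative[OF that])
  qed (rule r)
qed

text \<open>Frobenius' theorem for linear systems. A solution is smooth because its derivative is a smooth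
  expression in the solution.\<close>

theorem linear_total_equation:
  fixes B :: "'a::euclidean_space \<Rightarrow> 'a \<Rightarrow> 'b::euclidean_space \<Rightarrow> 'b"
  assumes W: "open W" "x0 \<in> W"
    and lin1: "\<And>x z. x \<in> W \<Longrightarrow> linear (\<lambda>v. B x v z)" and lin2: "\<And>x v. x \<in> W \<Longrightarrow> linear (B x v)"
    and sm: "\<And>v z. smooth_on W (\<lambda>x. B x v z)"
    and integrable: "\<And>x v w z. x \<in> W \<Longrightarrow>
       FD (\<lambda>x. B x w z) x v + B x w (B x v z) = FD (\<lambda>x. B x v z) x w + B x v (B x w z)"
  obtains r \<theta> where "0 < r" "ball x0 r \<subseteq> W" "\<theta> x0 = z0" "smooth_on (ball x0 r) \<theta>"
    "\<And>x. x \<in> ball x0 r \<Longrightarrow> (\<theta> has_derivative (\<lambda>v. B x v (\<theta> x))) (at x)"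
proof -
  let ?W = "(\<lambda>x. x - x0) ` W"
  have mem: "x0 + x \<in> W" if "x \<in> ?W" for x using that by auto
  have oW: "open ?W" using open_translation[OF W(1), of "- x0"] by simp
  have tr: "((\<lambda>x. x0 + x) has_derivative (\<lambda>h. h)) (at x)" for x by (auto intro!: derivative_eq_intros)
  have FD_tr: "FD (\<lambda>x. B (x0 + x) v z) x = FD (\<lambda>x. B x v z) (x0 + x)" if "x \<in> ?W" for x v z
    using FD_eq[OF has_derivative_compose[OF tr smooth_on_has_derivative[OF sm mem[OF that]]]] .
  have sm': "smooth_on ?W (\<lambda>x. B (x0 + x) v z)" for v z
    by (rule smooth_on_compose[OF oW sm]) (use mem in \<open>auto intro!: smooth_on_add smooth_on_const smooth_on_ident oW\<close>)
  obtain r \<theta> where *: "0 < r" "ball 0 r \<subseteq> ?W" "\<theta> 0 = z0"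
    "\<And>x. x \<in> ball 0 r \<Longrightarrow> (\<theta> has_derivative (\<lambda>v. B (x0 + x) v (\<theta> x))) (at x)"
  proof (rule linear_total_equation_at_origin[of ?W "\<lambda>x. B (x0 + x)" z0])
    show "FD (\<lambda>x. B (x0 + x) w z) x v + B (x0 + x) w (B (x0 + x) v z)
        = FD (\<lambda>x. B (x0 + x) v z) x w + B (x0 + x) v (B (x0 + x) w z)" if "x \<in> ?W" for x v w z
      unfolding FD_tr[OF that] by (rule integrable[OF mem[OF that]])
    show "open ?W" "0 \<in> ?W" using oW W(2) by auto
    show "linear (\<lambda>v. B (x0 + x) v z)" if "x \<in> ?W" for x z by (rule lin1[OF mem[OF that]])
    show "linear (B (x0 + x) v)" if "x \<in> ?W" for x v by (rule lin2[OF mem[OF that]])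
  qed (rule sm' | (rule that; assumption))+
  have bW: "ball x0 r \<subseteq> W"
  proof
    fix x assume "x \<in> ball x0 r"
    then have "x - x0 \<in> ball 0 r" by (simp add: dist_norm norm_minus_commute)
    then show "x \<in> W" using *(2) mem[of "x - x0"] by auto
  qed
  have der: "((\<lambda>x. \<theta> (x - x0)) has_derivative (\<lambda>v. B x v (\<theta> (x - x0)))) (at x)" if x: "x \<in> ball x0 r" for x
  proof -
    have "x - x0 \<in> ball 0 r" using x by (simp add: dist_norm norm_minus_commute)
    from *(4)[OF this] have "(\<theta> has_derivative (\<lambda>v. B x v (\<theta> (x - x0)))) (at (x - x0))" by simp
    moreover have "((\<lambda>x. x - x0) has_derivative (\<lambda>h. h)) (at x)" by (auto intro!: derivative_eq_intros)
    ultimately show ?thesis by (rule has_derivative_compose[rotated])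
  qed
  have "Ck_on k (ball x0 r) (\<lambda>x. \<theta> (x - x0))" for k
  proof (induction k)
    case 0
    show ?case by (auto intro!: continuous_at_imp_continuous_on has_derivative_continuous[OF der])
  next
    case (Suc k)
    show ?case
    proof (rule Ck_on_SucI[OF open_ball der])
      show "Ck_on k (ball x0 r) (\<lambda>x. B x v (\<theta> (x - x0)))" for v
        by (rule Ck_on_family_apply[OF open_ball _ _ Suc])
           (use bW lin2 Ck_on_subset[OF smooth_on_Ck[OF sm] bW] in auto)
    qed
  qed
  then have "smooth_on (ball x0 r) (\<lambda>x. \<theta> (x - x0))" by (simp add: smooth_on_def)
  with * bW der show thesis by (intro that[of r "\<lambda>x. \<theta> (x - x0)"]) auto
qed

section \<open>Flat coordinates from parallel tensors\<close>

locale local_connection =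
  fixes W :: "'a::euclidean_space set" and \<Gamma> :: "'a \<Rightarrow> 'a \<Rightarrow> 'a \<Rightarrow> 'a" and gm :: "'a \<Rightarrow> 'a \<Rightarrow> 'a \<Rightarrow> real"
  assumes W: "open W"
    and \<Gamma>_lin1: "\<And>x w. x \<in> W \<Longrightarrow> linear (\<lambda>v. \<Gamma> x v w)" and \<Gamma>_lin2: "\<And>x v. x \<in> W \<Longrightarrow> linear (\<Gamma> x v)"
    and \<Gamma>_smooth: "\<And>v w. smooth_on W (\<lambda>x. \<Gamma> x v w)"
    and \<Gamma>_sym: "\<And>x v w. x \<in> W \<Longrightarrow> \<Gamma> x v w = \<Gamma> x w v"
    and gm_lin1: "\<And>x b. x \<in> W \<Longrightarrow> linear (\<lambda>a. gm x a b)" and gm_lin2: "\<And>x a. x \<in> W \<Longrightarrow> linear (gm x a)"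
    and gm_pos: "\<And>x a. x \<in> W \<Longrightarrow> a \<noteq> 0 \<Longrightarrow> gm x a a > 0"
    and gm_smooth: "\<And>a b. smooth_on W (\<lambda>x. gm x a b)"
    and gm_parallel: "\<And>x a b v. x \<in> W \<Longrightarrow> FD (\<lambda>x. gm x a b) x v = gm x (\<Gamma> x v a) b + gm x a (\<Gamma> x v b)"
begin

definition D\<Gamma> :: "'a \<Rightarrow> 'a \<Rightarrow> 'a \<Rightarrow> 'a \<Rightarrow> 'a" where
  "D\<Gamma> x u v w = FD (\<lambda>y. \<Gamma> y v w) x u"

text \<open>The curvature tensor in terms of the connection coefficients.\<close>

definition R :: "'a \<Rightarrow> 'a \<Rightarrow> 'a \<Rightarrow> 'a \<Rightarrow> 'a" where
  "R x u v w = D\<Gamma> x u v w - D\<Gamma> x v u w + \<Gamma> x u (\<Gamma> x v w) - \<Gamma> x v (\<Gamma> x u w)"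

text \<open>The derivative condition says that the covariant derivative of \<open>K\<close> vanishes.\<close>

definition parallel_endo :: "('a \<Rightarrow> 'a \<Rightarrow> 'a) \<Rightarrow> bool" where
  "parallel_endo K \<longleftrightarrow> (\<forall>x\<in>W. linear (K x)) \<and> (\<forall>w. smooth_on W (\<lambda>x. K x w)) \<and>
     (\<forall>x\<in>W. \<forall>v w. FD (\<lambda>x. K x w) x v = K x (\<Gamma> x v w) - \<Gamma> x v (K x w))"

lemma D\<Gamma>_linear:
  assumes x: "x \<in> W"
  shows "linear (\<lambda>u. D\<Gamma> x u v w)" "linear (\<lambda>v. D\<Gamma> x u v w)" "linear (D\<Gamma> x u v)"
proof -
  note d = smooth_on_differentiable[OF \<Gamma>_smooth x]
  show "linear (\<lambda>u. D\<Gamma> x u v w)" unfolding D\<Gamma>_def by (rule linear_frechet_derivative[OF d])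
  show "linear (\<lambda>v. D\<Gamma> x u v w)" unfolding D\<Gamma>_def by (rule linear_FD_family[OF \<Gamma>_lin1 W x d])
  have "linear (\<lambda>w. D\<Gamma> x u v w)" unfolding D\<Gamma>_def by (rule linear_FD_family[OF \<Gamma>_lin2 W x d])
  then show "linear (D\<Gamma> x u v)" .
qed

lemma D\<Gamma>_sym: "x \<in> W \<Longrightarrow> D\<Gamma> x u v w = D\<Gamma> x u w v"
  unfolding D\<Gamma>_def by (rule fun_cong[OF FD_cong_open[OF W]]) (auto intro: \<Gamma>_sym)

lemma R_linear:
  assumes x: "x \<in> W"
  shows "linear (\<lambda>u. R x u v w)" "linear (\<lambda>v. R x u v w)" "linear (R x u v)"
proof -
  note l = D\<Gamma>_linear[OF x] \<Gamma>_lin1[OF x] \<Gamma>_lin2[OF x]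
  have c: "linear (\<lambda>u. \<Gamma> x v (\<Gamma> x u w))" "linear (\<lambda>w. \<Gamma> x u (\<Gamma> x v w))" for u v w
    using linear_compose[OF \<Gamma>_lin1[OF x, of w] \<Gamma>_lin2[OF x, of v]]
      linear_compose[OF \<Gamma>_lin2[OF x, of v] \<Gamma>_lin2[OF x, of u]] by (simp_all add: o_def)
  show "linear (\<lambda>u. R x u v w)" "linear (\<lambda>v. R x u v w)" unfolding R_def
    by (intro linear_compose_sub linear_compose_add l c)+
  have "linear (\<lambda>w. R x u v w)" unfolding R_def
    by (intro linear_compose_sub linear_compose_add l c)
  then show "linear (R x u v)" .
qed

lemma R_skew: "R x u v w = - R x v u w"
  by (simp add: R_def)

lemma R_bianchi: "x \<in> W \<Longrightarrow> R x u v w + R x v w u + R x w u v = 0"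
  using D\<Gamma>_sym[of x u v w] D\<Gamma>_sym[of x v w u] D\<Gamma>_sym[of x w u v]
    \<Gamma>_sym[of x u v] \<Gamma>_sym[of x v w] \<Gamma>_sym[of x w u]
  by (simp add: R_def)

text \<open>Ricci identity: the curvature is the commutator of second covariant derivatives, so it acts as a
  derivation that kills every parallel tensor.\<close>

lemma R_commute:
  assumes K: "parallel_endo K" and x: "x \<in> W"
  shows "K x (R x u v w) = R x u v (K x w)"
proof -
  have lin: "\<And>y. y \<in> W \<Longrightarrow> linear (K y)" and sm: "\<And>w. smooth_on W (\<lambda>x. K x w)"
    and par: "\<And>y v w. y \<in> W \<Longrightarrow> FD (\<lambda>x. K x w) y v = K y (\<Gamma> y v w) - \<Gamma> y v (K y w)"
    using K by (auto simp: parallel_endo_def)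
  have dK: "((\<lambda>y. K y w) has_derivative (\<lambda>h. K x (\<Gamma> x h w) - \<Gamma> x h (K x w))) (at x)" for w
    using smooth_on_has_derivative[OF sm x, of w] par[OF x] by (metis (no_types, lifting) ext)
  have d\<Gamma>: "((\<lambda>y. \<Gamma> y v w) has_derivative (\<lambda>h. D\<Gamma> x h v w)) (at x)" for v w
    using smooth_on_has_derivative[OF \<Gamma>_smooth x] unfolding D\<Gamma>_def .
  have "FD (\<lambda>y. FD (\<lambda>x. K x w) y v) x u = (K x (\<Gamma> x u (\<Gamma> x v w)) - \<Gamma> x u (K x (\<Gamma> x v w)) + K x (D\<Gamma> x u v w))
      - (D\<Gamma> x u v (K x w) + \<Gamma> x v (K x (\<Gamma> x u w) - \<Gamma> x u (K x w)))" for u v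
  proof -
    have "FD (\<lambda>y. FD (\<lambda>x. K x w) y v) x = FD (\<lambda>y. K y (\<Gamma> y v w) - \<Gamma> y v (K y w)) x"
      by (rule FD_cong_open[OF W x par])
    also have "\<dots> = (\<lambda>u. (K x (\<Gamma> x u (\<Gamma> x v w)) - \<Gamma> x u (K x (\<Gamma> x v w)) + K x (D\<Gamma> x u v w))
      - (D\<Gamma> x u v (K x w) + \<Gamma> x v (K x (\<Gamma> x u w) - \<Gamma> x u (K x w))))"
      by (rule FD_eq, rule has_derivative_diff[OF has_derivative_family_apply[where K = K and K' = "\<lambda>h w. K x (\<Gamma> x h w) - \<Gamma> x h (K x w)", OF lin W x dK d\<Gamma>]
         has_derivative_family_apply[where K = "\<lambda>y. \<Gamma> y v" and K' = "\<lambda>h. D\<Gamma> x h v", OF \<Gamma>_lin2 W x d\<Gamma> dK]])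
    finally show ?thesis by (rule fun_cong)
  qed
  note second = this
  have "K x (R x u v w) - R x u v (K x w)
      = FD (\<lambda>y. FD (\<lambda>x. K x w) y v) x u - FD (\<lambda>y. FD (\<lambda>x. K x w) y u) x v"
    unfolding second R_def
    by (simp add: linear_diff[OF lin[OF x]] linear_add[OF lin[OF x]] linear_diff[OF \<Gamma>_lin2[OF x]] algebra_simps)
  then show ?thesis using second_derivative_symmetric[OF W sm x, of w v u] by simp
qed

text \<open>The same commutator argument for the parallel metric: the curvature acts by skew endomorphisms.\<close>

lemma R_metric:
  assumes x: "x \<in> W"
  shows "gm x (R x u v a) b + gm x a (R x u v b) = 0"
proof -
  have dg: "((\<lambda>y. gm y a b) has_derivative (\<lambda>h. gm x (\<Gamma> x h a) b + gm x a (\<Gamma> x h b))) (at x)" for a b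
    using smooth_on_has_derivative[OF gm_smooth x, of a b] gm_parallel[OF x] by (metis (no_types, lifting) ext)
  have d\<Gamma>: "((\<lambda>y. \<Gamma> y v w) has_derivative (\<lambda>h. D\<Gamma> x h v w)) (at x)" for v w
    using smooth_on_has_derivative[OF \<Gamma>_smooth x] unfolding D\<Gamma>_def .
  have "FD (\<lambda>y. FD (\<lambda>x. gm x a b) y v) x u =
      ((gm x (\<Gamma> x u (\<Gamma> x v a)) b + gm x (\<Gamma> x v a) (\<Gamma> x u b)) + gm x (D\<Gamma> x u v a) b)
      + ((gm x (\<Gamma> x u a) (\<Gamma> x v b) + gm x a (\<Gamma> x u (\<Gamma> x v b))) + gm x a (D\<Gamma> x u v b))" for u v
  proof -
    have "FD (\<lambda>y. FD (\<lambda>x. gm x a b) y v) x = FD (\<lambda>y. gm y (\<Gamma> y v a) b + gm y a (\<Gamma> y v b)) x"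
      by (rule FD_cong_open[OF W x gm_parallel])
    also have "\<dots> = (\<lambda>u. ((gm x (\<Gamma> x u (\<Gamma> x v a)) b + gm x (\<Gamma> x v a) (\<Gamma> x u b)) + gm x (D\<Gamma> x u v a) b)
      + ((gm x (\<Gamma> x u a) (\<Gamma> x v b) + gm x a (\<Gamma> x u (\<Gamma> x v b))) + gm x a (D\<Gamma> x u v b)))"
      by (rule FD_eq, rule has_derivative_add[OF has_derivative_family_apply[where K = "\<lambda>y z. gm y z b" and K' = "\<lambda>h z. gm x (\<Gamma> x h z) b + gm x z (\<Gamma> x h b)", OF gm_lin1 W x dg d\<Gamma>]
         has_derivative_family_apply[where K = "\<lambda>y. gm y a" and K' = "\<lambda>h z. gm x (\<Gamma> x h a) z + gm x a (\<Gamma> x h z)", OF gm_lin2 W x dg d\<Gamma>]])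
    finally show ?thesis by (rule fun_cong)
  qed
  from this[of u v] this[of v u] second_derivative_symmetric[OF W gm_smooth x, of a b v u]
  show ?thesis
    by (simp add: R_def linear_diff[OF gm_lin1[OF x]] linear_add[OF gm_lin1[OF x]]
        linear_diff[OF gm_lin2[OF x]] linear_add[OF gm_lin2[OF x]] algebra_simps)
qed

text \<open>The sum of four Bianchi identities, simplified by the two skew symmetries.\<close>

lemma R_pair_symmetry:
  assumes x: "x \<in> W" and sym: "\<And>a b. gm x a b = gm x b a"
  shows "gm x (R x u v w) z = gm x (R x w z u) v"
proof -
  define q where "q u v w z = gm x (R x u v w) z" for u v w z
  have s1: "q u v w z = - q v u w z" for u v w z
    unfolding q_def R_skew[of x u v] by (rule linear_neg[OF gm_lin1[OF x]])
  have s2: "q u v w z = - q u v z w" for u v w z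
    using R_metric[OF x, of u v w z] sym[of w "R x u v z"] by (simp add: q_def)
  have b: "q u v w z + q v w u z + q w u v z = 0" for u v w z
  proof -
    have "gm x (R x u v w + R x v w u + R x w u v) z = 0"
      unfolding R_bianchi[OF x] by (rule linear_0[OF gm_lin1[OF x]])
    then show ?thesis by (simp add: q_def linear_add[OF gm_lin1[OF x]])
  qed
  have "q u v w z = q w z u v"
    using b[of u v w z] b[of v w z u] b[of w z u v] b[of z u v w]
      s1[of u v w z] s2[of u v w z] s1[of v w u z] s2[of v w u z] s1[of w u v z] s2[of w u v z]
      s1[of w z v u] s2[of w z v u] s1[of z v w u] s2[of z v w u] s1[of z u w v] s2[of z u w v]
      s1[of u w z v] s2[of u w z v] s1[of u v z w] s1[of v z u w] s2[of v z u w] s1[of w z u v] s2[of w z u v]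
    by linarith
  then show ?thesis by (simp add: q_def)
qed

end

text \<open>A parallel complex structure that interchanges the two factors of a parallel orthogonal splitting
  forces flatness: mixed curvatures vanish by pair symmetry, and the first Bianchi identity together
  with the complex structure reduces all others to mixed ones.\<close>

locale parallel_lagrangian_splitting = local_connection W \<Gamma> gm
  for W :: "'a::euclidean_space set" and \<Gamma> gm +
  fixes Jm Pm :: "'a \<Rightarrow> 'a \<Rightarrow> 'a"
  assumes gm_sym: "\<And>x a b. x \<in> W \<Longrightarrow> gm x a b = gm x b a"
    and J: "parallel_endo Jm" and P: "parallel_endo Pm"
    and J_square: "\<And>x v. x \<in> W \<Longrightarrow> Jm x (Jm x v) = - v"
    and P_idem: "\<And>x v. x \<in> W \<Longrightarrow> Pm x (Pm x v) = Pm x v"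
    and P_selfadjoint: "\<And>x a b. x \<in> W \<Longrightarrow> gm x (Pm x a) b = gm x a (Pm x b)"
    and J_swaps: "\<And>x v. x \<in> W \<Longrightarrow> Pm x (Jm x v) = Jm x (v - Pm x v)"
begin

lemma curvature_vanishes:
  assumes x: "x \<in> W"
  shows "R x u v w = 0"
proof -
  let ?P = "Pm x" let ?Q = "\<lambda>v. v - Pm x v"
  have linP: "linear ?P" and linJ: "linear (Jm x)" using P J x by (auto simp: parallel_endo_def)
  have PQ: "?P (?Q v) = 0" for v by (simp add: linear_diff[OF linP] P_idem[OF x])
  have nondeg: "a = 0" if "\<And>b. gm x a b = 0" for a using gm_pos[OF x, of a] that[of a] by fastforce
  have mixed0: "gm x (R x u v w) z = 0" if "?P w = w" "?P z = 0" for u v w z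
    using P_selfadjoint[OF x, of "R x u v w" z] R_commute[OF P x, of u v w] that
      linear_0[OF gm_lin2[OF x]] by simp
  have mixed: "R x a b w = 0" if "?P a = a" "?P b = 0" for a b w
    by (rule nondeg, subst R_pair_symmetry[OF x gm_sym[OF x]], rule mixed0[OF that])
  have mixed': "R x b a w = 0" if "?P a = a" "?P b = 0" for a b w
    using mixed[OF that] R_skew[of x b a w] by simp
  have JP: "?P (Jm x w) = 0" if "?P w = w" for w using J_swaps[OF x, of w] that linear_0[OF linJ] by simp
  have JQ: "?P (Jm x w) = Jm x w" if "?P w = 0" for w using J_swaps[OF x, of w] that by simp
  have Jinj: "w = 0" if "Jm x w = 0" for w using J_square[OF x, of w] that linear_0[OF linJ] by simp
  have vvh: "R x a b w = 0" if "?P a = a" "?P b = b" "?P w = 0" for a b w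
    using R_bianchi[OF x, of a b w] mixed[OF that(2,3), of a] mixed'[OF that(1,3), of b] by simp
  have hhv: "R x a b w = 0" if "?P a = 0" "?P b = 0" "?P w = w" for a b w
    using R_bianchi[OF x, of a b w] mixed'[OF that(3,2), of a] mixed[OF that(3,1), of b] by simp
  have vvv: "R x a b w = 0" if "?P a = a" "?P b = b" "?P w = w" for a b w
    using vvh[OF that(1,2) JP[OF that(3)]] R_commute[OF J x, of a b w] Jinj by simp
  have hhh: "R x a b w = 0" if "?P a = 0" "?P b = 0" "?P w = 0" for a b w
    using hhv[OF that(1,2) JQ[OF that(3)]] R_commute[OF J x, of a b w] Jinj by simp
  have split: "a = ?P a + ?Q a" for a by simp
  have vv: "R x a b w = 0" if "?P a = a" "?P b = b" for a b w
    by (subst split[of w], subst linear_add[OF R_linear(3)[OF x]])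
       (simp add: vvv[OF that P_idem[OF x]] vvh[OF that PQ])
  have hh: "R x a b w = 0" if "?P a = 0" "?P b = 0" for a b w
    by (subst split[of w], subst linear_add[OF R_linear(3)[OF x]])
       (simp add: hhv[OF that P_idem[OF x]] hhh[OF that PQ])
  have "R x (?P u) v w = 0"
    by (subst split[of v], subst linear_add[OF R_linear(2)[OF x]])
       (simp add: vv[OF P_idem[OF x] P_idem[OF x]] mixed[OF P_idem[OF x] PQ])
  moreover have "R x (?Q u) v w = 0"
    by (subst split[of v], subst linear_add[OF R_linear(2)[OF x]])
       (simp only: hh[OF PQ PQ] mixed'[OF P_idem[OF x] PQ] add_0_right)
  ultimately show ?thesis
    by (subst split[of u], subst linear_add[OF R_linear(1)[OF x]]) simp
qed

text \<open>The pair (function, differential) of an affine function solves a linear total differential equation,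
  integrable because the connection is torsion free and flat.\<close>

lemma affine_function:
  assumes x0: "x0 \<in> W"
  obtains r s \<theta> where "0 < r" "ball x0 r \<subseteq> W" "smooth_on (ball x0 r) s" "\<theta> x0 = i"
    "smooth_on (ball x0 r) (\<theta> :: 'a \<Rightarrow> 'a)" "\<And>x. x \<in> ball x0 r \<Longrightarrow> (s has_derivative (\<lambda>v. \<theta> x \<bullet> v)) (at x)"
    "\<And>x w. x \<in> ball x0 r \<Longrightarrow> ((\<lambda>x. \<theta> x \<bullet> w) has_derivative (\<lambda>v. \<theta> x \<bullet> \<Gamma> x v w)) (at x)"
proof -
  define A where "A x v \<theta> = (\<Sum>j\<in>Basis. (\<theta> \<bullet> \<Gamma> x v j) *\<^sub>R j)" for x v \<theta>
  define B where "B x v z = (snd z \<bullet> v, A x v (snd z))" for x v and z :: "real \<times> 'a"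
  have A: "A x v \<theta> \<bullet> w = \<theta> \<bullet> \<Gamma> x v w" if "x \<in> W" for x v \<theta> w
  proof -
    have "A x v \<theta> \<bullet> w = \<theta> \<bullet> (\<Sum>j\<in>Basis. (w \<bullet> j) *\<^sub>R \<Gamma> x v j)"
      by (simp add: A_def inner_sum_left inner_sum_right inner_commute mult.commute)
    then show ?thesis unfolding linear_basis_expand[OF \<Gamma>_lin2[OF that], of v w] .
  qed
  have A_lin: "linear (\<lambda>v. A x v \<theta>)" "linear (A x v)" if "x \<in> W" for x v \<theta>
    unfolding A_def
    by (auto intro!: linearI simp: linear_add[OF \<Gamma>_lin1[OF that]] linear_cmul[OF \<Gamma>_lin1[OF that]]
        inner_add_right inner_add_left scaleR_add_left sum.distrib scaleR_sum_right)
  have A_smooth: "smooth_on W (\<lambda>x. A x v \<theta>)" for v \<theta>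
    unfolding A_def
    by (rule smooth_on_sum[OF W], rule smooth_on_scaleR[OF W smooth_on_inner[OF W smooth_on_const \<Gamma>_smooth] smooth_on_const])
  have A_FD: "FD (\<lambda>x. A x v \<theta>) x u \<bullet> w = \<theta> \<bullet> D\<Gamma> x u v w" if "x \<in> W" for x v \<theta> u w
  proof -
    have "((\<lambda>x. A x v \<theta> \<bullet> w) has_derivative (\<lambda>u. FD (\<lambda>x. A x v \<theta>) x u \<bullet> w)) (at x)"
      by (rule bounded_linear.has_derivative[OF bounded_linear_inner_left smooth_on_has_derivative[OF A_smooth that]])
    then have "((\<lambda>x. \<theta> \<bullet> \<Gamma> x v w) has_derivative (\<lambda>u. FD (\<lambda>x. A x v \<theta>) x u \<bullet> w)) (at x)"
      by (rule has_derivative_transform_within_open[OF _ W that A])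
    moreover have "((\<lambda>x. \<theta> \<bullet> \<Gamma> x v w) has_derivative (\<lambda>u. \<theta> \<bullet> D\<Gamma> x u v w)) (at x)"
      unfolding D\<Gamma>_def
      by (rule bounded_linear.has_derivative[OF bounded_linear_inner_right smooth_on_has_derivative[OF \<Gamma>_smooth that]])
    ultimately show ?thesis by (metis has_derivative_unique)
  qed
  have Pair0: "bounded_linear (\<lambda>w::'a. (0::real, w))" by (auto intro: bounded_linear_Pair bounded_linear_ident bounded_linear_zero)
  have B_alt: "B x v z = (snd z \<bullet> v, 0) + (0, A x v (snd z))" for x v z by (simp add: B_def)
  have B_smooth: "smooth_on W (\<lambda>x. B x v z)" for v z
    unfolding B_alt by (rule smooth_on_add[OF W smooth_on_const smooth_on_linear[OF W Pair0 A_smooth]])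
  have B_FD: "FD (\<lambda>x. B x v z) x u = (0, FD (\<lambda>x. A x v (snd z)) x u)" if "x \<in> W" for x v z u
  proof -
    have "((\<lambda>x. B x v z) has_derivative (\<lambda>u. 0 + (0, FD (\<lambda>x. A x v (snd z)) x u))) (at x)"
      unfolding B_alt
      by (rule has_derivative_add[OF has_derivative_const bounded_linear.has_derivative[OF Pair0 smooth_on_has_derivative[OF A_smooth that]]])
    from FD_eq[OF this] show ?thesis by simp
  qed
  obtain r z where r: "0 < r" "ball x0 r \<subseteq> W" "z x0 = (0, i)" "smooth_on (ball x0 r) z"
    and z: "\<And>x. x \<in> ball x0 r \<Longrightarrow> (z has_derivative (\<lambda>v. B x v (z x))) (at x)"
  proof (rule linear_total_equation[of W x0 B "(0, i)"])
    show "linear (\<lambda>v. B x v z)" "linear (B x v)" if "x \<in> W" for x v z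
      by (auto intro!: linearI simp: B_def linear_add[OF A_lin(1)[OF that]] linear_cmul[OF A_lin(1)[OF that]]
          linear_add[OF A_lin(2)[OF that]] linear_cmul[OF A_lin(2)[OF that]] inner_add_right inner_add_left)
    show "FD (\<lambda>x. B x w z) x v + B x w (B x v z) = FD (\<lambda>x. B x v z) x w + B x v (B x w z)"
      if x: "x \<in> W" for x v w z
    proof -
      have "FD (\<lambda>x. A x w (snd z)) x v + A x w (A x v (snd z)) = FD (\<lambda>x. A x v (snd z)) x w + A x v (A x w (snd z))"
      proof (rule euclidean_eqI)
        fix k :: 'a
        have "snd z \<bullet> R x v w k = 0" by (simp add: curvature_vanishes[OF x])
        then show "(FD (\<lambda>x. A x w (snd z)) x v + A x w (A x v (snd z))) \<bullet> k
            = (FD (\<lambda>x. A x v (snd z)) x w + A x v (A x w (snd z))) \<bullet> k"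
          by (simp add: inner_add_left A_FD[OF x] A[OF x] R_def inner_diff_right inner_add_right)
      qed
      moreover have "A x v (snd z) \<bullet> w = A x w (snd z) \<bullet> v" using \<Gamma>_sym[OF x] by (simp add: A[OF x])
      ultimately show ?thesis unfolding B_FD[OF x] by (simp add: B_def)
    qed
  qed (rule W x0 B_smooth | (rule that; assumption))+
  show thesis
  proof (rule that[of r "\<lambda>x. fst (z x)" "\<lambda>x. snd (z x)"])
    show "smooth_on (ball x0 r) (\<lambda>x. fst (z x))" "smooth_on (ball x0 r) (\<lambda>x. snd (z x))"
      by (rule smooth_on_linear[OF open_ball _ r(4)], rule bounded_linear_fst bounded_linear_snd)+
    fix x w assume x: "x \<in> ball x0 r"
    have xW: "x \<in> W" using x r(2) by blast
    show "((\<lambda>x. fst (z x)) has_derivative (\<lambda>v. snd (z x) \<bullet> v)) (at x)"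
      using has_derivative_fst[OF z[OF x]] by (simp add: B_def)
    have "((\<lambda>x. snd (z x) \<bullet> w) has_derivative (\<lambda>v. snd (B x v (z x)) \<bullet> w)) (at x)"
      by (rule bounded_linear.has_derivative[OF bounded_linear_inner_left has_derivative_snd[OF z[OF x]]])
    then show "((\<lambda>x. snd (z x) \<bullet> w) has_derivative (\<lambda>v. snd (z x) \<bullet> \<Gamma> x v w)) (at x)"
      by (simp add: B_def A[OF xW])
  qed (use r in auto)
qed

text \<open>Affine functions whose differentials at \<open>x\<^sub>0\<close> form the standard dual basis are the components of \<open>\<psi>\<close>. Its
  differential \<open>M\<close> is parallel, hence the columns of \<open>M\<close>'s inverse \<open>u\<close> are parallel vector fields, and every
  parallel tensor has constant components with respect to them.\<close>

theorem flat_coordinates: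
  assumes x0: "x0 \<in> W"
  obtains r \<psi> where "0 < r" "ball x0 r \<subseteq> W" "smooth_on (ball x0 r) \<psi>"
    "\<And>x. x \<in> ball x0 r \<Longrightarrow> inj (FD \<psi> x)"
    "\<And>x v w. x \<in> ball x0 r \<Longrightarrow> gm x v w = gm x0 (FD \<psi> x v) (FD \<psi> x w)"
    "\<And>x v. x \<in> ball x0 r \<Longrightarrow> FD \<psi> x (Pm x v) = Pm x0 (FD \<psi> x v)"
proof -
  define affine where "affine i r s \<theta> \<longleftrightarrow> 0 < r \<and> ball x0 r \<subseteq> W \<and> smooth_on (ball x0 r) s \<and> \<theta> x0 = i \<and>
    smooth_on (ball x0 r) \<theta> \<and> (\<forall>x\<in>ball x0 r. (s has_derivative (\<lambda>v. \<theta> x \<bullet> v)) (at x)) \<and>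
    (\<forall>x\<in>ball x0 r. \<forall>w. ((\<lambda>x. \<theta> x \<bullet> w) has_derivative (\<lambda>v. \<theta> x \<bullet> \<Gamma> x v w)) (at x))"
    for i r and s :: "'a \<Rightarrow> real" and \<theta> :: "'a \<Rightarrow> 'a"
  have "\<exists>t. affine i (fst t) (fst (snd t)) (snd (snd t))" for i
  proof (rule affine_function[OF x0, of i])
    fix r s and \<theta> :: "'a \<Rightarrow> 'a"
    assume *: "0 < r" "ball x0 r \<subseteq> W" "smooth_on (ball x0 r) s" "\<theta> x0 = i" "smooth_on (ball x0 r) \<theta>"
      "\<And>x. x \<in> ball x0 r \<Longrightarrow> (s has_derivative (\<lambda>v. \<theta> x \<bullet> v)) (at x)"
      "\<And>x w. x \<in> ball x0 r \<Longrightarrow> ((\<lambda>x. \<theta> x \<bullet> w) has_derivative (\<lambda>v. \<theta> x \<bullet> \<Gamma> x v w)) (at x)"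
    show ?thesis by (intro exI[of _ "(r, s, \<theta>)"]) (simp add: affine_def *)
  qed
  then obtain t where t: "\<And>i. affine i (fst (t i)) (fst (snd (t i))) (snd (snd (t i)))"
    using choice[of "\<lambda>i t. affine i (fst t) (fst (snd t)) (snd (snd t))"] by blast
  define \<rho> s \<theta> where "\<rho> i = fst (t i)" and "s i = fst (snd (t i))" and "\<theta> i = snd (snd (t i))" for i
  have aff: "affine i (\<rho> i) (s i) (\<theta> i)" for i using t by (simp add: \<rho>_def s_def \<theta>_def)
  define r1 where "r1 = Min (\<rho> ` (Basis :: 'a set))"
  have r1: "0 < r1" "\<And>i. i \<in> Basis \<Longrightarrow> r1 \<le> \<rho> i"
    using aff by (auto simp: r1_def affine_def)
  have sub: "ball x0 r1 \<subseteq> ball x0 (\<rho> i)" if "i \<in> Basis" for i using r1(2)[OF that] by auto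
  have bW: "ball x0 r1 \<subseteq> W"
  proof -
    obtain i :: 'a where "i \<in> Basis" using nonempty_Basis by blast
    then show ?thesis using sub aff[of i] unfolding affine_def by blast
  qed
  define \<psi> where "\<psi> x = (\<Sum>i\<in>Basis. s i x *\<^sub>R i)" for x
  define M where "M x v = (\<Sum>i\<in>Basis. (\<theta> i x \<bullet> v) *\<^sub>R i)" for x v
  have M0: "M x0 v = v" for v
  proof -
    have "\<theta> i x0 = i" for i using aff[of i] by (simp add: affine_def)
    then show ?thesis by (simp add: M_def inner_commute[of _ v] euclidean_representation)
  qed
  have M_lin: "linear (M x)" for x
    unfolding M_def by (auto intro!: linearI simp: inner_add_right scaleR_add_left sum.distrib scaleR_sum_right)
  have \<psi>_smooth: "smooth_on (ball x0 r1) \<psi>"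
    unfolding \<psi>_def
  proof (rule smooth_on_sum[OF open_ball])
    fix i :: 'a assume i: "i \<in> Basis"
    have "smooth_on (ball x0 r1) (s i)"
      by (rule smooth_on_subset[OF _ sub[OF i]]) (use aff[of i] in \<open>simp add: affine_def\<close>)
    then show "smooth_on (ball x0 r1) (\<lambda>x. s i x *\<^sub>R i)"
      by (rule smooth_on_linear[OF open_ball bounded_linear_scaleR_left])
  qed
  have M_smooth: "smooth_on (ball x0 r1) (\<lambda>x. M x w)" for w
    unfolding M_def
  proof (rule smooth_on_sum[OF open_ball])
    fix i :: 'a assume i: "i \<in> Basis"
    have "smooth_on (ball x0 r1) (\<theta> i)"
      by (rule smooth_on_subset[OF _ sub[OF i]]) (use aff[of i] in \<open>simp add: affine_def\<close>)
    then show "smooth_on (ball x0 r1) (\<lambda>x. (\<theta> i x \<bullet> w) *\<^sub>R i)"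
      by (intro smooth_on_linear[OF open_ball bounded_linear_scaleR_left] smooth_on_linear[OF open_ball bounded_linear_inner_left])
  qed
  have \<psi>_der: "(\<psi> has_derivative M x) (at x)" if x: "x \<in> ball x0 r1" for x
    unfolding \<psi>_def M_def
  proof (rule has_derivative_sum)
    fix i :: 'a assume i: "i \<in> Basis"
    have "(s i has_derivative (\<lambda>v. \<theta> i x \<bullet> v)) (at x)" using aff[of i] sub[OF i] x by (auto simp: affine_def)
    then show "((\<lambda>x. s i x *\<^sub>R i) has_derivative (\<lambda>v. (\<theta> i x \<bullet> v) *\<^sub>R i)) (at x)"
      by (rule bounded_linear.has_derivative[OF bounded_linear_scaleR_left])
  qed
  have M_der: "((\<lambda>x. M x w) has_derivative (\<lambda>v. M x (\<Gamma> x v w))) (at x)" if x: "x \<in> ball x0 r1" for x w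
    unfolding M_def
  proof (rule has_derivative_sum)
    fix i :: 'a assume i: "i \<in> Basis"
    have "((\<lambda>x. \<theta> i x \<bullet> w) has_derivative (\<lambda>v. \<theta> i x \<bullet> \<Gamma> x v w)) (at x)"
      using aff[of i] sub[OF i] x by (auto simp: affine_def)
    then show "((\<lambda>x. (\<theta> i x \<bullet> w) *\<^sub>R i) has_derivative (\<lambda>v. (\<theta> i x \<bullet> \<Gamma> x v w) *\<^sub>R i)) (at x)"
      by (rule bounded_linear.has_derivative[OF bounded_linear_scaleR_left])
  qed
  (* M is the identity at x0, hence invertible as long as it differs from it by less than one. *)
  define \<eta> where "\<eta> x = (\<Sum>i\<in>Basis. norm (M x i - i))" for x
  have "isCont (\<lambda>x. M x i) x0" for i
    using smooth_on_continuous[OF M_smooth] r1(1) by (simp add: continuous_on_eq_continuous_at)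
  then have "isCont \<eta> x0" unfolding \<eta>_def by (intro continuous_intros)
  then have "\<forall>\<^sub>F x in nhds x0. \<eta> x < 1"
    using order_tendstoD(2)[OF tendsto_at_iff_tendsto_nhds[THEN iffD1, OF \<open>isCont \<eta> x0\<close>[unfolded isCont_def]], of 1]
    by (simp add: \<eta>_def M0)
  then obtain r2 where r2: "r2 > 0" "\<And>x. dist x x0 < r2 \<Longrightarrow> \<eta> x < 1" unfolding eventually_nhds_metric by blast
  define r where "r = min r1 r2"
  have r: "0 < r" "ball x0 r \<subseteq> ball x0 r1" using r1 r2 by (auto simp: r_def)
  have M_inj: "inj (M x)" if x: "x \<in> ball x0 r" for x
    unfolding linear_injective_0[OF M_lin]
  proof (intro allI impI, rule ccontr)
    fix v assume v: "M x v = 0" "v \<noteq> 0"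
    have "v = (\<Sum>i\<in>Basis. (v \<bullet> i) *\<^sub>R (i - M x i))"
      using linear_basis_expand[OF M_lin, of x v] v(1)
      by (simp add: scaleR_diff_right sum_subtractf euclidean_representation)
    then have "norm v = norm (\<Sum>i\<in>Basis. (v \<bullet> i) *\<^sub>R (i - M x i))" by simp
    also have "\<dots> \<le> (\<Sum>i\<in>Basis. norm v * norm (M x i - i))"
      by (rule sum_norm_le) (simp add: mult_right_mono Basis_le_norm norm_minus_commute)
    also have "\<dots> = norm v * \<eta> x" by (simp add: \<eta>_def sum_distrib_left)
    finally have "norm v * 1 \<le> norm v * \<eta> x" by simp
    then show False using v(2) r2(2)[of x] x by (simp add: r_def dist_commute)
  qed
  define u where "u x = inv (M x)" for x
  have u: "M x (u x z) = z" "u x (M x z) = z" if "x \<in> ball x0 r" for x z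
    using M_inj[OF that] linear_injective_imp_surjective[OF M_lin M_inj[OF that]]
    by (auto simp: u_def surj_f_inv_f)
  have u_smooth: "smooth_on (ball x0 r) (\<lambda>x. u x z)" for z
    by (rule smooth_on_family_inverse[OF open_ball M_lin smooth_on_subset[OF M_smooth r(2)] u])
  have u_der: "((\<lambda>x. u x z) has_derivative (\<lambda>h. - \<Gamma> x h (u x z))) (at x)" if x: "x \<in> ball x0 r" for x z
  proof -
    have d: "((\<lambda>x. u x z) has_derivative FD (\<lambda>x. u x z) x) (at x)"
      by (rule smooth_on_has_derivative[OF u_smooth x])
    have "((\<lambda>x. M x (u x z)) has_derivative (\<lambda>h. M x (\<Gamma> x h (u x z)) + M x (FD (\<lambda>x. u x z) x h))) (at x)"
      by (rule has_derivative_family_apply[where K = M and K' = "\<lambda>h w. M x (\<Gamma> x h w)", OF M_lin open_ball x M_der d])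
         (use x r(2) in blast)
    then have "((\<lambda>x. z) has_derivative (\<lambda>h. M x (\<Gamma> x h (u x z)) + M x (FD (\<lambda>x. u x z) x h))) (at x)"
      by (rule has_derivative_transform_within_open[OF _ open_ball x]) (rule u)
    from has_derivative_unique[OF this has_derivative_const]
    have "M x (\<Gamma> x h (u x z) + FD (\<lambda>x. u x z) x h) = M x 0" for h
      by (simp add: linear_add[OF M_lin] linear_0[OF M_lin] fun_eq_iff)
    then have "\<Gamma> x h (u x z) + FD (\<lambda>x. u x z) x h = 0" for h using injD[OF M_inj[OF x]] by blast
    then have "FD (\<lambda>x. u x z) x = (\<lambda>h. - \<Gamma> x h (u x z))" by (auto simp: fun_eq_iff add_eq_0_iff)
    with d show ?thesis by simp
  qed
  have brW: "x \<in> W" if "x \<in> ball x0 r" for x using that r(2) bW by blast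
  have x0r: "x0 \<in> ball x0 r" using r(1) by simp
  have u0: "u x0 z = z" for z using u(2)[OF x0r, of z] by (simp add: M0)
  have const: "f x = f x0" if x: "x \<in> ball x0 r" and "\<And>y. y \<in> ball x0 r \<Longrightarrow> (f has_derivative (\<lambda>h. 0)) (at y)"
    for f :: "'a \<Rightarrow> 'b::real_normed_vector" and x
  proof -
    have "\<exists>c. \<forall>y\<in>ball x0 r. f y = c"
      by (rule has_derivative_zero_constant[OF convex_ball]) (rule has_derivative_at_withinI[OF that(2)])
    then show ?thesis using x x0r by force
  qed
  have dg: "((\<lambda>y. gm y a b) has_derivative (\<lambda>h. gm x (\<Gamma> x h a) b + gm x a (\<Gamma> x h b))) (at x)" if "x \<in> W" for x a b
    using smooth_on_has_derivative[OF gm_smooth that, of a b] gm_parallel[OF that] by (metis (no_types, lifting) ext)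
  have g_const: "gm x (u x a) (u x b) = gm x0 a b" if x: "x \<in> ball x0 r" for x a b
  proof -
    have "((\<lambda>y. gm y (u y a) (u y b)) has_derivative (\<lambda>h. 0)) (at y)" if y: "y \<in> ball x0 r" for y
    proof -
      note yW = brW[OF y]
      have 1: "((\<lambda>y. gm y (u y a) z) has_derivative (\<lambda>h. gm y (u y a) (\<Gamma> y h z))) (at y)" for z
      proof -
        have "((\<lambda>y. gm y (u y a) z) has_derivative (\<lambda>h. (gm y (\<Gamma> y h (u y a)) z + gm y (u y a) (\<Gamma> y h z))
            + gm y (- \<Gamma> y h (u y a)) z)) (at y)"
          by (rule has_derivative_family_apply[where K = "\<lambda>y w. gm y w z" and K' = "\<lambda>h w. gm y (\<Gamma> y h w) z + gm y w (\<Gamma> y h z)",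
                OF gm_lin1[OF brW] open_ball y dg[OF yW] u_der[OF y]])
        then show ?thesis by (simp add: linear_neg[OF gm_lin1[OF yW]])
      qed
      have "((\<lambda>y. gm y (u y a) (u y b)) has_derivative (\<lambda>h. gm y (u y a) (\<Gamma> y h (u y b)) + gm y (u y a) (- \<Gamma> y h (u y b)))) (at y)"
        by (rule has_derivative_family_apply[where K = "\<lambda>y. gm y (u y a)" and K' = "\<lambda>h w. gm y (u y a) (\<Gamma> y h w)",
              OF gm_lin2[OF brW] open_ball y 1 u_der[OF y]])
      then show ?thesis by (simp add: linear_neg[OF gm_lin2[OF yW]])
    qed
    from const[OF x this] show ?thesis by (simp add: u0)
  qed
  have linP: "\<And>y. y \<in> W \<Longrightarrow> linear (Pm y)" and smP: "\<And>w. smooth_on W (\<lambda>x. Pm x w)"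
    and parP: "\<And>y v w. y \<in> W \<Longrightarrow> FD (\<lambda>x. Pm x w) y v = Pm y (\<Gamma> y v w) - \<Gamma> y v (Pm y w)"
    using P by (auto simp: parallel_endo_def)
  have dP: "((\<lambda>y. Pm y w) has_derivative (\<lambda>h. Pm x (\<Gamma> x h w) - \<Gamma> x h (Pm x w))) (at x)" if "x \<in> W" for x w
    using smooth_on_has_derivative[OF smP that, of w] parP[OF that] by (metis (no_types, lifting) ext)
  have P_const: "M x (Pm x (u x a)) = Pm x0 a" if x: "x \<in> ball x0 r" for x a
  proof -
    have "((\<lambda>y. M y (Pm y (u y a))) has_derivative (\<lambda>h. 0)) (at y)" if y: "y \<in> ball x0 r" for y
    proof -
      note yW = brW[OF y]
      have y1: "y \<in> ball x0 r1" using y r(2) by blast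
      have "((\<lambda>y. Pm y (u y a)) has_derivative (\<lambda>h. (Pm y (\<Gamma> y h (u y a)) - \<Gamma> y h (Pm y (u y a))) + Pm y (- \<Gamma> y h (u y a)))) (at y)"
        by (rule has_derivative_family_apply[where K = Pm and K' = "\<lambda>h w. Pm y (\<Gamma> y h w) - \<Gamma> y h (Pm y w)",
              OF linP[OF brW] open_ball y dP[OF yW] u_der[OF y]])
      then have "((\<lambda>y. Pm y (u y a)) has_derivative (\<lambda>h. - \<Gamma> y h (Pm y (u y a)))) (at y)"
        by (simp add: linear_neg[OF linP[OF yW]])
      from has_derivative_family_apply[where K = M and K' = "\<lambda>h w. M y (\<Gamma> y h w)", OF M_lin open_ball y M_der[OF y1] this]
      show ?thesis by (simp add: linear_neg[OF M_lin])
    qed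
    from const[OF x this] show ?thesis by (simp add: u0 M0)
  qed
  show thesis
  proof (rule that[of r \<psi>])
    show "smooth_on (ball x0 r) \<psi>" by (rule smooth_on_subset[OF \<psi>_smooth r(2)])
    have FD\<psi>: "FD \<psi> x = M x" if "x \<in> ball x0 r" for x using \<psi>_der that r(2) by (blast intro: FD_eq)
    fix x v w assume x: "x \<in> ball x0 r"
    show "inj (FD \<psi> x)" unfolding FD\<psi>[OF x] by (rule M_inj[OF x])
    show "gm x v w = gm x0 (FD \<psi> x v) (FD \<psi> x w)"
      using g_const[OF x, of "M x v" "M x w"] by (simp add: FD\<psi>[OF x] u[OF x])
    show "FD \<psi> x (Pm x v) = Pm x0 (FD \<psi> x v)"
      using P_const[OF x, of "M x v"] by (simp add: FD\<psi>[OF x] u[OF x])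
  qed (use r bW in auto)
qed

end

section \<open>Calculus in charts\<close>

lemma smooth_on_congI:
  "open S \<Longrightarrow> smooth_on S g \<Longrightarrow> (\<And>x. x \<in> S \<Longrightarrow> f x = g x) \<Longrightarrow> smooth_on S f"
  by (rule smooth_on_cong[THEN iffD2])

abbreviation cimg :: "('m, 'e) chart \<Rightarrow> 'e set" where
  "cimg c \<equiv> snd c ` fst c"

lemma chart_inverse:
  assumes "is_chart c"
  shows "p \<in> fst c \<Longrightarrow> inv_chart c (snd c p) = p"
    "x \<in> cimg c \<Longrightarrow> inv_chart c x \<in> fst c" "x \<in> cimg c \<Longrightarrow> snd c (inv_chart c x) = x"
  using assms by (auto simp: is_chart_def homeomorphism_def)

lemma chart_open: "is_chart c \<Longrightarrow> open (fst c)" "is_chart c \<Longrightarrow> open (cimg c)"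
  by (auto simp: is_chart_def)

lemma chart_continuous:
  "is_chart c \<Longrightarrow> continuous_on (fst c) (snd c)" "is_chart c \<Longrightarrow> continuous_on (cimg c) (inv_chart c)"
  by (auto simp: is_chart_def homeomorphism_def)

lemma chart_image_Int: "is_chart c \<Longrightarrow> snd c ` (fst c \<inter> V) = cimg c \<inter> inv_chart c -` V"
proof (intro equalityI subsetI)
  assume c: "is_chart c"
  show "x \<in> cimg c \<inter> inv_chart c -` V" if "x \<in> snd c ` (fst c \<inter> V)" for x
    using that chart_inverse(1)[OF c] by auto
  show "x \<in> snd c ` (fst c \<inter> V)" if "x \<in> cimg c \<inter> inv_chart c -` V" for x
    using that chart_inverse(2,3)[OF c, of x] by (intro image_eqI[of _ _ "inv_chart c x"]) auto
qed

lemma chart_image_open: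
  assumes "is_chart c" "open V" shows "open (snd c ` (fst c \<inter> V))"
  unfolding chart_image_Int[OF assms(1)]
  by (rule continuous_open_preimage[OF chart_continuous(2)[OF assms(1)] chart_open(2)[OF assms(1)] assms(2)])

lemma transition_smooth:
  assumes "smooth_transition c d"
  shows "smooth_on (snd c ` (fst c \<inter> fst d)) (\<lambda>x. snd d (inv_chart c x))"
  using assms by (simp add: smooth_transition_def o_def)

lemma transition_inverse:
  assumes c: "is_chart c" and d: "is_chart d" and t: "smooth_transition c d" "smooth_transition d c"
    and p: "p \<in> fst c" "p \<in> fst d"
  shows "FD (\<lambda>y. snd c (inv_chart d y)) (snd d p) (FD (\<lambda>x. snd d (inv_chart c x)) (snd c p) v) = v"
proof -
  let ?S = "snd c ` (fst c \<inter> fst d)" and ?T = "snd d ` (fst d \<inter> fst c)"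
  have x: "snd c p \<in> ?S" and y: "snd d p \<in> ?T" using p by auto
  have S: "open ?S" using chart_image_open[OF c chart_open(1)[OF d]] .
  have 1: "((\<lambda>x. snd d (inv_chart c x)) has_derivative FD (\<lambda>x. snd d (inv_chart c x)) (snd c p)) (at (snd c p))"
    by (rule smooth_on_has_derivative[OF transition_smooth[OF t(1)] x])
  have "((\<lambda>y. snd c (inv_chart d y)) has_derivative FD (\<lambda>y. snd c (inv_chart d y)) (snd d p))
      (at (snd d (inv_chart c (snd c p))))"
    using smooth_on_has_derivative[OF transition_smooth[OF t(2)] y] chart_inverse(1)[OF c p(1)] by simp
  from has_derivative_compose[OF 1 this]
  have "((\<lambda>x. x) has_derivative (\<lambda>v. FD (\<lambda>y. snd c (inv_chart d y)) (snd d p) (FD (\<lambda>x. snd d (inv_chart c x)) (snd c p) v)))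
      (at (snd c p))"
    by (rule has_derivative_transform_within_open[OF _ S x]) (auto simp: chart_inverse[OF c] chart_inverse[OF d])
  from has_derivative_unique[OF this has_derivative_ident] show ?thesis by (rule fun_cong)
qed

text \<open>The components of a vector field change by the differential of the transition map.\<close>

lemma transport_smooth:
  assumes c: "is_chart c" and d: "is_chart d" and t: "smooth_transition c d" "smooth_transition d c"
    and Y: "smooth_on (snd d ` (fst d \<inter> fst c)) Y"
  shows "smooth_on (snd c ` (fst c \<inter> fst d)) (\<lambda>x. FD (\<lambda>y. snd c (inv_chart d y)) (snd d (inv_chart c x)) (Y (snd d (inv_chart c x))))"
proof (rule smooth_on_compose[of _ _ "\<lambda>y. FD (\<lambda>y. snd c (inv_chart d y)) y (Y y)" "\<lambda>x. snd d (inv_chart c x)"])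
  show "open (snd c ` (fst c \<inter> fst d))" by (rule chart_image_open[OF c chart_open(1)[OF d]])
  show "smooth_on (snd d ` (fst d \<inter> fst c)) (\<lambda>y. FD (\<lambda>y. snd c (inv_chart d y)) y (Y y))"
    by (rule smooth_on_FD_apply[OF chart_image_open[OF d chart_open(1)[OF c]] transition_smooth[OF t(2)] Y])
  show "smooth_on (snd c ` (fst c \<inter> fst d)) (\<lambda>x. snd d (inv_chart c x))" by (rule transition_smooth[OF t(1)])
qed (auto simp: chart_inverse[OF c])

lemma chart_compact_closed:
  fixes c :: "('m::t2_space, 'e::euclidean_space) chart"
  assumes c: "is_chart c" and K: "compact K" "K \<subseteq> cimg c"
  shows "closed (inv_chart c ` K)"
  by (rule compact_imp_closed[OF compact_continuous_image[OF continuous_on_subset[OF chart_continuous(2)[OF c] K(2)] K(1)]])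

locale manifold =
  fixes A :: "('m::{t2_space,second_countable_topology}, 'e::euclidean_space) chart set"
  assumes atlas: "smooth_atlas A"
begin

abbreviation cmp :: "('m, 'e) chart \<Rightarrow> 'm \<Rightarrow> 'e \<Rightarrow> 'e" where
  "cmp c \<equiv> mderiv A (snd c)"

text \<open>The inverse of \<open>cmp c p\<close>: the tangent vector at \<open>p\<close> with given components in the chart \<open>c\<close>. A tangent vector
  is represented by its components in the preferred chart, which explains the formula.\<close>

definition vec :: "('m, 'e) chart \<Rightarrow> 'm \<Rightarrow> 'e \<Rightarrow> 'e" where
  "vec c p w = FD (snd (chart_at A p) \<circ> inv_chart c) (snd c p) w"

lemma smooth_chart_is_chart: "smooth_chart A c \<Longrightarrow> is_chart c"
  by (simp add: smooth_chart_def)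

lemma member_smooth_chart: "c \<in> A \<Longrightarrow> smooth_chart A c"
  using atlas by (auto simp: smooth_atlas_def smooth_chart_def)

lemma chart_at: "chart_at A p \<in> A" "p \<in> fst (chart_at A p)"
proof -
  have "p \<in> (\<Union>c\<in>A. fst c)" using atlas by (simp add: smooth_atlas_def)
  then have "\<exists>c. c \<in> A \<and> p \<in> fst c" by blast
  from someI_ex[OF this] show "chart_at A p \<in> A" "p \<in> fst (chart_at A p)"
    unfolding chart_at_def by auto
qed

lemma smooth_chart_transitions:
  assumes "smooth_chart A c" "d \<in> A"
  shows "smooth_transition c d" "smooth_transition d c"
  using assms by (auto simp: smooth_chart_def)

lemma mderiv_in_chart:
  assumes c: "smooth_chart A c" and p: "p \<in> fst c"
    and f: "(\<lambda>x. f (inv_chart c x)) differentiable (at (snd c p))"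
  shows "mderiv A f p v = FD (\<lambda>x. f (inv_chart c x)) (snd c p) (cmp c p v)"
proof -
  let ?d = "chart_at A p"
  note cc = smooth_chart_is_chart[OF c] and t = smooth_chart_transitions[OF c chart_at(1)[of p]]
  have d: "is_chart ?d" using member_smooth_chart[OF chart_at(1)] smooth_chart_is_chart by blast
  let ?S = "snd ?d ` (fst ?d \<inter> fst c)"
  have S: "open ?S" "snd ?d p \<in> ?S" using chart_image_open[OF d chart_open(1)[OF cc]] chart_at(2) p by auto
  have 1: "((\<lambda>y. snd c (inv_chart ?d y)) has_derivative FD (\<lambda>y. snd c (inv_chart ?d y)) (snd ?d p)) (at (snd ?d p))"
    by (rule smooth_on_has_derivative[OF transition_smooth[OF t(2)] S(2)])
  have "((\<lambda>x. f (inv_chart c x)) has_derivative FD (\<lambda>x. f (inv_chart c x)) (snd c p))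
      (at (snd c (inv_chart ?d (snd ?d p))))"
    using FD_works[OF f] chart_inverse(1)[OF d chart_at(2)] by simp
  from has_derivative_compose[OF 1 this]
  have "((f \<circ> inv_chart ?d) has_derivative
      (\<lambda>v. FD (\<lambda>x. f (inv_chart c x)) (snd c p) (FD (\<lambda>y. snd c (inv_chart ?d y)) (snd ?d p) v))) (at (snd ?d p))"
    by (rule has_derivative_transform_within_open[OF _ S]) (auto simp: chart_inverse[OF cc] chart_inverse[OF d])
  from FD_eq[OF this] show ?thesis by (simp add: mderiv_def o_def)
qed

lemma vec_cmp_inverse:
  assumes c: "smooth_chart A c" and p: "p \<in> fst c"
  shows "vec c p (cmp c p v) = v" "cmp c p (vec c p w) = w"
    "linear (cmp c p)" "linear (vec c p)"
proof -
  let ?d = "chart_at A p"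
  note cc = smooth_chart_is_chart[OF c] and t = smooth_chart_transitions[OF c chart_at(1)[of p]]
  have d: "is_chart ?d" using member_smooth_chart[OF chart_at(1)] smooth_chart_is_chart by blast
  show "vec c p (cmp c p v) = v" "cmp c p (vec c p w) = w"
    using transition_inverse[OF cc d t p chart_at(2), of w] transition_inverse[OF d cc t(2,1) chart_at(2) p, of v]
    by (simp_all add: vec_def mderiv_def o_def)
  show "linear (cmp c p)" unfolding mderiv_def o_def
    by (rule smooth_on_linear_FD[OF transition_smooth[OF t(2)]]) (use p chart_at(2) in auto)
  show "linear (vec c p)" unfolding vec_def o_def
    using smooth_on_linear_FD[OF transition_smooth[OF t(1)], of "snd c p"] p chart_at(2) by auto
qed

lemma cmp_change:
  assumes c: "smooth_chart A c" and t: "smooth_transition c d" and p: "p \<in> fst c" "p \<in> fst d"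
  shows "cmp d p v = FD (\<lambda>x. snd d (inv_chart c x)) (snd c p) (cmp c p v)"
  by (rule mderiv_in_chart[OF c p(1) smooth_on_differentiable[OF transition_smooth[OF t]]]) (use p in auto)

lemma smooth_field_in_chart:
  assumes X: "smooth_field A X" and c: "smooth_chart A c"
  shows "smooth_on (cimg c) (field_in_chart A c X)"
proof (rule smooth_on_local)
  note cc = smooth_chart_is_chart[OF c]
  show "open (cimg c)" by (rule chart_open(2)[OF cc])
  fix x assume x: "x \<in> cimg c"
  define d where "d = chart_at A (inv_chart c x)"
  have dA: "d \<in> A" "inv_chart c x \<in> fst d" using chart_at by (auto simp: d_def)
  note dc = smooth_chart_is_chart[OF member_smooth_chart[OF dA(1)]] and t = smooth_chart_transitions[OF c dA(1)]
  let ?S = "snd c ` (fst c \<inter> fst d)"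
  have S: "open ?S" by (rule chart_image_open[OF cc chart_open(1)[OF dc]])
  have "smooth_on (cimg d) (field_in_chart A d X)" using X dA(1) by (simp add: smooth_field_def)
  then have "smooth_on (snd d ` (fst d \<inter> fst c)) (field_in_chart A d X)" by (rule smooth_on_subset) auto
  from transport_smooth[OF cc dc t this]
  have "smooth_on ?S (\<lambda>x. FD (\<lambda>y. snd c (inv_chart d y)) (snd d (inv_chart c x)) (field_in_chart A d X (snd d (inv_chart c x))))" .
  moreover have "field_in_chart A c X x' = FD (\<lambda>y. snd c (inv_chart d y)) (snd d (inv_chart c x')) (field_in_chart A d X (snd d (inv_chart c x')))"
    if "x' \<in> ?S" for x'
    using that cmp_change[OF member_smooth_chart[OF dA(1)] t(2)]
    by (auto simp: field_in_chart_def chart_inverse[OF cc] chart_inverse[OF dc])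
  ultimately have "smooth_on ?S (field_in_chart A c X)" by (rule smooth_on_congI[OF S])
  moreover have "x \<in> ?S" unfolding chart_image_Int[OF cc] using x dA(2) by simp
  ultimately show "\<exists>T. open T \<and> x \<in> T \<and> smooth_on T (field_in_chart A c X)" using S by blast
qed

lemma smooth_fun_in_chart:
  assumes f: "smooth_fun A f" and c: "smooth_chart A c"
  shows "smooth_on (cimg c) (\<lambda>x. f (inv_chart c x))"
proof (rule smooth_on_local)
  note cc = smooth_chart_is_chart[OF c]
  show "open (cimg c)" by (rule chart_open(2)[OF cc])
  fix x assume x: "x \<in> cimg c"
  define d where "d = chart_at A (inv_chart c x)"
  have dA: "d \<in> A" "inv_chart c x \<in> fst d" using chart_at by (auto simp: d_def)
  note dc = smooth_chart_is_chart[OF member_smooth_chart[OF dA(1)]] and t = smooth_chart_transitions[OF c dA(1)]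
  let ?S = "snd c ` (fst c \<inter> fst d)"
  have S: "open ?S" by (rule chart_image_open[OF cc chart_open(1)[OF dc]])
  have "smooth_on (cimg d) (\<lambda>y. f (inv_chart d y))" using f dA(1) by (simp add: smooth_fun_def o_def)
  then have "smooth_on ?S (\<lambda>x. f (inv_chart d (snd d (inv_chart c x))))"
    by (rule smooth_on_compose[OF S _ transition_smooth[OF t(1)]]) (auto simp: chart_inverse[OF cc])
  moreover have "f (inv_chart c x') = f (inv_chart d (snd d (inv_chart c x')))" if "x' \<in> ?S" for x'
    using that by (auto simp: chart_inverse[OF cc] chart_inverse[OF dc])
  ultimately have "smooth_on ?S (\<lambda>x. f (inv_chart c x))" by (rule smooth_on_congI[OF S])
  moreover have "x \<in> ?S" unfolding chart_image_Int[OF cc] using x dA(2) by simp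
  ultimately show "\<exists>T. open T \<and> x \<in> T \<and> smooth_on T (\<lambda>x. f (inv_chart c x))" using S by blast
qed

lemma mderiv_smooth_fun:
  assumes f: "smooth_fun A f" and c: "smooth_chart A c" and p: "p \<in> fst c"
  shows "mderiv A f p v = FD (\<lambda>x. f (inv_chart c x)) (snd c p) (cmp c p v)"
  by (rule mderiv_in_chart[OF c p smooth_on_differentiable[OF smooth_fun_in_chart[OF f c]]]) (use p in auto)

definition chart_field :: "('m, 'e) chart \<Rightarrow> ('e \<Rightarrow> 'e) \<Rightarrow> 'm \<Rightarrow> 'e" where
  "chart_field c Y p = (if p \<in> fst c then vec c p (Y (snd c p)) else 0)"

definition chart_fun :: "('m, 'e) chart \<Rightarrow> ('e \<Rightarrow> real) \<Rightarrow> 'm \<Rightarrow> real" where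
  "chart_fun c h p = (if p \<in> fst c then h (snd c p) else 0)"

text \<open>The domain of another chart is covered by its overlap with \<open>c\<close> and the complement of the compact support;
  the latter is open because the manifold is Hausdorff.\<close>

lemma chart_field_smooth:
  assumes c: "smooth_chart A c" and Y: "smooth_on (cimg c) Y" and K: "compact K" "K \<subseteq> cimg c"
    and Y0: "\<And>x. x \<in> cimg c - K \<Longrightarrow> Y x = 0"
  shows "smooth_field A (chart_field c Y)"
  unfolding smooth_field_def
proof
  fix d assume d: "d \<in> A"
  note cc = smooth_chart_is_chart[OF c] and ds = member_smooth_chart[OF d]
  note dc = smooth_chart_is_chart[OF ds] and t = smooth_chart_transitions[OF c d]
  let ?S = "snd d ` (fst d \<inter> fst c)" and ?T = "snd d ` (fst d \<inter> (- inv_chart c ` K))"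
  have S: "open ?S" "open ?T"
    using chart_image_open[OF dc] chart_open(1)[OF cc] chart_compact_closed[OF cc K] by auto
  have sm: "smooth_on ?S (field_in_chart A d (chart_field c Y))"
  proof -
    have "smooth_on (snd c ` (fst c \<inter> fst d)) Y" by (rule smooth_on_subset[OF Y]) auto
    from transport_smooth[OF dc cc t(2,1) this]
    have "smooth_on ?S (\<lambda>y. FD (\<lambda>x. snd d (inv_chart c x)) (snd c (inv_chart d y)) (Y (snd c (inv_chart d y))))" .
    moreover have "field_in_chart A d (chart_field c Y) y
       = FD (\<lambda>x. snd d (inv_chart c x)) (snd c (inv_chart d y)) (Y (snd c (inv_chart d y)))" if "y \<in> ?S" for y
      using that cmp_change[OF c t(1)] vec_cmp_inverse(2)[OF c]
      by (auto simp: field_in_chart_def chart_field_def chart_inverse[OF dc])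
    ultimately show ?thesis by (rule smooth_on_congI[OF S(1)])
  qed
  moreover have "smooth_on ?T (field_in_chart A d (chart_field c Y))"
  proof -
    have "field_in_chart A d (chart_field c Y) y = 0" if y: "y \<in> ?T" for y
    proof -
      obtain p where p: "p \<in> fst d" "p \<notin> inv_chart c ` K" "y = snd d p" using y by blast
      have "chart_field c Y p = 0"
      proof (cases "p \<in> fst c")
        case True
        have "snd c p \<notin> K" using p(2) chart_inverse(1)[OF cc True] by (metis image_eqI)
        then show ?thesis using True Y0[of "snd c p"] linear_0[OF vec_cmp_inverse(4)[OF c True]]
          by (simp add: chart_field_def)
      qed (simp add: chart_field_def)
      then show ?thesis using p linear_0[OF vec_cmp_inverse(3)[OF ds p(1)]]
        by (simp add: field_in_chart_def chart_inverse[OF dc])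
    qed
    then show ?thesis by (rule smooth_on_congI[OF S(2) smooth_on_const])
  qed
  ultimately have "smooth_on (?S \<union> ?T) (field_in_chart A d (chart_field c Y))"
    by (rule smooth_on_Un[OF S])
  moreover have "cimg d \<subseteq> ?S \<union> ?T"
  proof
    fix y assume "y \<in> cimg d"
    then obtain p where p: "p \<in> fst d" "y = snd d p" by blast
    have "p \<in> fst c" if "p \<in> inv_chart c ` K" using that chart_inverse(2)[OF cc] K(2) by blast
    then show "y \<in> ?S \<union> ?T" using p by blast
  qed
  ultimately show "smooth_on (cimg d) (field_in_chart A d (chart_field c Y))" by (rule smooth_on_subset)
qed

lemma chart_fun_smooth:
  assumes c: "smooth_chart A c" and h: "smooth_on (cimg c) h" and K: "compact K" "K \<subseteq> cimg c"
    and h0: "\<And>x. x \<in> cimg c - K \<Longrightarrow> h x = 0"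
  shows "smooth_fun A (chart_fun c h)"
  unfolding smooth_fun_def o_def
proof
  fix d assume d: "d \<in> A"
  note cc = smooth_chart_is_chart[OF c] and ds = member_smooth_chart[OF d]
  note dc = smooth_chart_is_chart[OF ds] and t = smooth_chart_transitions[OF c d]
  let ?S = "snd d ` (fst d \<inter> fst c)" and ?T = "snd d ` (fst d \<inter> (- inv_chart c ` K))"
  have S: "open ?S" "open ?T"
    using chart_image_open[OF dc] chart_open(1)[OF cc] chart_compact_closed[OF cc K] by auto
  have "smooth_on ?S (\<lambda>y. h (snd c (inv_chart d y)))"
    by (rule smooth_on_compose[OF S(1) h transition_smooth[OF t(2)]]) (auto simp: chart_inverse[OF dc])
  then have "smooth_on ?S (\<lambda>y. chart_fun c h (inv_chart d y))"
    by (rule smooth_on_congI[OF S(1)]) (auto simp: chart_fun_def chart_inverse[OF dc])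
  moreover have "smooth_on ?T (\<lambda>y. chart_fun c h (inv_chart d y))"
  proof -
    have "chart_fun c h (inv_chart d y) = 0" if y: "y \<in> ?T" for y
    proof -
      obtain p where p: "p \<in> fst d" "p \<notin> inv_chart c ` K" "y = snd d p" using y by blast
      have "snd c p \<notin> K" if "p \<in> fst c" using p(2) chart_inverse(1)[OF cc that] by (metis image_eqI)
      then show ?thesis using h0[of "snd c p"] p by (auto simp: chart_fun_def chart_inverse[OF dc])
    qed
    then show ?thesis by (rule smooth_on_congI[OF S(2) smooth_on_const])
  qed
  ultimately have "smooth_on (?S \<union> ?T) (\<lambda>y. chart_fun c h (inv_chart d y))"
    by (rule smooth_on_Un[OF S])
  moreover have "cimg d \<subseteq> ?S \<union> ?T"
  proof
    fix y assume "y \<in> cimg d"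
    then obtain p where p: "p \<in> fst d" "y = snd d p" by blast
    have "p \<in> fst c" if "p \<in> inv_chart c ` K" using that chart_inverse(2)[OF cc] K(2) by blast
    then show "y \<in> ?S \<union> ?T" using p by blast
  qed
  ultimately show "smooth_on (cimg d) (\<lambda>y. chart_fun c h (inv_chart d y))" by (rule smooth_on_subset)
qed

lemma smooth_field_add:
  assumes "smooth_field A X" "smooth_field A Y" shows "smooth_field A (\<lambda>p. X p + Y p)"
  unfolding smooth_field_def
proof
  fix d assume d: "d \<in> A"
  note ds = member_smooth_chart[OF d]
  note dc = smooth_chart_is_chart[OF ds]
  have "smooth_on (cimg d) (\<lambda>x. field_in_chart A d X x + field_in_chart A d Y x)"
    using assms d by (intro smooth_on_add chart_open(2)[OF dc]) (auto simp: smooth_field_def)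
  then show "smooth_on (cimg d) (field_in_chart A d (\<lambda>p. X p + Y p))"
    by (rule smooth_on_congI[OF chart_open(2)[OF dc]])
       (use linear_add[OF vec_cmp_inverse(3)[OF ds]] chart_inverse(2)[OF dc] in \<open>auto simp: field_in_chart_def\<close>)
qed

lemma smooth_field_scale:
  assumes "smooth_fun A f" "smooth_field A X" shows "smooth_field A (\<lambda>p. f p *\<^sub>R X p)"
  unfolding smooth_field_def
proof
  fix d assume d: "d \<in> A"
  note ds = member_smooth_chart[OF d]
  note dc = smooth_chart_is_chart[OF ds]
  have "smooth_on (cimg d) (\<lambda>x. f (inv_chart d x) *\<^sub>R field_in_chart A d X x)"
    using assms d by (intro smooth_on_scaleR chart_open(2)[OF dc]) (auto simp: smooth_field_def smooth_fun_def o_def)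
  then show "smooth_on (cimg d) (field_in_chart A d (\<lambda>p. f p *\<^sub>R X p))"
    by (rule smooth_on_congI[OF chart_open(2)[OF dc]])
       (use linear_cmul[OF vec_cmp_inverse(3)[OF ds]] chart_inverse(2)[OF dc] in \<open>auto simp: field_in_chart_def\<close>)
qed

lemma smooth_fun_const: "smooth_fun A (\<lambda>_. k)"
  by (simp add: smooth_fun_def o_def smooth_on_const)

lemma smooth_field_zero: "smooth_field A (\<lambda>_. 0)"
  unfolding smooth_field_def
proof
  fix d assume d: "d \<in> A"
  note ds = member_smooth_chart[OF d]
  note dc = smooth_chart_is_chart[OF ds]
  show "smooth_on (cimg d) (field_in_chart A d (\<lambda>_. 0))"
    by (rule smooth_on_congI[OF chart_open(2)[OF dc] smooth_on_const[of _ 0]])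
       (use linear_0[OF vec_cmp_inverse(3)[OF ds]] chart_inverse(2)[OF dc] in \<open>auto simp: field_in_chart_def\<close>)
qed

lemma smooth_field_sum:
  "finite I \<Longrightarrow> (\<And>i. i \<in> I \<Longrightarrow> smooth_field A (X i)) \<Longrightarrow> smooth_field A (\<lambda>p. \<Sum>i\<in>I. X i p)"
  by (induction I rule: finite_induct) (auto intro: smooth_field_zero smooth_field_add)

lemma smooth_field_diff:
  assumes "smooth_field A X" "smooth_field A Y" shows "smooth_field A (\<lambda>p. X p - Y p)"
  using smooth_field_add[OF assms(1) smooth_field_scale[OF smooth_fun_const[of "-1"] assms(2)]] by simp

lemma local_bump:
  assumes N: "open N" "p \<in> N"
  obtains \<kappa> where "smooth_fun A \<kappa>" "\<And>q. q \<notin> N \<Longrightarrow> \<kappa> q = 0" "\<kappa> p = 1"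
proof -
  let ?c = "chart_at A p"
  have c: "smooth_chart A ?c" by (rule member_smooth_chart[OF chart_at(1)])
  note cc = smooth_chart_is_chart[OF c]
  have "open (snd ?c ` (fst ?c \<inter> N))" by (rule chart_image_open[OF cc N(1)])
  then obtain R where R: "R > 0" "cball (snd ?c p) R \<subseteq> snd ?c ` (fst ?c \<inter> N)"
    using chart_at(2)[of p] N(2) unfolding open_contains_cball by blast
  obtain \<beta> :: "'e \<Rightarrow> real" where \<beta>: "smooth_on UNIV \<beta>" "\<And>x. x \<in> cball (snd ?c p) (R/2) \<Longrightarrow> \<beta> x = 1"
    "\<And>x. x \<notin> ball (snd ?c p) R \<Longrightarrow> \<beta> x = 0"
    by (rule smooth_bump[of "R/2" R "snd ?c p"]) (use R(1) in simp_all)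
  show thesis
  proof (rule that[of "chart_fun ?c \<beta>"])
    show "smooth_fun A (chart_fun ?c \<beta>)"
    proof (rule chart_fun_smooth[OF c smooth_on_subset[OF \<beta>(1) subset_UNIV] compact_cball])
      show "cball (snd ?c p) R \<subseteq> cimg ?c" using R(2) by auto
    qed (use \<beta>(3) in auto)
    show "chart_fun ?c \<beta> q = 0" if "q \<notin> N" for q
    proof (cases "q \<in> fst ?c \<and> snd ?c q \<in> ball (snd ?c p) R")
      case True
      then have "snd ?c q \<in> snd ?c ` (fst ?c \<inter> N)" using R(2) by auto
      then have "q \<in> N" unfolding chart_image_Int[OF cc] using chart_inverse(1)[OF cc, of q] True by simp
      then show ?thesis using that by simp
    qed (use \<beta>(3) in \<open>auto simp: chart_fun_def\<close>)
    show "chart_fun ?c \<beta> p = 1" using \<beta>(2)[of "snd ?c p"] chart_at(2) R(1) by (simp add: chart_fun_def)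
  qed
qed

end

section \<open>The Levi-Civita connection in a chart\<close>

locale levi_civita_manifold = manifold A
  for A :: "('m::{t2_space,second_countable_topology}, 'e::euclidean_space) chart set" +
  fixes g :: "'m \<Rightarrow> 'e \<Rightarrow> 'e \<Rightarrow> real" and nabla :: "('m \<Rightarrow> 'e) \<Rightarrow> ('m \<Rightarrow> 'e) \<Rightarrow> 'm \<Rightarrow> 'e"
  assumes metric: "riemannian_metric A g" and lc: "levi_civita A g nabla"
begin

lemma metric_bilinear: "linear (\<lambda>v. g p v w)" "linear (g p v)"
proof -
  have "bilinear (g p)" using metric by (simp add: riemannian_metric_def)
  then show "linear (\<lambda>v. g p v w)" "linear (g p v)" by (auto simp: bilinear_def)
qed

lemma metric_sym: "g p v w = g p w v"
  using metric by (simp add: riemannian_metric_def)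

lemma metric_pos: "v \<noteq> 0 \<Longrightarrow> g p v v > 0"
  using metric by (simp add: riemannian_metric_def)

lemma metric_smooth: "smooth_field A X \<Longrightarrow> smooth_field A Y \<Longrightarrow> smooth_fun A (\<lambda>p. g p (X p) (Y p))"
  using metric by (simp add: riemannian_metric_def)

lemma
  shows nabla_smooth: "smooth_field A X \<Longrightarrow> smooth_field A Y \<Longrightarrow> smooth_field A (nabla X Y)"
    and nabla_add1: "smooth_field A X \<Longrightarrow> smooth_field A X' \<Longrightarrow> smooth_field A Y \<Longrightarrow>
      nabla (\<lambda>q. X q + X' q) Y p = nabla X Y p + nabla X' Y p"
    and nabla_add2: "smooth_field A X \<Longrightarrow> smooth_field A Y \<Longrightarrow> smooth_field A Y' \<Longrightarrow>
      nabla X (\<lambda>q. Y q + Y' q) p = nabla X Y p + nabla X Y' p"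
    and nabla_scale1: "smooth_fun A f \<Longrightarrow> smooth_field A X \<Longrightarrow> smooth_field A Y \<Longrightarrow>
      nabla (\<lambda>q. f q *\<^sub>R X q) Y p = f p *\<^sub>R nabla X Y p"
    and nabla_leibniz: "smooth_fun A f \<Longrightarrow> smooth_field A X \<Longrightarrow> smooth_field A Y \<Longrightarrow>
      nabla X (\<lambda>q. f q *\<^sub>R Y q) p = mderiv A f p (X p) *\<^sub>R Y p + f p *\<^sub>R nabla X Y p"
    and nabla_torsion: "smooth_field A X \<Longrightarrow> smooth_field A Y \<Longrightarrow>
      nabla X Y p - nabla Y X p = lie_bracket A X Y p"
    and nabla_metric: "smooth_field A X \<Longrightarrow> smooth_field A Y \<Longrightarrow> smooth_field A Z \<Longrightarrow>
      mderiv A (\<lambda>q. g q (Y q) (Z q)) p (X p) = g p (nabla X Y p) (Z p) + g p (Y p) (nabla X Z p)"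
  using lc unfolding levi_civita_def affine_connection_def by simp_all

lemma mderiv_const: "mderiv A (\<lambda>_. k) p v = 0"
  by (simp add: mderiv_def o_def)

lemma nabla_zero1: "smooth_field A Y \<Longrightarrow> nabla (\<lambda>_. 0) Y p = 0"
  using nabla_scale1[OF smooth_fun_const[of 0] smooth_field_zero, of Y p] by simp

lemma nabla_zero2: "smooth_field A X \<Longrightarrow> nabla X (\<lambda>_. 0) p = 0"
  using nabla_leibniz[OF smooth_fun_const[of 0] _ smooth_field_zero, of X p] by (simp add: mderiv_const)

lemma nabla_sum1:
  "finite I \<Longrightarrow> (\<And>i. i \<in> I \<Longrightarrow> smooth_field A (X i)) \<Longrightarrow> smooth_field A Y \<Longrightarrow>
    nabla (\<lambda>q. \<Sum>i\<in>I. X i q) Y p = (\<Sum>i\<in>I. nabla (X i) Y p)"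
  by (induction I rule: finite_induct) (simp_all add: nabla_zero1 nabla_add1 smooth_field_sum)

lemma nabla_sum2:
  "finite I \<Longrightarrow> (\<And>i. i \<in> I \<Longrightarrow> smooth_field A (Y i)) \<Longrightarrow> smooth_field A X \<Longrightarrow>
    nabla X (\<lambda>q. \<Sum>i\<in>I. Y i q) p = (\<Sum>i\<in>I. nabla X (Y i) p)"
  by (induction I rule: finite_induct) (simp_all add: nabla_zero2 nabla_add2 smooth_field_sum)

text \<open>A connection is given on global fields only. Multiplication with a cutoff function makes two fields that
  agree near \<open>p\<close> equal everywhere, which shows that \<open>nabla\<close> is local in both arguments.\<close>

lemma nabla_local1:
  assumes "smooth_field A X" "smooth_field A X'" "smooth_field A Y" "open N" "p \<in> N" "\<And>q. q \<in> N \<Longrightarrow> X q = X' q"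
  shows "nabla X Y p = nabla X' Y p"
proof -
  obtain \<kappa> where k: "smooth_fun A \<kappa>" "\<And>q. q \<notin> N \<Longrightarrow> \<kappa> q = 0" "\<kappa> p = 1"
    using local_bump[OF assms(4,5)] by blast
  have "\<kappa> q *\<^sub>R X q = \<kappa> q *\<^sub>R X' q" for q by (cases "q \<in> N") (simp_all add: assms(6) k(2))
  then have "nabla (\<lambda>q. \<kappa> q *\<^sub>R X q) Y p = nabla (\<lambda>q. \<kappa> q *\<^sub>R X' q) Y p" by (simp only:)
  then show ?thesis by (simp add: nabla_scale1 k assms(1-3))
qed

lemma nabla_local2:
  assumes "smooth_field A X" "smooth_field A Y" "smooth_field A Y'" "open N" "p \<in> N" "\<And>q. q \<in> N \<Longrightarrow> Y q = Y' q"
  shows "nabla X Y p = nabla X Y' p"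
proof -
  obtain \<kappa> where k: "smooth_fun A \<kappa>" "\<And>q. q \<notin> N \<Longrightarrow> \<kappa> q = 0" "\<kappa> p = 1"
    using local_bump[OF assms(4,5)] by blast
  have "\<kappa> q *\<^sub>R Y q = \<kappa> q *\<^sub>R Y' q" for q by (cases "q \<in> N") (simp_all add: assms(6) k(2))
  then have "nabla X (\<lambda>q. \<kappa> q *\<^sub>R Y q) p = nabla X (\<lambda>q. \<kappa> q *\<^sub>R Y' q) p" by (simp only:)
  then show ?thesis using assms(6)[OF assms(5)] by (simp add: nabla_leibniz k assms(1-3))
qed

end

text \<open>Coordinate fields of a chart exist globally only after multiplication with a cutoff function \<open>\<beta>\<close>;
  they are the true coordinate fields over the region \<open>W\<close> where \<open>\<beta> = 1\<close>.\<close>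

locale chart_frame = levi_civita_manifold A g nabla
  for A :: "('m::{t2_space,second_countable_topology}, 'e::euclidean_space) chart set" and g nabla +
  fixes c :: "('m, 'e) chart" and W K :: "'e set" and \<beta> :: "'e \<Rightarrow> real"
  assumes c: "smooth_chart A c" and region: "open W" "W \<subseteq> cimg c" and \<beta>: "smooth_on UNIV \<beta>"
    and \<beta>1: "\<And>x. x \<in> W \<Longrightarrow> \<beta> x = 1" and K: "compact K" "K \<subseteq> cimg c" and \<beta>0: "\<And>x. x \<notin> K \<Longrightarrow> \<beta> x = 0"
begin

abbreviation pt :: "'e \<Rightarrow> 'm" where "pt \<equiv> inv_chart c"

lemmas cc = smooth_chart_is_chart[OF c]

lemma pt_W: "x \<in> W \<Longrightarrow> pt x \<in> fst c" "x \<in> W \<Longrightarrow> snd c (pt x) = x"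
  using region(2) chart_inverse(2,3)[OF cc] by auto

lemma open_cimg: "open (cimg c)" by (rule chart_open(2)[OF cc])

definition E :: "'e \<Rightarrow> 'm \<Rightarrow> 'e" where
  "E w = chart_field c (\<lambda>x. \<beta> x *\<^sub>R w)"

definition \<Gamma> :: "'e \<Rightarrow> 'e \<Rightarrow> 'e \<Rightarrow> 'e" where
  "\<Gamma> x v w = cmp c (pt x) (nabla (E v) (E w) (pt x))"

definition gm :: "'e \<Rightarrow> 'e \<Rightarrow> 'e \<Rightarrow> real" where
  "gm x a b = g (pt x) (vec c (pt x) a) (vec c (pt x) b)"

definition endo :: "('m \<Rightarrow> 'e \<Rightarrow> 'e) \<Rightarrow> 'e \<Rightarrow> 'e \<Rightarrow> 'e" where
  "endo T x a = cmp c (pt x) (T (pt x) (vec c (pt x) a))"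

lemma \<beta>_smooth: "smooth_on S \<beta>" by (rule smooth_on_subset[OF \<beta> subset_UNIV])

lemma E_smooth: "smooth_field A (E w)"
  unfolding E_def
  by (rule chart_field_smooth[OF c _ K]) (auto simp: \<beta>0 intro: smooth_on_scaleR open_cimg \<beta>_smooth smooth_on_const)

lemma E_pt: "x \<in> W \<Longrightarrow> E w (pt x) = vec c (pt x) w"
  by (simp add: E_def chart_field_def pt_W \<beta>1)

lemma cmp_E: "x \<in> W \<Longrightarrow> cmp c (pt x) (E w (pt x)) = w"
  by (simp add: E_pt vec_cmp_inverse(2)[OF c pt_W(1)])

lemma vec_cmp: "x \<in> W \<Longrightarrow> vec c (pt x) (cmp c (pt x) v) = v"
  by (rule vec_cmp_inverse(1)[OF c pt_W(1)])

lemma E_add: "E (v + w) = (\<lambda>p. E v p + E w p)"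
  by (rule ext) (simp add: E_def chart_field_def scaleR_add_right linear_add[OF vec_cmp_inverse(4)[OF c]])

lemma E_scale: "E (k *\<^sub>R w) = (\<lambda>p. k *\<^sub>R E w p)"
proof
  show "E (k *\<^sub>R w) p = k *\<^sub>R E w p" for p
    using linear_cmul[OF vec_cmp_inverse(4)[OF c, of p], of k "\<beta> (snd c p) *\<^sub>R w"]
    by (simp add: E_def chart_field_def mult.commute)
qed

lemma \<Gamma>_lin1: "x \<in> W \<Longrightarrow> linear (\<lambda>v. \<Gamma> x v w)"
  by (rule linearI)
     (simp_all add: \<Gamma>_def E_add E_scale nabla_add1 nabla_scale1 smooth_fun_const E_smooth
       linear_add[OF vec_cmp_inverse(3)[OF c pt_W(1)]] linear_cmul[OF vec_cmp_inverse(3)[OF c pt_W(1)]])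

lemma \<Gamma>_lin2: "x \<in> W \<Longrightarrow> linear (\<Gamma> x v)"
  by (rule linearI)
     (simp_all add: \<Gamma>_def E_add E_scale nabla_add2 nabla_leibniz mderiv_const smooth_fun_const E_smooth
       linear_add[OF vec_cmp_inverse(3)[OF c pt_W(1)]] linear_cmul[OF vec_cmp_inverse(3)[OF c pt_W(1)]])

lemma \<Gamma>_smooth: "smooth_on W (\<lambda>x. \<Gamma> x v w)"
proof -
  have "smooth_on (cimg c) (field_in_chart A c (nabla (E v) (E w)))"
    by (rule smooth_field_in_chart[OF nabla_smooth[OF E_smooth E_smooth] c])
  then have "smooth_on W (field_in_chart A c (nabla (E v) (E w)))" by (rule smooth_on_subset[OF _ region(2)])
  then show ?thesis by (simp add: field_in_chart_def[abs_def] \<Gamma>_def)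
qed

definition N :: "'m set" where "N = fst c \<inter> snd c -` W"

lemma open_N: "open N"
  unfolding N_def by (rule continuous_open_preimage[OF chart_continuous(1)[OF cc] chart_open(1)[OF cc] region(1)])

lemma pt_N: "x \<in> W \<Longrightarrow> pt x \<in> N" by (simp add: N_def pt_W)

definition coef :: "('m \<Rightarrow> 'e) \<Rightarrow> 'e \<Rightarrow> 'm \<Rightarrow> real" where
  "coef X k = chart_fun c (\<lambda>x. \<beta> x *\<^sub>R (field_in_chart A c X x \<bullet> k))"

lemma coef_smooth:
  assumes "smooth_field A X" shows "smooth_fun A (coef X k)"
  unfolding coef_def
proof (rule chart_fun_smooth[OF c _ K])
  show "smooth_on (cimg c) (\<lambda>x. \<beta> x *\<^sub>R (field_in_chart A c X x \<bullet> k))"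
    by (rule smooth_on_scaleR[OF open_cimg \<beta>_smooth
          smooth_on_linear[OF open_cimg bounded_linear_inner_left smooth_field_in_chart[OF assms c]]])
qed (simp add: \<beta>0)

lemma coef_pt: "x \<in> W \<Longrightarrow> coef X k (pt x) = field_in_chart A c X x \<bullet> k"
  by (simp add: coef_def chart_fun_def pt_W \<beta>1)

lemma frame_expansion:
  assumes "q \<in> N" shows "(\<Sum>k\<in>Basis. coef X k q *\<^sub>R E k q) = X q"
proof -
  define x where "x = snd c q"
  have q: "q \<in> fst c" "x \<in> W" "pt x = q" using assms chart_inverse(1)[OF cc] by (auto simp: N_def x_def)
  have "(\<Sum>k\<in>Basis. coef X k q *\<^sub>R E k q) = (\<Sum>k\<in>Basis. (field_in_chart A c X x \<bullet> k) *\<^sub>R vec c q k)"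
    using coef_pt[OF q(2)] E_pt[OF q(2)] by (simp add: q(3))
  also have "\<dots> = vec c q (field_in_chart A c X x)"
    by (rule linear_basis_expand[OF vec_cmp_inverse(4)[OF c q(1)], symmetric])
  finally show ?thesis by (simp add: field_in_chart_def q vec_cmp_inverse(1)[OF c q(1)])
qed

text \<open>Over \<open>W\<close> the fields are combinations of the global frame fields \<open>E k\<close> with smooth coefficients; locality and
  the axioms of a connection then yield the classical coordinate formula.\<close>

theorem nabla_in_chart:
  assumes X: "smooth_field A X" and Y: "smooth_field A Y" and x: "x \<in> W"
  shows "cmp c (pt x) (nabla X Y (pt x)) = FD (field_in_chart A c Y) x (cmp c (pt x) (X (pt x)))
    + \<Gamma> x (cmp c (pt x) (X (pt x))) (cmp c (pt x) (Y (pt x)))"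
proof -
  let ?p = "pt x" and ?X = "cmp c (pt x) (X (pt x))" and ?Y = "field_in_chart A c Y"
  have Yx: "?Y x = cmp c ?p (Y ?p)" and Xx: "field_in_chart A c X x = ?X" by (simp_all add: field_in_chart_def)
  note lin = vec_cmp_inverse(3)[OF c pt_W(1)[OF x]]
  have sX: "smooth_field A (\<lambda>q. coef X k q *\<^sub>R E k q)" and sY: "smooth_field A (\<lambda>q. coef Y k q *\<^sub>R E k q)" for k
    by (rule smooth_field_scale[OF coef_smooth[OF X] E_smooth] smooth_field_scale[OF coef_smooth[OF Y] E_smooth])+
  have first: "cmp c ?p (nabla X (E k) ?p) = \<Gamma> x ?X k" for k
  proof -
    have "nabla X (E k) ?p = nabla (\<lambda>q. \<Sum>j\<in>Basis. coef X j q *\<^sub>R E j q) (E k) ?p"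
      by (rule nabla_local1[OF X _ E_smooth open_N pt_N[OF x]])
         (rule smooth_field_sum[OF finite_Basis sX], rule frame_expansion[symmetric])
    also have "\<dots> = (\<Sum>j\<in>Basis. (?X \<bullet> j) *\<^sub>R nabla (E j) (E k) ?p)"
      by (simp add: nabla_sum1[OF finite_Basis sX E_smooth] nabla_scale1[OF coef_smooth[OF X] E_smooth E_smooth]
          coef_pt[OF x] Xx)
    finally have "cmp c ?p (nabla X (E k) ?p) = (\<Sum>j\<in>Basis. (?X \<bullet> j) *\<^sub>R \<Gamma> x j k)"
      by (simp add: linear_sum[OF lin] linear_cmul[OF lin] \<Gamma>_def)
    then show ?thesis using linear_basis_expand[OF \<Gamma>_lin1[OF x], of ?X k] by (rule trans[OF _ sym])
  qed
  have d: "mderiv A (coef Y k) ?p (X ?p) = FD ?Y x ?X \<bullet> k" for k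
  proof -
    have "mderiv A (coef Y k) ?p (X ?p) = FD (\<lambda>x. coef Y k (pt x)) x ?X"
      using mderiv_smooth_fun[OF coef_smooth[OF Y] c pt_W(1)[OF x], of k "X ?p"] by (simp add: pt_W(2)[OF x])
    also have "FD (\<lambda>x. coef Y k (pt x)) x = FD (\<lambda>x. ?Y x \<bullet> k) x"
      by (rule FD_cong_open[OF region(1) x]) (rule coef_pt)
    also have "\<dots> = (\<lambda>h. FD ?Y x h \<bullet> k)"
      by (rule FD_eq, rule bounded_linear.has_derivative[OF bounded_linear_inner_left],
          rule smooth_on_has_derivative[OF smooth_field_in_chart[OF Y c]]) (use x region(2) in blast)
    finally show ?thesis .
  qed
  have "nabla X Y ?p = nabla X (\<lambda>q. \<Sum>k\<in>Basis. coef Y k q *\<^sub>R E k q) ?p"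
    by (rule nabla_local2[OF X Y _ open_N pt_N[OF x]])
       (rule smooth_field_sum[OF finite_Basis sY], rule frame_expansion[symmetric])
  also have "\<dots> = (\<Sum>k\<in>Basis. (FD ?Y x ?X \<bullet> k) *\<^sub>R E k ?p + (?Y x \<bullet> k) *\<^sub>R nabla X (E k) ?p)"
    by (simp add: nabla_sum2[OF finite_Basis sY X] nabla_leibniz[OF coef_smooth[OF Y] X E_smooth] coef_pt[OF x] d)
  finally have "cmp c ?p (nabla X Y ?p) = (\<Sum>k\<in>Basis. (FD ?Y x ?X \<bullet> k) *\<^sub>R k + (?Y x \<bullet> k) *\<^sub>R \<Gamma> x ?X k)"
    by (simp add: linear_sum[OF lin] linear_add[OF lin] linear_cmul[OF lin] cmp_E[OF x] first)
  also have "\<dots> = FD ?Y x ?X + (\<Sum>k\<in>Basis. (?Y x \<bullet> k) *\<^sub>R \<Gamma> x ?X k)"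
    by (simp add: sum.distrib euclidean_representation)
  also have "(\<Sum>k\<in>Basis. (?Y x \<bullet> k) *\<^sub>R \<Gamma> x ?X k) = \<Gamma> x ?X (?Y x)"
    by (rule linear_basis_expand[OF \<Gamma>_lin2[OF x], symmetric])
  finally show ?thesis by (simp add: Yx)
qed

text \<open>The bracket is computed in the preferred chart at the point, where the coordinate fields of \<open>c\<close> have as
  components the partial derivatives of the transition map \<open>\<sigma>\<close>; their bracket vanishes because the second
  derivative of \<open>\<sigma>\<close> is symmetric.\<close>

lemma bracket_coordinate_fields:
  assumes x: "x \<in> W" shows "lie_bracket A (E v) (E w) (pt x) = 0"
proof -
  define d where "d = chart_at A (pt x)"
  have dA: "d \<in> A" "pt x \<in> fst d" using chart_at by (auto simp: d_def)
  note ds = member_smooth_chart[OF dA(1)]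
  note dc = smooth_chart_is_chart[OF ds] and t = smooth_chart_transitions[OF c dA(1)]
  let ?\<sigma> = "\<lambda>x. snd d (pt x)" and ?\<tau> = "\<lambda>y. snd c (inv_chart d y)" and ?y = "snd d (pt x)"
  let ?S = "snd d ` (fst d \<inter> N)" and ?T = "snd c ` (fst c \<inter> fst d)"
  have S: "open ?S" "?y \<in> ?S" using chart_image_open[OF dc open_N] dA(2) pt_N[OF x] by auto
  have T: "open ?T" "x \<in> ?T"
    unfolding chart_image_Int[OF cc]
    using chart_image_open[OF cc chart_open(1)[OF dc], unfolded chart_image_Int[OF cc]] x region(2) dA(2) by auto
  have \<tau>y: "?\<tau> ?y = x" using chart_inverse(1)[OF dc dA(2)] pt_W(2)[OF x] by simp
  have main: "FD (field_in_chart A d (E w)) ?y (E v (pt x)) = FD (\<lambda>x. FD ?\<sigma> x w) x v" for v w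
  proof -
    have "field_in_chart A d (E w) y = FD ?\<sigma> (?\<tau> y) w" if y: "y \<in> ?S" for y
    proof -
      obtain p where p: "p \<in> fst d" "p \<in> N" "y = snd d p" using y by blast
      have pc: "p \<in> fst c" "snd c p \<in> W" using p(2) by (auto simp: N_def)
      have "cmp c p (E w p) = w" using cmp_E[OF pc(2), of w] chart_inverse(1)[OF cc pc(1)] by simp
      then show ?thesis
        using cmp_change[OF c t(1) pc(1) p(1), of "E w p"] chart_inverse(1)[OF dc p(1)] p(3)
        by (simp add: field_in_chart_def)
    qed
    then have "FD (field_in_chart A d (E w)) ?y = FD (\<lambda>y. FD ?\<sigma> (?\<tau> y) w) ?y"
      by (rule FD_cong_open[OF S])
    moreover have "FD (\<lambda>y. FD ?\<sigma> (?\<tau> y) w) ?y = (\<lambda>h. FD (\<lambda>x. FD ?\<sigma> x w) x (FD ?\<tau> ?y h))"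
    proof -
      have 1: "(?\<tau> has_derivative FD ?\<tau> ?y) (at ?y)"
        by (rule smooth_on_has_derivative[OF transition_smooth[OF t(2)]]) (use dA(2) pt_W(1)[OF x] in auto)
      have 2: "((\<lambda>x. FD ?\<sigma> x w) has_derivative FD (\<lambda>x. FD ?\<sigma> x w) x) (at (?\<tau> ?y))"
        unfolding \<tau>y by (rule smooth_on_has_derivative[OF smooth_on_FD[OF transition_smooth[OF t(1)]] T(2)])
      show ?thesis by (rule FD_eq[OF has_derivative_compose[OF 1 2]])
    qed
    ultimately have "FD (field_in_chart A d (E w)) ?y = (\<lambda>h. FD (\<lambda>x. FD ?\<sigma> x w) x (FD ?\<tau> ?y h))"
      by (simp only:)
    moreover have "FD ?\<tau> ?y (E v (pt x)) = v"
      using cmp_E[OF x, of v] by (simp add: mderiv_def d_def o_def)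
    ultimately show ?thesis by simp
  qed
  have "FD (\<lambda>x. FD ?\<sigma> x w) x v = FD (\<lambda>x. FD ?\<sigma> x v) x w"
    by (rule second_derivative_symmetric[OF T(1) transition_smooth[OF t(1)] T(2)])
  then show ?thesis
    unfolding lie_bracket_def Let_def d_def[symmetric] main by simp
qed

lemma \<Gamma>_sym: "x \<in> W \<Longrightarrow> \<Gamma> x v w = \<Gamma> x w v"
  using nabla_torsion[OF E_smooth E_smooth, of v w "pt x"] by (simp add: \<Gamma>_def bracket_coordinate_fields)

lemma gm_E: "x \<in> W \<Longrightarrow> gm x a b = g (pt x) (E a (pt x)) (E b (pt x))"
  by (simp add: gm_def E_pt)

lemma gm_smooth: "smooth_on W (\<lambda>x. gm x a b)"
proof (rule smooth_on_congI[OF region(1)])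
  show "smooth_on W (\<lambda>x. g (pt x) (E a (pt x)) (E b (pt x)))"
    by (rule smooth_on_subset[OF smooth_fun_in_chart[OF metric_smooth[OF E_smooth E_smooth] c] region(2)])
qed (rule gm_E)

lemma gm_parallel:
  assumes x: "x \<in> W"
  shows "FD (\<lambda>x. gm x a b) x v = gm x (\<Gamma> x v a) b + gm x a (\<Gamma> x v b)"
proof -
  have "FD (\<lambda>x. gm x a b) x = FD (\<lambda>x. g (pt x) (E a (pt x)) (E b (pt x))) x"
    by (rule FD_cong_open[OF region(1) x]) (rule gm_E)
  then have "FD (\<lambda>x. gm x a b) x v = mderiv A (\<lambda>q. g q (E a q) (E b q)) (pt x) (E v (pt x))"
    using mderiv_smooth_fun[OF metric_smooth[OF E_smooth E_smooth] c pt_W(1)[OF x], of a b "E v (pt x)"]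
    by (simp add: pt_W(2)[OF x] cmp_E[OF x])
  also have "\<dots> = g (pt x) (nabla (E v) (E a) (pt x)) (E b (pt x)) + g (pt x) (E a (pt x)) (nabla (E v) (E b) (pt x))"
    by (rule nabla_metric[OF E_smooth E_smooth E_smooth])
  finally show ?thesis by (simp add: gm_def \<Gamma>_def vec_cmp[OF x] E_pt[OF x])
qed

lemma gm_linear: "x \<in> W \<Longrightarrow> linear (\<lambda>a. gm x a b)" "x \<in> W \<Longrightarrow> linear (gm x a)"
proof -
  assume x: "x \<in> W"
  note v = vec_cmp_inverse(4)[OF c pt_W(1)[OF x]]
  have "linear (\<lambda>b. gm x a b)"
    unfolding gm_def using linear_compose[OF v metric_bilinear(2)[of "pt x" "vec c (pt x) a"]] by (simp add: o_def)
  then show "linear (gm x a)" .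
  show "linear (\<lambda>a. gm x a b)"
    unfolding gm_def using linear_compose[OF v metric_bilinear(1)[of "pt x" "vec c (pt x) b"]] by (simp add: o_def)
qed

lemma gm_pos:
  assumes x: "x \<in> W" and a: "a \<noteq> 0" shows "gm x a a > 0"
proof -
  have "vec c (pt x) a \<noteq> 0"
    using vec_cmp_inverse(2)[OF c pt_W(1)[OF x], of a] linear_0[OF vec_cmp_inverse(3)[OF c pt_W(1)[OF x]]] a by metis
  then show ?thesis unfolding gm_def by (rule metric_pos)
qed

sublocale local_connection W \<Gamma> gm
  by (rule local_connection.intro)
     (rule region(1) \<Gamma>_lin1 \<Gamma>_lin2 \<Gamma>_smooth \<Gamma>_sym gm_linear gm_pos gm_smooth gm_parallel; assumption)+

lemma parallel_endo_in_chart: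
  assumes T: "endomorphism_field A T"
    and par: "\<And>X Y p. smooth_field A X \<Longrightarrow> smooth_field A Y \<Longrightarrow> nabla X (\<lambda>q. T q (Y q)) p = T p (nabla X Y p)"
  shows "parallel_endo (endo T)"
  unfolding parallel_endo_def
proof (intro conjI ballI allI)
  have linT: "linear (T p)" for p using T by (simp add: endomorphism_field_def)
  have smT: "smooth_field A (\<lambda>p. T p (E w p))" for w using T E_smooth by (simp add: endomorphism_field_def)
  have eq: "endo T x w = field_in_chart A c (\<lambda>p. T p (E w p)) x" if "x \<in> W" for x w
    by (simp add: endo_def field_in_chart_def E_pt[OF that])
  show "linear (endo T x)" if x: "x \<in> W" for x
  proof -
    have "linear (\<lambda>a. endo T x a)" unfolding endo_def
      using linear_compose[OF linear_compose[OF vec_cmp_inverse(4)[OF c pt_W(1)[OF x]] linT[of "pt x"]] vec_cmp_inverse(3)[OF c pt_W(1)[OF x]]]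
      by (simp add: o_def)
    then show ?thesis .
  qed
  show "smooth_on W (\<lambda>x. endo T x w)" for w
    by (rule smooth_on_congI[OF region(1) smooth_on_subset[OF smooth_field_in_chart[OF smT c] region(2)] eq])
  show "FD (\<lambda>x. endo T x w) x v = endo T x (\<Gamma> x v w) - \<Gamma> x v (endo T x w)" if x: "x \<in> W" for x v w
  proof -
    have "endo T x (\<Gamma> x v w) = cmp c (pt x) (nabla (E v) (\<lambda>q. T q (E w q)) (pt x))"
      by (simp add: par[OF E_smooth E_smooth] endo_def \<Gamma>_def vec_cmp[OF x])
    also have "\<dots> = FD (field_in_chart A c (\<lambda>p. T p (E w p))) x v + \<Gamma> x v (endo T x w)"
      unfolding nabla_in_chart[OF E_smooth smT x] cmp_E[OF x] by (simp add: endo_def E_pt[OF x])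
    also have "FD (field_in_chart A c (\<lambda>p. T p (E w p))) x = FD (\<lambda>x. endo T x w) x"
      by (rule FD_cong_open[OF region(1) x]) (rule eq[symmetric])
    finally show ?thesis by simp
  qed
qed

end

lemma (in levi_civita_manifold) chart_frame_exists:
  assumes c: "smooth_chart A c" and p: "p \<in> fst c"
  obtains W K \<beta> where "chart_frame A g nabla c W K \<beta>" "snd c p \<in> W"
proof -
  note cc = smooth_chart_is_chart[OF c]
  have "snd c p \<in> cimg c" using p by blast
  then obtain R where R: "R > 0" "cball (snd c p) R \<subseteq> cimg c"
    using chart_open(2)[OF cc] unfolding open_contains_cball by blast
  obtain \<beta> :: "'e \<Rightarrow> real" where \<beta>: "smooth_on UNIV \<beta>" "\<And>x. x \<in> cball (snd c p) (R/2) \<Longrightarrow> \<beta> x = 1"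
    "\<And>x. x \<notin> ball (snd c p) R \<Longrightarrow> \<beta> x = 0"
    by (rule smooth_bump[of "R/2" R "snd c p"]) (use R(1) in simp_all)
  have "chart_frame A g nabla c (ball (snd c p) (R/2)) (cball (snd c p) R) \<beta>"
  proof (intro chart_frame.intro chart_frame_axioms.intro levi_civita_manifold_axioms c)
    show "ball (snd c p) (R/2) \<subseteq> cimg c" using R by force
    show "\<beta> x = 0" if "x \<notin> cball (snd c p) R" for x using \<beta>(3)[of x] that by simp
  qed (use R \<beta> in auto)
  then show thesis by (rule that) (use R(1) in simp)
qed

section \<open>Orthogonal projections\<close>

locale inner_form =
  fixes b :: "'e::euclidean_space \<Rightarrow> 'e \<Rightarrow> real"
  assumes lin1: "\<And>w. linear (\<lambda>v. b v w)" and lin2: "\<And>v. linear (b v)"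
    and sym: "\<And>v w. b v w = b w v" and pos: "\<And>v. v \<noteq> 0 \<Longrightarrow> b v v > 0"
begin

lemmas b_simps = linear_add[OF lin1] linear_add[OF lin2] linear_cmul[OF lin1] linear_cmul[OF lin2]
  linear_diff[OF lin1] linear_diff[OF lin2] linear_0[OF lin1] linear_0[OF lin2]

text \<open>One step of the Gram-Schmidt process for the form \<open>b\<close>.\<close>

lemma projection_exists_span:
  assumes "finite S" shows "\<exists>v\<in>span S. \<forall>u\<in>span S. b u (w - v) = 0"
  using assms
proof (induction S arbitrary: w rule: finite_induct)
  case empty
  then show ?case by (simp add: b_simps)
next
  case (insert a S)
  obtain a1 where a1: "a1 \<in> span S" "\<And>u. u \<in> span S \<Longrightarrow> b u (a - a1) = 0" using insert.IH[of a] by blast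
  obtain w1 where w1: "w1 \<in> span S" "\<And>u. u \<in> span S \<Longrightarrow> b u (w - w1) = 0" using insert.IH[of w] by blast
  define a' where "a' = a - a1"
  define k where "k = b a' (w - w1) / b a' a'"
  have k: "b a' (w - w1) - k * b a' a' = 0"
  proof (cases "a' = 0")
    case True
    then show ?thesis by (simp add: b_simps)
  next
    case False
    then show ?thesis using pos[of a'] by (simp add: k_def)
  qed
  have mono: "u \<in> span (insert a S)" if "u \<in> span S" for u
    using that span_mono[of S "insert a S"] by blast
  have a'_in: "a' \<in> span (insert a S)"
    unfolding a'_def using mono[OF a1(1)] by (intro span_diff) (simp_all add: span_base)
  show ?case
  proof (intro bexI ballI)
    show "w1 + k *\<^sub>R a' \<in> span (insert a S)" by (intro span_add span_scale a'_in mono w1)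
    fix u assume "u \<in> span (insert a S)"
    then obtain l where l: "u - l *\<^sub>R a \<in> span S" by (auto simp: span_breakdown_eq)
    define u1 where "u1 = u - l *\<^sub>R a'"
    have "u1 = (u - l *\<^sub>R a) + l *\<^sub>R a1" by (simp add: u1_def a'_def algebra_simps)
    then have u1: "u1 \<in> span S" using l a1(1) by (simp add: span_add span_scale)
    have 1: "b u1 (w - (w1 + k *\<^sub>R a')) = 0"
      using w1(2)[OF u1] a1(2)[OF u1] by (simp add: a'_def[symmetric] b_simps)
    have 2: "b a' (w - (w1 + k *\<^sub>R a')) = 0" using k by (simp add: b_simps)
    have "u = u1 + l *\<^sub>R a'" by (simp add: u1_def)
    then have "b u (w - (w1 + k *\<^sub>R a')) = b u1 (w - (w1 + k *\<^sub>R a')) + l * b a' (w - (w1 + k *\<^sub>R a'))"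
      by (simp only: linear_add[OF lin1] linear_cmul[OF lin1] real_scaleR_def)
    then show "b u (w - (w1 + k *\<^sub>R a')) = 0" by (simp only: 1 2)
  qed
qed

lemma orth_proj_unique:
  assumes S: "subspace S" and v: "v \<in> S" "\<And>u. u \<in> S \<Longrightarrow> b u (w - v) = 0"
  shows "orth_proj b S w = v"
  unfolding orth_proj_def
proof (rule the_equality)
  show "v \<in> S \<and> (\<forall>u\<in>S. b u (w - v) = 0)" using v by blast
  fix v' assume v': "v' \<in> S \<and> (\<forall>u\<in>S. b u (w - v') = 0)"
  have d: "v' - v \<in> S" using v' v(1) S by (simp add: subspace_diff)
  have "b (v' - v) (v' - v) = b (v' - v) (w - v) - b (v' - v) (w - v')" by (simp add: b_simps)
  also have "\<dots> = 0" using v(2)[OF d] v' d by simp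
  finally show "v' = v" using pos[of "v' - v"] by fastforce
qed

lemma orth_proj:
  assumes S: "subspace S"
  shows "orth_proj b S w \<in> S" "u \<in> S \<Longrightarrow> b u (w - orth_proj b S w) = 0"
proof -
  obtain C where C: "finite C" "span C = S"
    using basis_exists[of S] span_eq_dim S by (metis finiteI_independent span_minimal subset_antisym)
  obtain v where v: "v \<in> S" "\<forall>u\<in>S. b u (w - v) = 0" using projection_exists_span[OF C(1), of w] C(2) by blast
  then have "orth_proj b S w = v" by (intro orth_proj_unique[OF S]) auto
  with v show "orth_proj b S w \<in> S" "u \<in> S \<Longrightarrow> b u (w - orth_proj b S w) = 0" by auto
qed

lemma orth_proj_linear:
  assumes S: "subspace S" shows "linear (orth_proj b S)"
proof (rule linearI)
  note P = orth_proj[OF S]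
  show "orth_proj b S (v + w) = orth_proj b S v + orth_proj b S w" for v w
    using P(2)[of _ v] P(2)[of _ w]
    by (intro orth_proj_unique[OF S] subspace_add[OF S] P(1)) (simp add: b_simps)
  show "orth_proj b S (k *\<^sub>R v) = k *\<^sub>R orth_proj b S v" for k v
    using P(2)[of _ v]
    by (intro orth_proj_unique[OF S] subspace_scale[OF S] P(1)) (simp add: b_simps)
qed

end

section \<open>Lagrangian submersions\<close>

locale lagrangian_submersion = levi_civita_manifold A g nabla + base: manifold B
  for A :: "('m::{t2_space,second_countable_topology}, 'e::euclidean_space) chart set" and g nabla
    and B :: "('n::{t2_space,second_countable_topology}, 'f::euclidean_space) chart set" +
  fixes J :: "'m \<Rightarrow> 'e \<Rightarrow> 'e" and F :: "'m \<Rightarrow> 'n"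
  assumes J: "endomorphism_field A J" and J_square: "\<And>p v. J p (J p v) = - v"
    and J_parallel: "\<And>X Y p. smooth_field A X \<Longrightarrow> smooth_field A Y \<Longrightarrow> nabla X (\<lambda>q. J q (Y q)) p = J p (nabla X Y p)"
    and F: "smooth_submersion A B F" and lagrangian: "\<And>p. J p ` vertical A B F p = horizontal A g B F p"
begin

abbreviation V :: "'m \<Rightarrow> 'e set" where "V \<equiv> vertical A B F"
abbreviation H :: "'m \<Rightarrow> 'e set" where "H \<equiv> horizontal A g B F"
abbreviation P :: "'m \<Rightarrow> 'e \<Rightarrow> 'e" where "P p \<equiv> orth_proj (g p) (V p)"

lemma inner_form: "inner_form (g p)"
  by (rule inner_form.intro) (rule metric_bilinear metric_sym metric_pos; assumption?)+

lemma linear_J: "linear (J p)" using J by (simp add: endomorphism_field_def)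

lemma F_smooth:
  assumes "c \<in> A" "e \<in> B"
  shows "smooth_on (snd c ` (fst c \<inter> F -` fst e)) (\<lambda>x. snd e (F (inv_chart c x)))"
    "open (snd c ` (fst c \<inter> F -` fst e))"
proof -
  have "smooth_map A B F" using F by (simp add: smooth_submersion_def)
  then have F': "continuous_on UNIV F" "smooth_on (snd c ` (fst c \<inter> F -` fst e)) (snd e \<circ> F \<circ> inv_chart c)"
    using assms by (auto simp: smooth_map_def)
  show "smooth_on (snd c ` (fst c \<inter> F -` fst e)) (\<lambda>x. snd e (F (inv_chart c x)))"
    using F'(2) by (simp add: o_def)
  have "open (F -` fst e)"
    by (rule open_vimage[OF chart_open(1)[OF base.smooth_chart_is_chart[OF base.member_smooth_chart[OF assms(2)]]] F'(1)])
  then show "open (snd c ` (fst c \<inter> F -` fst e))"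
    by (rule chart_image_open[OF smooth_chart_is_chart[OF member_smooth_chart[OF assms(1)]]])
qed

text \<open>The definition of \<open>F\<^sub>*\<close> uses preferred charts, which jump from point to point. Reading \<open>F\<^sub>*\<close> off in fixed
  charts around \<open>p\<close> and \<open>F p\<close> changes it by an injective linear map only, hence not its kernel.\<close>

lemma tangent_map_in_charts:
  assumes c: "c \<in> A" and e: "e \<in> B" and p: "p \<in> fst c" "F p \<in> fst e"
  obtains D where "linear D" "inj D" "\<And>v. tangent_map A B F p v = D (FD (\<lambda>x. snd e (F (inv_chart c x))) (snd c p) (cmp c p v))"
proof -
  define e' where "e' = chart_at B (F p)"
  have e': "e' \<in> B" "F p \<in> fst e'" using base.chart_at by (auto simp: e'_def)
  note cs = member_smooth_chart[OF c]
  note cc = smooth_chart_is_chart[OF cs]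
  note es = base.member_smooth_chart[OF e] base.member_smooth_chart[OF e'(1)]
  note ec = base.smooth_chart_is_chart[OF es(1)] base.smooth_chart_is_chart[OF es(2)]
  note t = base.smooth_chart_transitions[OF es(1) e'(1)]
  let ?S = "snd c ` (fst c \<inter> F -` fst e)" and ?S' = "snd c ` (fst c \<inter> F -` fst e')"
  let ?f = "\<lambda>x. snd e (F (inv_chart c x))" and ?f' = "\<lambda>x. snd e' (F (inv_chart c x))"
  let ?D = "FD (\<lambda>y. snd e' (inv_chart e y)) (snd e (F p))"
  have x: "snd c p \<in> ?S" "snd c p \<in> ?S'" "snd c p \<in> ?S \<inter> ?S'" using p e'(2) by auto
  have pin: "inv_chart c (snd c p) = p" by (rule chart_inverse(1)[OF cc p(1)])
  have y: "snd e (F p) \<in> snd e ` (fst e \<inter> fst e')" using p(2) e'(2) by blast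
  have 1: "(?f has_derivative FD ?f (snd c p)) (at (snd c p))"
    by (rule smooth_on_has_derivative[OF F_smooth(1)[OF c e] x(1)])
  have 2: "((\<lambda>y. snd e' (inv_chart e y)) has_derivative ?D) (at (?f (snd c p)))"
    unfolding pin by (rule smooth_on_has_derivative[OF transition_smooth[OF t(1)] y])
  have "(?f' has_derivative (\<lambda>h. ?D (FD ?f (snd c p) h))) (at (snd c p))"
    by (rule has_derivative_transform_within_open[OF has_derivative_compose[OF 1 2] F_smooth(2)[OF c e] x(1)])
       (auto simp: chart_inverse[OF cc] chart_inverse[OF ec(1)])
  from FD_eq[OF this] have FDf': "FD ?f' (snd c p) h = ?D (FD ?f (snd c p) h)" for h by simp
  have "tangent_map A B F p v = FD ?f' (snd c p) (cmp c p v)" for v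
    unfolding tangent_map_def e'_def[symmetric]
    using mderiv_in_chart[OF cs p(1), of "snd e' \<circ> F" v]
      smooth_on_differentiable[OF F_smooth(1)[OF c e'(1)] x(2)] by (simp add: o_def)
  moreover have "linear ?D" by (rule smooth_on_linear_FD[OF transition_smooth[OF t(1)] y])
  moreover have "inj ?D"
    by (rule inj_on_inverseI) (rule transition_inverse[OF ec t p(2) e'(2)])
  ultimately show thesis using that FDf' by simp
qed

lemma vertical_in_charts:
  assumes "c \<in> A" "e \<in> B" "p \<in> fst c" "F p \<in> fst e"
  shows "v \<in> V p \<longleftrightarrow> FD (\<lambda>x. snd e (F (inv_chart c x))) (snd c p) (cmp c p v) = 0"
    "surj (FD (\<lambda>x. snd e (F (inv_chart c x))) (snd c p))"
proof -
  let ?L = "FD (\<lambda>x. snd e (F (inv_chart c x))) (snd c p)"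
  obtain D where D: "linear D" "inj D" "\<And>v. tangent_map A B F p v = D (?L (cmp c p v))"
    by (rule tangent_map_in_charts[OF assms]) (rule that; assumption)
  show "v \<in> V p \<longleftrightarrow> ?L (cmp c p v) = 0"
    using injD[OF D(2), of "?L (cmp c p v)" 0] linear_0[OF D(1)] by (auto simp: vertical_def D(3))
  have "\<exists>w. ?L w = a" for a
  proof -
    have "surj (tangent_map A B F p)" using F by (simp add: smooth_submersion_def)
    then obtain v where "tangent_map A B F p v = D a" by (metis surjD)
    then have "?L (cmp c p v) = a" using injD[OF D(2)] by (simp add: D(3))
    then show ?thesis by blast
  qed
  then show "surj ?L" by (metis surjI)
qed

lemma subspace_V: "subspace (V p)"
proof -
  obtain D where D: "linear D" "inj D" "\<And>v. tangent_map A B F p v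
      = D (FD (\<lambda>x. snd (chart_at B (F p)) (F (inv_chart (chart_at A p) x))) (snd (chart_at A p) p) (cmp (chart_at A p) p v))"
    by (rule tangent_map_in_charts[OF chart_at(1) base.chart_at(1) chart_at(2) base.chart_at(2)]) (rule that; assumption)
  have l1: "linear (FD (\<lambda>x. snd (chart_at B (F p)) (F (inv_chart (chart_at A p) x))) (snd (chart_at A p) p))"
    by (rule smooth_on_linear_FD[OF F_smooth(1)[OF chart_at(1) base.chart_at(1)]])
       (use chart_at(2) base.chart_at(2) in auto)
  have l2: "linear (cmp (chart_at A p) p)"
    by (rule vec_cmp_inverse(3)[OF member_smooth_chart[OF chart_at(1)] chart_at(2)])
  have "linear (tangent_map A B F p)"
    using linear_compose[OF linear_compose[OF l2 l1] D(1)] by (simp add: D(3)[abs_def] o_def)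
  then show ?thesis
    by (simp add: vertical_def subspace_def linear_0 linear_add linear_cmul)
qed

lemma H_iff: "w \<in> H p \<longleftrightarrow> (\<forall>v\<in>V p. g p v w = 0)"
  by (simp add: horizontal_def)

lemma subspace_H: "subspace (H p)"
  by (auto simp: subspace_def H_iff linear_0[OF metric_bilinear(2)] linear_add[OF metric_bilinear(2)] linear_cmul[OF metric_bilinear(2)])

lemma P_in: "P p v \<in> V p" by (rule inner_form.orth_proj(1)[OF inner_form subspace_V])

lemma Q_in: "v - P p v \<in> H p"
  unfolding H_iff using inner_form.orth_proj(2)[OF inner_form subspace_V] by blast

lemma linear_P: "linear (P p)" by (rule inner_form.orth_proj_linear[OF inner_form subspace_V])

lemma P_unique: "v \<in> V p \<Longrightarrow> w - v \<in> H p \<Longrightarrow> P p w = v"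
  by (rule inner_form.orth_proj_unique[OF inner_form subspace_V]) (auto simp: H_iff)

lemma P_id_iff: "P p v = v \<longleftrightarrow> v \<in> V p"
  using P_in[of p v] P_unique[of v p v] subspace_0[OF subspace_H] by auto

lemma P_zero_iff: "P p v = 0 \<longleftrightarrow> v \<in> H p"
  using Q_in[of v p] P_unique[of 0 p v] subspace_0[OF subspace_V] by auto

lemma orth_proj_H: "orth_proj (g p) (H p) v = v - P p v"
  by (rule inner_form.orth_proj_unique[OF inner_form subspace_H Q_in])
     (use P_in[of p v] metric_sym H_iff in auto)

lemma V_H_zero: "v \<in> V p \<Longrightarrow> v \<in> H p \<Longrightarrow> v = 0"
  using metric_pos[of v p] by (auto simp: H_iff)

lemma J_V_iff: "J p v \<in> H p \<longleftrightarrow> v \<in> V p"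
proof
  assume "J p v \<in> H p"
  then obtain w where w: "w \<in> V p" "J p v = J p w" using lagrangian[of p] by (metis imageE)
  then have "J p (J p v) = J p (J p w)" by simp
  then have "v = w" by (simp add: J_square)
  with w(1) show "v \<in> V p" by simp
qed (use lagrangian[of p] in blast)

lemma J_H_iff: "J p v \<in> V p \<longleftrightarrow> v \<in> H p"
  using J_V_iff[of p "J p v"] subspace_neg[OF subspace_H, of v p] subspace_neg[OF subspace_H, of "- v" p]
  by (auto simp: J_square)

lemma P_J: "P p (J p v) = J p (v - P p v)"
proof (rule P_unique)
  show "J p (v - P p v) \<in> V p" by (simp add: J_H_iff Q_in)
  have "J p v - J p (v - P p v) = J p (P p v)" by (simp add: linear_diff[OF linear_J])
  then show "J p v - J p (v - P p v) \<in> H p" by (simp add: J_V_iff P_in)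
qed

lemma P_selfadjoint: "g p (P p v) w = g p v (P p w)"
proof -
  have "g p (P p v) (w - P p w) = 0" "g p (P p w) (v - P p v) = 0" using Q_in P_in H_iff by blast+
  then show ?thesis
    using metric_sym[of p "P p w" v] metric_sym[of p "P p w" "P p v"]
    by (simp add: linear_diff[OF metric_bilinear(2)])
qed

text \<open>Since \<open>J\<close> maps the horizontal space into the kernel of \<open>F\<^sub>*\<close>, the vertical part \<open>v\<close> of \<open>w\<close> is the solution
  of \<open>F\<^sub>* v = 0\<close>, \<open>F\<^sub>* (J v) = F\<^sub>* (J w)\<close>. The pair \<open>(F\<^sub>*, F\<^sub>* J)\<close> is a smooth family of isomorphisms, whence
  the projection is smooth.\<close>

lemma P_endomorphism: "endomorphism_field A P"
  unfolding endomorphism_field_def smooth_field_def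
proof (intro conjI allI impI ballI)
  show "linear (P p)" for p by (rule linear_P)
  fix X c assume X: "\<forall>c\<in>A. smooth_on (cimg c) (field_in_chart A c X)" and cA: "c \<in> A"
  have sX: "smooth_field A X" using X by (simp add: smooth_field_def)
  note cs = member_smooth_chart[OF cA]
  note cc = smooth_chart_is_chart[OF cs]
  show "smooth_on (cimg c) (field_in_chart A c (\<lambda>p. P p (X p)))"
  proof (rule smooth_on_local[OF chart_open(2)[OF cc]])
    fix x0 assume x0: "x0 \<in> cimg c"
    define p0 where "p0 = inv_chart c x0"
    have p0: "p0 \<in> fst c" "snd c p0 = x0" using chart_inverse[OF cc] x0 by (auto simp: p0_def)
    obtain W K \<beta> where fr: "chart_frame A g nabla c W K \<beta>" "x0 \<in> W"
      using chart_frame_exists[OF cs p0(1)] p0(2) by auto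
    interpret fr: chart_frame A g nabla c W K \<beta> by (rule fr(1))
    define e where "e = chart_at B (F p0)"
    have e: "e \<in> B" "F p0 \<in> fst e" using base.chart_at by (auto simp: e_def)
    define S where "S = snd c ` (fst c \<inter> F -` fst e) \<inter> W"
    have S: "open S" "x0 \<in> S"
      unfolding S_def using F_smooth(2)[OF cA e(1)] fr.region(1) fr(2) p0 e(2) by auto
    let ?L = "\<lambda>x. FD (\<lambda>x. snd e (F (inv_chart c x))) x" and ?p = "\<lambda>x. inv_chart c x"
    have pS: "?p x \<in> fst c" "F (?p x) \<in> fst e" "snd c (?p x) = x" "x \<in> W" if "x \<in> S" for x
      using that chart_inverse[OF cc] by (auto simp: S_def)
    have L_smooth: "smooth_on S (\<lambda>x. ?L x w)" for w
      by (rule smooth_on_FD[OF smooth_on_subset[OF F_smooth(1)[OF cA e(1)]]]) (simp add: S_def)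
    have L_lin: "linear (?L x)" if "x \<in> S" for x
      by (rule smooth_on_linear_FD[OF F_smooth(1)[OF cA e(1)]]) (use that in \<open>simp add: S_def\<close>)
    have V_L: "vec c (?p x) w \<in> V (?p x) \<longleftrightarrow> ?L x w = 0" if "x \<in> S" for x w
      using vertical_in_charts(1)[OF cA e(1) pS(1,2)[OF that]] pS(3)[OF that]
        vec_cmp_inverse(2)[OF cs pS(1)[OF that]] by simp
    have L_surj: "surj (?L x)" if "x \<in> S" for x
      using vertical_in_charts(2)[OF cA e(1) pS(1,2)[OF that]] pS(3)[OF that] by simp
    let ?J = "fr.endo J"
    have J_end: "fr.parallel_endo ?J" by (rule fr.parallel_endo_in_chart[OF J J_parallel])
    then have J_lin: "linear (?J x)" if "x \<in> S" for x using pS(4)[OF that] by (simp add: fr.parallel_endo_def)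
    have J_smooth': "smooth_on S (\<lambda>x. ?J x w)" for w
      by (rule smooth_on_subset[of W]) (use J_end in \<open>auto simp: fr.parallel_endo_def S_def\<close>)
    have vJ: "vec c (?p x) (?J x w) = J (?p x) (vec c (?p x) w)" if "x \<in> S" for x w
      by (simp add: fr.endo_def fr.vec_cmp[OF pS(4)[OF that]])
    define M where "M x w = (?L x w, ?L x (?J x w))" for x w
    have M_lin: "linear (M x)" if "x \<in> S" for x
      unfolding M_def using L_lin[OF that] J_lin[OF that]
      by (auto intro!: linearI simp: linear_add linear_cmul)
    have inl: "bounded_linear (\<lambda>v::'f. (v, 0::'f))" and inr: "bounded_linear (\<lambda>v::'f. (0::'f, v))"
      by (rule bounded_linear_Pair[OF bounded_linear_ident bounded_linear_zero]
          bounded_linear_Pair[OF bounded_linear_zero bounded_linear_ident])+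
    have M_smooth: "smooth_on S (\<lambda>x. M x w)" for w
    proof -
      have "smooth_on S (\<lambda>x. ?L x (?J x w))"
        by (rule smooth_on_family_apply[OF S(1) L_lin L_smooth J_smooth'])
      then have "smooth_on S (\<lambda>x. (?L x w, 0) + (0, ?L x (?J x w)))"
        by (intro smooth_on_add[OF S(1)] smooth_on_linear[OF S(1) inl L_smooth] smooth_on_linear[OF S(1) inr])
      then show ?thesis by (simp add: M_def)
    qed
    have M_inj: "inj (M x)" if x: "x \<in> S" for x
      unfolding linear_injective_0[OF M_lin[OF x]]
    proof (intro allI impI)
      fix w assume "M x w = 0"
      then have "?L x w = 0" "?L x (?J x w) = 0" by (auto simp: M_def zero_prod_def)
      then have v: "vec c (?p x) w \<in> V (?p x)" "J (?p x) (vec c (?p x) w) \<in> V (?p x)"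
        unfolding vJ[OF x, symmetric] V_L[OF x] by simp_all
      then have "vec c (?p x) w \<in> H (?p x)" by (simp only: J_H_iff)
      then have "vec c (?p x) w = 0" by (rule V_H_zero[OF v(1)])
      then show "w = 0"
        using vec_cmp_inverse(2)[OF cs pS(1)[OF x], of w] linear_0[OF vec_cmp_inverse(3)[OF cs pS(1)[OF x]]] by simp
    qed
    have M_surj: "\<exists>w. M x w = z" if x: "x \<in> S" for x z
    proof -
      let ?v = "vec c (?p x)" and ?c = "cmp c (?p x)"
      have vc: "?v (?c u) = u" for u by (rule vec_cmp_inverse(1)[OF cs pS(1)[OF x]])
      obtain a1 a2 where a: "?L x a1 = fst z" "?L x a2 = snd z" using surjD[OF L_surj[OF x], of "fst z"] surjD[OF L_surj[OF x], of "snd z"] by metis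
      define h where "h = ?v a1 - P (?p x) (?v a1)"
      define v where "v = - J (?p x) (?v a2 - P (?p x) (?v a2))"
      have hH: "h \<in> H (?p x)" and vV: "v \<in> V (?p x)"
        using Q_in J_H_iff subspace_neg[OF subspace_V] by (auto simp: h_def v_def)
      have kill: "?L x (?c u) = 0" if "u \<in> V (?p x)" for u using V_L[OF x, of "?c u"] that by (simp add: vc)
      note lc = vec_cmp_inverse(3)[OF cs pS(1)[OF x]]
      have cv: "?c (?v u) = u" for u by (rule vec_cmp_inverse(2)[OF cs pS(1)[OF x]])
      have Lq: "?L x (?c (?v u - P (?p x) (?v u))) = ?L x u" for u
        by (simp add: linear_diff[OF lc] linear_diff[OF L_lin[OF x]] kill[OF P_in] cv)
      have 1: "?L x (?c (h + v)) = fst z"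
        unfolding linear_add[OF lc] linear_add[OF L_lin[OF x]] kill[OF vV] h_def Lq a by simp
      have Jhv: "?J x (?c (h + v)) = ?c (J (?p x) h) + ?c (?v a2 - P (?p x) (?v a2))"
      proof -
        have "J (?p x) (h + v) = J (?p x) h + (?v a2 - P (?p x) (?v a2))"
          unfolding v_def linear_add[OF linear_J] linear_neg[OF linear_J] J_square minus_minus ..
        moreover have "?J x (?c (h + v)) = ?c (J (?p x) (h + v))" by (simp only: fr.endo_def vc)
        ultimately show ?thesis by (simp only: linear_add[OF lc])
      qed
      have "J (?p x) h \<in> V (?p x)" using hH by (simp add: J_H_iff)
      then have 2: "?L x (?J x (?c (h + v))) = snd z"
        unfolding Jhv linear_add[OF L_lin[OF x]] Lq a by (simp add: kill)
      show ?thesis by (intro exI[of _ "?c (h + v)"]) (simp add: M_def 1 2)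
    qed
    define u where "u x = inv (M x)" for x
    have u: "M x (u x z) = z" "u x (M x w) = w" if "x \<in> S" for x z w
    proof -
      have "surj (M x)" by (rule surjI[of _ "\<lambda>z. SOME w. M x w = z"]) (rule someI_ex[OF M_surj[OF that]])
      then show "M x (u x z) = z" unfolding u_def by (rule surj_f_inv_f)
      show "u x (M x w) = w" unfolding u_def by (rule inv_f_f[OF M_inj[OF that]])
    qed
    have u_lin: "linear (u x)" if "x \<in> S" for x
    proof (rule linearI)
      show "u x (v + w) = u x v + u x w" for v w
        using u(2)[OF that, of "u x v + u x w"] by (simp add: linear_add[OF M_lin[OF that]] u(1)[OF that])
      show "u x (k *\<^sub>R v) = k *\<^sub>R u x v" for k v
        using u(2)[OF that, of "k *\<^sub>R u x v"] by (simp add: linear_cmul[OF M_lin[OF that]] u(1)[OF that])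
    qed
    have u_smooth: "smooth_on S (\<lambda>x. u x z)" for z
      by (rule smooth_on_family_inverse[OF S(1) M_lin M_smooth u])
    let ?X = "field_in_chart A c X"
    have X_smooth: "smooth_on S ?X"
      by (rule smooth_on_subset[OF smooth_field_in_chart[OF sX cs]]) (auto simp: S_def)
    have LJX: "smooth_on S (\<lambda>x. ?L x (?J x (?X x)))"
      by (rule smooth_on_family_apply[OF S(1) L_lin L_smooth smooth_on_family_apply[OF S(1) J_lin J_smooth' X_smooth]])
    have "smooth_on S (\<lambda>x. (0::'f, ?L x (?J x (?X x))))"
      by (rule smooth_on_linear[OF S(1) inr LJX])
    then have "smooth_on S (\<lambda>x. u x (0, ?L x (?J x (?X x))))"
      by (rule smooth_on_family_apply[OF S(1) u_lin u_smooth, rotated]) assumption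
    moreover have "field_in_chart A c (\<lambda>p. P p (X p)) x = u x (0, ?L x (?J x (?X x)))" if x: "x \<in> S" for x
    proof -
      let ?q = "?p x" and ?v = "vec c (?p x)" and ?c = "cmp c (?p x)"
      have vc: "?v (?c u) = u" for u by (rule vec_cmp_inverse(1)[OF cs pS(1)[OF x]])
      note lc = vec_cmp_inverse(3)[OF cs pS(1)[OF x]]
      have kill: "?L x (?c u) = 0" if "u \<in> V ?q" for u using V_L[OF x, of "?c u"] that by (simp add: vc)
      have "J ?q (X ?q) - J ?q (P ?q (X ?q)) \<in> V ?q"
        using Q_in[of "X ?q" ?q] J_H_iff[of ?q "X ?q - P ?q (X ?q)"] by (simp add: linear_diff[OF linear_J])
      from kill[OF this] have "?L x (?c (J ?q (X ?q))) = ?L x (?c (J ?q (P ?q (X ?q))))"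
        by (simp add: linear_diff[OF lc] linear_diff[OF L_lin[OF x]])
      then have "M x (?c (P ?q (X ?q))) = (0, ?L x (?J x (?X x)))"
        by (simp add: M_def kill[OF P_in] fr.endo_def field_in_chart_def vc)
      then have "u x (M x (?c (P ?q (X ?q)))) = u x (0, ?L x (?J x (?X x)))" by simp
      then show ?thesis by (simp add: u(2)[OF x] field_in_chart_def)
    qed
    ultimately have "smooth_on S (field_in_chart A c (\<lambda>p. P p (X p)))" by (rule smooth_on_congI[OF S(1)])
    with S show "\<exists>T. open T \<and> x0 \<in> T \<and> smooth_on T (field_in_chart A c (\<lambda>p. P p (X p)))" by blast
  qed
qed

lemma sections_iff: "X \<in> sections A D \<longleftrightarrow> smooth_field A X \<and> (\<forall>p. X p \<in> D p)"
  by (simp add: sections_def)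

text \<open>As \<open>J Y\<close> is vertical and \<open>J\<close> is parallel, \<open>A\<^sub>X J Y\<close> is the horizontal part of \<open>J (\<nabla>\<^sub>X Y)\<close>, and \<open>J\<close> maps exactly the
  horizontal vectors to vertical ones. The argument for \<open>T\<close> is the mirror image.\<close>

lemma oneill_A_zero_iff:
  assumes X: "X \<in> sections A H" and Y: "Y \<in> sections A H"
  shows "oneill_A A g nabla B F X (\<lambda>q. J q (Y q)) p = 0 \<longleftrightarrow> nabla X Y p \<in> H p"
proof -
  have s: "smooth_field A X" "smooth_field A Y" "\<And>p. X p \<in> H p" "\<And>p. Y p \<in> H p"
    using X Y by (auto simp: sections_iff)
  have 1: "hor_part A g B F X = X"
    using s(3) by (auto simp: hor_part_def orth_proj_H P_zero_iff fun_eq_iff)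
  have JV: "J q (Y q) \<in> V q" for q using s(4) by (simp add: J_H_iff)
  have 2: "hor_part A g B F (\<lambda>q. J q (Y q)) = (\<lambda>_. 0)"
    using JV by (auto simp: hor_part_def orth_proj_H P_id_iff[THEN iffD2] fun_eq_iff)
  have 3: "vert_part A g B F (\<lambda>q. J q (Y q)) = (\<lambda>q. J q (Y q))"
    using JV P_id_iff by (auto simp: vert_part_def fun_eq_iff)
  have "oneill_A A g nabla B F X (\<lambda>q. J q (Y q)) p
      = P p (nabla X (\<lambda>_. 0) p) + orth_proj (g p) (H p) (nabla X (\<lambda>q. J q (Y q)) p)"
    unfolding oneill_A_def Let_def 1 2 3 by (simp add: vert_part_def hor_part_def)
  also have "\<dots> = J p (nabla X Y p) - P p (J p (nabla X Y p))"
    by (simp add: nabla_zero2[OF s(1)] linear_0[OF linear_P] orth_proj_H J_parallel[OF s(1,2)])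
  finally show ?thesis using P_id_iff[of p "J p (nabla X Y p)"] J_H_iff[of p "nabla X Y p"] by auto
qed

lemma oneill_T_zero_iff:
  assumes X: "X \<in> sections A V" and Y: "Y \<in> sections A V"
  shows "oneill_T A g nabla B F X (\<lambda>q. J q (Y q)) p = 0 \<longleftrightarrow> nabla X Y p \<in> V p"
proof -
  have s: "smooth_field A X" "smooth_field A Y" "\<And>p. X p \<in> V p" "\<And>p. Y p \<in> V p"
    using X Y by (auto simp: sections_iff)
  have 1: "vert_part A g B F X = X"
    using s(3) P_id_iff by (auto simp: vert_part_def fun_eq_iff)
  have JH: "J q (Y q) \<in> H q" for q using s(4) by (simp add: J_V_iff)
  have 2: "vert_part A g B F (\<lambda>q. J q (Y q)) = (\<lambda>_. 0)"
    using JH P_zero_iff by (auto simp: vert_part_def fun_eq_iff)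
  have 3: "hor_part A g B F (\<lambda>q. J q (Y q)) = (\<lambda>q. J q (Y q))"
    using JH P_zero_iff by (auto simp: hor_part_def orth_proj_H fun_eq_iff)
  have "oneill_T A g nabla B F X (\<lambda>q. J q (Y q)) p
      = orth_proj (g p) (H p) (nabla X (\<lambda>_. 0) p) + P p (nabla X (\<lambda>q. J q (Y q)) p)"
    unfolding oneill_T_def Let_def 1 2 3 by (simp add: vert_part_def hor_part_def)
  also have "\<dots> = P p (J p (nabla X Y p))"
    by (simp add: nabla_zero2[OF s(1)] linear_0[OF linear_P] orth_proj_H J_parallel[OF s(1,2)])
  finally show ?thesis using P_zero_iff[of p "J p (nabla X Y p)"] J_V_iff[of p "nabla X Y p"] by auto
qed

end

section \<open>Products have totally geodesic factors\<close>

lemma has_derivative_in_subspace: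
  fixes f :: "'a::real_normed_vector \<Rightarrow> 'b::euclidean_space"
  assumes S: "subspace S" and f: "(f has_derivative f') (at x)" and T: "open T" "x \<in> T" "\<And>y. y \<in> T \<Longrightarrow> f y \<in> S"
  shows "f' h \<in> S"
proof -
  interpret inner_form "(\<bullet>) :: 'b \<Rightarrow> 'b \<Rightarrow> real"
    by (rule inner_form.intro) (auto intro!: linearI simp: inner_add_left inner_add_right inner_commute)
  let ?\<pi> = "orth_proj (\<bullet>) S"
  have id: "?\<pi> v = v" if "v \<in> S" for v by (rule orth_proj_unique[OF S that]) simp
  have bl: "bounded_linear ?\<pi>" using orth_proj_linear[OF S] linear_conv_bounded_linear by blast
  have "((\<lambda>y. ?\<pi> (f y)) has_derivative (\<lambda>h. ?\<pi> (f' h))) (at x)" by (rule bounded_linear.has_derivative[OF bl f])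
  then have "(f has_derivative (\<lambda>h. ?\<pi> (f' h))) (at x)"
    by (rule has_derivative_transform_within_open[OF _ T(1,2)]) (simp add: id T(3))
  from has_derivative_unique[OF f this] have "f' h = ?\<pi> (f' h)" by (rule fun_cong)
  then show ?thesis using orth_proj(1)[OF S, of "f' h"] by simp
qed

definition product_chart ::
    "('m::{t2_space,second_countable_topology}, 'e::euclidean_space) chart set
      \<Rightarrow> ('m \<Rightarrow> 'e \<Rightarrow> 'e \<Rightarrow> real) \<Rightarrow> ('m \<Rightarrow> 'e set) \<Rightarrow> ('m \<Rightarrow> 'e set) \<Rightarrow> 'm set \<Rightarrow> ('m \<Rightarrow> 'e)
      \<Rightarrow> 'e set \<Rightarrow> 'e set \<Rightarrow> 'e set \<Rightarrow> 'e set \<Rightarrow> ('e \<Rightarrow> 'e \<Rightarrow> 'e \<Rightarrow> real) \<Rightarrow> ('e \<Rightarrow> 'e \<Rightarrow> 'e \<Rightarrow> real) \<Rightarrow> bool" where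
  "product_chart A g D1 D2 U \<psi> S1 S2 P1 P2 h1 h2 \<longleftrightarrow> smooth_chart A (U, \<psi>) \<and>
     subspace S1 \<and> subspace S2 \<and> S1 \<inter> S2 = {0} \<and> {a + b | a b. a \<in> S1 \<and> b \<in> S2} = UNIV \<and>
     openin (top_of_set S1) P1 \<and> openin (top_of_set S2) P2 \<and>
     \<psi> ` U = {x + y | x y. x \<in> P1 \<and> y \<in> P2} \<and>
     (\<forall>q\<in>U. D1 q = {v. mderiv A \<psi> q v \<in> S1} \<and> D2 q = {v. mderiv A \<psi> q v \<in> S2}) \<and>
     (\<forall>q\<in>U. \<forall>x\<in>P1. \<forall>y\<in>P2. \<forall>v w. \<forall>a\<in>S1. \<forall>a'\<in>S1. \<forall>b\<in>S2. \<forall>b'\<in>S2.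
        \<psi> q = x + y \<longrightarrow> mderiv A \<psi> q v = a + b \<longrightarrow> mderiv A \<psi> q w = a' + b' \<longrightarrow>
        g q v w = h1 x a a' + h2 y b b')"

lemma locally_product_iff:
  "locally_product A g D1 D2 \<longleftrightarrow>
     (\<forall>p. \<exists>U \<psi> S1 S2 P1 P2 h1 h2. p \<in> U \<and> product_chart A g D1 D2 U \<psi> S1 S2 P1 P2 h1 h2)"
  unfolding locally_product_def product_chart_def ..

lemma product_chartD:
  assumes "product_chart A g D1 D2 U \<psi> S1 S2 P1 P2 h1 h2"
  shows "smooth_chart A (U, \<psi>)" "subspace S1" "subspace S2" "S1 \<inter> S2 = {0}"
    "{a + b | a b. a \<in> S1 \<and> b \<in> S2} = UNIV" "openin (top_of_set S1) P1" "openin (top_of_set S2) P2"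
    "\<psi> ` U = {x + y | x y. x \<in> P1 \<and> y \<in> P2}"
    "\<And>q. q \<in> U \<Longrightarrow> D1 q = {v. mderiv A \<psi> q v \<in> S1}" "\<And>q. q \<in> U \<Longrightarrow> D2 q = {v. mderiv A \<psi> q v \<in> S2}"
    "\<And>q x y v w a a' b b'. q \<in> U \<Longrightarrow> x \<in> P1 \<Longrightarrow> y \<in> P2 \<Longrightarrow> a \<in> S1 \<Longrightarrow> a' \<in> S1 \<Longrightarrow> b \<in> S2 \<Longrightarrow> b' \<in> S2 \<Longrightarrow>
       \<psi> q = x + y \<Longrightarrow> mderiv A \<psi> q v = a + b \<Longrightarrow> mderiv A \<psi> q w = a' + b' \<Longrightarrow>
       g q v w = h1 x a a' + h2 y b b'"
  subgoal using assms unfolding product_chart_def by (elim conjE)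
  subgoal using assms unfolding product_chart_def by (elim conjE)
  subgoal using assms unfolding product_chart_def by (elim conjE)
  subgoal using assms unfolding product_chart_def by (elim conjE)
  subgoal using assms unfolding product_chart_def by (elim conjE)
  subgoal using assms unfolding product_chart_def by (elim conjE)
  subgoal using assms unfolding product_chart_def by (elim conjE)
  subgoal using assms unfolding product_chart_def by (elim conjE)
  subgoal for q
  proof -
    have "\<forall>q\<in>U. D1 q = {v. mderiv A \<psi> q v \<in> S1} \<and> D2 q = {v. mderiv A \<psi> q v \<in> S2}"
      using assms unfolding product_chart_def by (elim conjE)
    then show "q \<in> U \<Longrightarrow> D1 q = {v. mderiv A \<psi> q v \<in> S1}" by blast
  qed
  subgoal for q
  proof -
    have "\<forall>q\<in>U. D1 q = {v. mderiv A \<psi> q v \<in> S1} \<and> D2 q = {v. mderiv A \<psi> q v \<in> S2}"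
      using assms unfolding product_chart_def by (elim conjE)
    then show "q \<in> U \<Longrightarrow> D2 q = {v. mderiv A \<psi> q v \<in> S2}" by blast
  qed
  subgoal using assms unfolding product_chart_def by (elim conjE) (simp only: Ball_def)
  done

lemma product_chart_swap:
  assumes "product_chart A g D1 D2 U \<psi> S1 S2 P1 P2 h1 h2"
  shows "product_chart A g D2 D1 U \<psi> S2 S1 P2 P1 h2 h1"
proof -
  note * = product_chartD[OF assms]
  have c: "{b + a | b a. b \<in> T \<and> a \<in> S} = {a + b | a b. a \<in> S \<and> b \<in> T}" for S T :: "'b set"
    by (auto simp: add.commute) (metis add.commute)+
  show ?thesis
    unfolding product_chart_def
  proof (intro conjI ballI allI impI)
    show "S2 \<inter> S1 = {0}" using *(4) by blast
    show "{b + a | b a. b \<in> S2 \<and> a \<in> S1} = UNIV" unfolding c by (rule *(5))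
    show "\<psi> ` U = {y + x | y x. y \<in> P2 \<and> x \<in> P1}" unfolding c by (rule *(8))
    fix q x y v w a a' b b'
    assume h: "q \<in> U" "x \<in> P2" "y \<in> P1" "a \<in> S2" "a' \<in> S2" "b \<in> S1" "b' \<in> S1" "\<psi> q = x + y"
      "mderiv A \<psi> q v = a + b" "mderiv A \<psi> q w = a' + b'"
    have "g q v w = h1 y b b' + h2 x a a'"
      by (rule *(11)[OF h(1,3,2,6,7,4,5)]) (simp_all only: h add.commute)
    then show "g q v w = h2 x a a' + h1 y b b'" by (simp only: add.commute)
  qed (rule *; assumption?)+
qed

lemma locally_product_swap: "locally_product A g D1 D2 \<Longrightarrow> locally_product A g D2 D1"
  unfolding locally_product_iff using product_chart_swap by meson

text \<open>Koszul's formula in a product chart: the metric coefficients along one factor do not vary along the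
  other one, and the mixed coefficients vanish.\<close>

lemma (in levi_civita_manifold) product_factor_geodesic:
  assumes prod: "locally_product A g D1 D2"
    and X: "X \<in> sections A D1" and Y: "Y \<in> sections A D1"
  shows "nabla X Y p \<in> D1 p"
proof -
  obtain U \<psi> S1 S2 P1 P2 h1 h2 where pU: "p \<in> U" and pc: "product_chart A g D1 D2 U \<psi> S1 S2 P1 P2 h1 h2"
    using prod[unfolded locally_product_iff, rule_format, of p] by (elim exE conjE) (rule that)
  note prodD = product_chartD[OF pc]
  note S = prodD(2-4) and P = prodD(6,7) and sum = prodD(5) and im = prodD(8) and g = prodD(11)
  have U: "p \<in> U" "smooth_chart A (U, \<psi>)" by (rule pU prodD(1))+
  define c where "c = (U, \<psi>)"
  have c: "smooth_chart A c" "p \<in> fst c" "fst c = U" "snd c = \<psi>" using U by (auto simp: c_def)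
  obtain W K \<beta> where fr: "chart_frame A g nabla c W K \<beta>" "snd c p \<in> W"
    by (rule chart_frame_exists[OF c(1,2)])
  interpret fr: chart_frame A g nabla c W K \<beta> by (rule fr(1))
  have X': "smooth_field A X" "\<And>p. X p \<in> D1 p" and Y': "smooth_field A Y" "\<And>p. Y p \<in> D1 p"
    using X Y by (auto simp: sections_def)
  have P_sub: "P1 \<subseteq> S1" "P2 \<subseteq> S2" using P by (auto simp: openin_subtopology)
  have zero: "0 \<in> S1" "0 \<in> S2" using S by (auto simp: subspace_0)
  have decomp: "\<exists>y1\<in>P1. \<exists>y2\<in>P2. x = y1 + y2" if "x \<in> W" for x
  proof -
    have "x \<in> \<psi> ` U" using fr.region(2) that c(3,4) by auto
    then show ?thesis unfolding im by blast
  qed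
  have gm: "fr.gm x (a + b) (a' + b') = h1 y1 a a' + h2 y2 b b'"
    if x: "x \<in> W" "x = y1 + y2" and y: "y1 \<in> P1" "y2 \<in> P2" and ab: "a \<in> S1" "a' \<in> S1" "b \<in> S2" "b' \<in> S2"
    for x y1 y2 a a' b b'
  proof -
    have "cmp c (fr.pt x) (vec c (fr.pt x) v) = v" for v
      by (rule vec_cmp_inverse(2)[OF c(1) fr.pt_W(1)[OF x(1)]])
    then have m: "mderiv A \<psi> (fr.pt x) (vec c (fr.pt x) v) = v" for v by (simp only: c(4))
    have q: "fr.pt x \<in> U" "\<psi> (fr.pt x) = y1 + y2" using fr.pt_W[OF x(1)] x(2) c(3,4) by auto
    show ?thesis unfolding fr.gm_def
      by (rule g[OF q(1) y ab q(2) m m])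
  qed
  have mixed: "fr.gm x a b = 0" if x: "x \<in> W" and ab: "a \<in> S1" "b \<in> S2" for x a b
  proof -
    obtain y1 y2 where y: "y1 \<in> P1" "y2 \<in> P2" "x = y1 + y2" using decomp[OF x] by blast
    note G = gm[OF x y(3,1,2)]
    have "fr.gm x a b = h1 y1 a 0 + h2 y2 0 b" using G[of a 0 0 b] ab zero by simp
    moreover have "h1 y1 a 0 + h2 y2 0 0 = 0"
      using G[of a 0 0 0] ab zero linear_0[OF fr.gm_linear(2)[OF x]] by simp
    moreover have "h1 y1 0 0 + h2 y2 0 b = 0"
      using G[of 0 0 0 b] ab zero linear_0[OF fr.gm_linear(1)[OF x]] by simp
    moreover have "h1 y1 0 0 + h2 y2 0 0 = 0"
      using G[of 0 0 0 0] zero linear_0[OF fr.gm_linear(1)[OF x]] by simp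
    ultimately show ?thesis by linarith
  qed
  have along: "FD (\<lambda>x. fr.gm x a a') x b = 0" if x: "x \<in> W" and ab: "a \<in> S1" "a' \<in> S1" "b \<in> S2" for x a a' b
  proof -
    obtain y1 y2 where y: "y1 \<in> P1" "y2 \<in> P2" "x = y1 + y2" using decomp[OF x] by blast
    let ?T = "(\<lambda>t. x + t *\<^sub>R b) -` W"
    have T: "open ?T" "0 \<in> ?T" using x by (auto intro!: open_vimage fr.region(1) continuous_intros)
    have const: "fr.gm (x + t *\<^sub>R b) a a' = fr.gm x a a'" if "t \<in> ?T" for t
    proof -
      have tW: "x + t *\<^sub>R b \<in> W" using that by simp
      obtain z1 z2 where z: "z1 \<in> P1" "z2 \<in> P2" "x + t *\<^sub>R b = z1 + z2" using decomp[OF tW] by blast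
      have "z1 - y1 = y2 + t *\<^sub>R b - z2" using z(3) y(3) by (simp add: algebra_simps)
      moreover have "z1 - y1 \<in> S1" using z(1) y(1) P_sub(1) S(1) by (auto intro: subspace_diff)
      moreover have "y2 + t *\<^sub>R b - z2 \<in> S2"
        using z(2) y(2) P_sub(2) S(2) ab(3) by (auto intro!: subspace_diff subspace_add subspace_scale)
      ultimately have "z1 - y1 \<in> S1 \<inter> S2" by simp
      then have eq: "z1 = y1" using S(3) by simp
      have h: "h2 y2 0 0 = h2 z2 0 0"
        using gm[OF x y(3,1,2), of 0 0 0 0] gm[OF tW z(3,1,2), of 0 0 0 0] zero eq
          linear_0[OF fr.gm_linear(1)[OF x]] linear_0[OF fr.gm_linear(1)[OF tW]] by simp
      show ?thesis
        using gm[OF x y(3,1,2), of a a' 0 0] gm[OF tW z(3,1,2), of a a' 0 0] ab zero eq h by simp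
    qed
    have 1: "((\<lambda>t. x + t *\<^sub>R b) has_derivative (\<lambda>t. t *\<^sub>R b)) (at 0)" by (auto intro!: derivative_eq_intros)
    have 2: "((\<lambda>x. fr.gm x a a') has_derivative FD (\<lambda>x. fr.gm x a a') x) (at (x + 0 *\<^sub>R b))"
      using smooth_on_has_derivative[OF fr.gm_smooth x] by simp
    from has_derivative_compose[OF 1 2]
    have "((\<lambda>t. fr.gm x a a') has_derivative (\<lambda>t. FD (\<lambda>x. fr.gm x a a') x (t *\<^sub>R b))) (at 0)"
      by (rule has_derivative_transform_within_open[OF _ T]) (rule const)
    from has_derivative_unique[OF this has_derivative_const]
    have "FD (\<lambda>x. fr.gm x a a') x (1 *\<^sub>R b) = 0" by (rule fun_cong)
    then show ?thesis by simp
  qed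
  let ?x = "snd c p"
  have ptx: "fr.pt ?x = p" by (rule chart_inverse(1)[OF smooth_chart_is_chart[OF c(1)] c(2)])
  have FD0: "FD (\<lambda>x. fr.gm x a b) ?x v = 0" if "a \<in> S1" "b \<in> S2" for a b v
  proof -
    have "FD (\<lambda>x. fr.gm x a b) ?x = FD (\<lambda>x. 0) ?x"
      by (rule FD_cong_open[OF fr.region(1) fr(2)]) (rule mixed[OF _ that])
    then show ?thesis by simp
  qed
  have sym: "fr.gm ?x a b = fr.gm ?x b a" for a b by (simp add: fr.gm_def metric_sym)
  (* Koszul's formula: the sum of two of the metric identities minus the third one. *)
  have \<Gamma>_perp: "fr.gm ?x (fr.\<Gamma> ?x a a') b = 0" if "a \<in> S1" "a' \<in> S1" "b \<in> S2" for a a' b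
    using FD0[OF that(2,3), of a] FD0[OF that(1,3), of a'] along[OF fr(2) that(1,2,3)]
      fr.\<Gamma>_sym[OF fr(2), of a a'] fr.\<Gamma>_sym[OF fr(2), of a b] fr.\<Gamma>_sym[OF fr(2), of a' b]
      sym[of a' "fr.\<Gamma> ?x b a"] sym[of a "fr.\<Gamma> ?x b a'"]
    by (simp add: fr.gm_parallel[OF fr(2)])
  have \<Gamma>_in: "fr.\<Gamma> ?x a a' \<in> S1" if "a \<in> S1" "a' \<in> S1" for a a'
  proof -
    obtain s t where st: "s \<in> S1" "t \<in> S2" "fr.\<Gamma> ?x a a' = s + t" using sum by blast
    have "fr.gm ?x t t = 0"
      using \<Gamma>_perp[OF that st(2)] mixed[OF fr(2) st(1,2)] by (simp add: st(3) linear_add[OF fr.gm_linear(1)[OF fr(2)]])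
    then have "t = 0" using fr.gm_pos[OF fr(2), of t] by fastforce
    then show ?thesis using st by simp
  qed
  have in_S1: "cmp c q v \<in> S1 \<longleftrightarrow> v \<in> D1 q" if "q \<in> U" for q v using prodD(9)[OF that] by (simp add: c(4))
  have "FD (field_in_chart A c Y) ?x h \<in> S1" for h
  proof (rule has_derivative_in_subspace[where f = "field_in_chart A c Y" and f' = "FD (field_in_chart A c Y) ?x", OF S(1) _ fr.region(1) fr(2)])
    show "(field_in_chart A c Y has_derivative FD (field_in_chart A c Y) ?x) (at ?x)"
      by (rule smooth_on_has_derivative[OF smooth_field_in_chart[OF Y'(1) c(1)]]) (use c(2) in simp)
    show "field_in_chart A c Y y \<in> S1" if "y \<in> W" for y
      using in_S1[of "fr.pt y"] fr.pt_W(1)[OF that] Y'(2) c(3) by (simp add: field_in_chart_def)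
  qed
  moreover have "fr.\<Gamma> ?x (cmp c p (X p)) (cmp c p (Y p)) \<in> S1"
    by (rule \<Gamma>_in) (simp_all add: in_S1[OF U(1)] X' Y')
  ultimately have "cmp c p (nabla X Y p) \<in> S1"
    using fr.nabla_in_chart[OF X'(1) Y'(1) fr(2)] S(1) by (simp add: ptx subspace_add)
  then show ?thesis by (simp add: in_S1[OF U(1)])
qed

section \<open>Parallel splittings give product charts\<close>

context manifold
begin

lemma smooth_chart_compose:
  assumes c: "smooth_chart A c" and U: "open U" "U \<subseteq> cimg c" and T: "open T" and hom: "homeomorphism U T \<psi> \<gamma>"
    and sm: "smooth_on U \<psi>" "smooth_on T \<gamma>"
  shows "smooth_chart A (fst c \<inter> snd c -` U, \<lambda>p. \<psi> (snd c p))" "(\<lambda>p. \<psi> (snd c p)) ` (fst c \<inter> snd c -` U) = T"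
proof -
  note cc = smooth_chart_is_chart[OF c]
  let ?U = "fst c \<inter> snd c -` U" and ?\<psi> = "\<lambda>p. \<psi> (snd c p)" and ?d = "(fst c \<inter> snd c -` U, \<lambda>p. \<psi> (snd c p))"
  have h: "\<And>x. x \<in> U \<Longrightarrow> \<gamma> (\<psi> x) = x" "\<And>x. x \<in> U \<Longrightarrow> \<psi> x \<in> T" "\<And>y. y \<in> T \<Longrightarrow> \<psi> (\<gamma> y) = y" "\<And>y. y \<in> T \<Longrightarrow> \<gamma> y \<in> U"
    using hom by (auto simp: homeomorphism_def)
  have chart_point: "inv_chart c (\<gamma> y) \<in> ?U" "?\<psi> (inv_chart c (\<gamma> y)) = y" if "y \<in> T" for y
    using h(3,4)[OF that] U(2) chart_inverse(2,3)[OF cc, of "\<gamma> y"] by auto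
  show img: "?\<psi> ` ?U = T"
  proof (intro equalityI subsetI)
    show "y \<in> T" if "y \<in> ?\<psi> ` ?U" for y using that h(2) by auto
    show "y \<in> ?\<psi> ` ?U" if "y \<in> T" for y using chart_point[OF that] by (intro image_eqI[of _ _ "inv_chart c (\<gamma> y)"]) auto
  qed
  have inj: "inj_on ?\<psi> ?U"
  proof (rule inj_onI)
    fix p q assume pq: "p \<in> ?U" "q \<in> ?U" "\<psi> (snd c p) = \<psi> (snd c q)"
    have a: "snd c p \<in> U" "snd c q \<in> U" "p \<in> fst c" "q \<in> fst c" using pq(1,2) by auto
    have "p = inv_chart c (\<gamma> (\<psi> (snd c p)))" unfolding h(1)[OF a(1)] by (rule chart_inverse(1)[OF cc a(3), symmetric])
    also have "\<dots> = inv_chart c (\<gamma> (\<psi> (snd c q)))" by (simp only: pq(3))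
    also have "\<dots> = q" unfolding h(1)[OF a(2)] by (rule chart_inverse(1)[OF cc a(4)])
    finally show "p = q" .
  qed
  have inv: "inv_into ?U ?\<psi> y = inv_chart c (\<gamma> y)" if "y \<in> T" for y
    by (rule inv_into_f_eq[OF inj chart_point[OF that]])
  have oU: "open ?U" by (rule continuous_open_preimage[OF chart_continuous(1)[OF cc] chart_open(1)[OF cc] U(1)])
  have d: "is_chart ?d"
    unfolding is_chart_def fst_conv snd_conv img
  proof (intro conjI homeomorphismI)
    show "open ?U" by (rule oU)
    show "open T" by (rule T)
    show "continuous_on ?U ?\<psi>"
      by (rule continuous_on_compose2[OF smooth_on_continuous[OF sm(1)] continuous_on_subset[OF chart_continuous(1)[OF cc]]]) auto
    have "continuous_on T (\<lambda>y. inv_chart c (\<gamma> y))"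
      by (rule continuous_on_compose2[OF chart_continuous(2)[OF cc] smooth_on_continuous[OF sm(2)]]) (use h(4) U(2) in auto)
    then show "continuous_on T (inv_into ?U ?\<psi>)" by (rule continuous_on_eq) (simp add: inv)
    show "?\<psi> ` ?U \<subseteq> T" by (simp add: img)
    show "inv_into ?U ?\<psi> ` T \<subseteq> ?U" using chart_point(1) by (auto simp: inv)
    show "inv_into ?U ?\<psi> (?\<psi> p) = p" if "p \<in> ?U" for p by (rule inv_into_f_f[OF inj that])
    show "?\<psi> (inv_into ?U ?\<psi> y) = y" if "y \<in> T" for y using inv[OF that] chart_point(2)[OF that] by simp
  qed
  show "smooth_chart A ?d"
    unfolding smooth_chart_def
  proof (intro conjI ballI d)
    fix e assume e: "e \<in> A"
    note ec = smooth_chart_is_chart[OF member_smooth_chart[OF e]] and t = smooth_chart_transitions[OF c e]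
    have S1: "open (?\<psi> ` (?U \<inter> fst e))" using chart_image_open[OF d chart_open(1)[OF ec]] by simp
    have sub: "?\<psi> ` (?U \<inter> fst e) \<subseteq> T" using img by blast
    have sm': "smooth_on (?\<psi> ` (?U \<inter> fst e)) (\<lambda>y. snd e (inv_chart c (\<gamma> y)))"
    proof (rule smooth_on_compose[OF S1 transition_smooth[OF t(1)] smooth_on_subset[OF sm(2) sub]])
      show "\<gamma> ` ?\<psi> ` (?U \<inter> fst e) \<subseteq> snd c ` (fst c \<inter> fst e)" using h(1) by auto
    qed
    have "smooth_on (?\<psi> ` (?U \<inter> fst e)) (\<lambda>y. snd e (inv_into ?U ?\<psi> y))"
    proof (rule smooth_on_congI[OF S1 sm'])
      show "snd e (inv_into ?U ?\<psi> y) = snd e (inv_chart c (\<gamma> y))" if "y \<in> ?\<psi> ` (?U \<inter> fst e)" for y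
        using inv[of y] sub that by (simp only: subset_iff)
    qed
    then show "smooth_transition ?d e" by (simp add: smooth_transition_def o_def)
    have S2: "open (snd e ` (fst e \<inter> ?U))" by (rule chart_image_open[OF ec oU])
    have "smooth_on (snd e ` (fst e \<inter> ?U)) (\<lambda>y. \<psi> (snd c (inv_chart e y)))"
    proof (rule smooth_on_compose[OF S2 sm(1) smooth_on_subset[OF transition_smooth[OF t(2)]]])
      show "snd e ` (fst e \<inter> ?U) \<subseteq> snd e ` (fst e \<inter> fst c)" by blast
      show "(\<lambda>y. snd c (inv_chart e y)) ` snd e ` (fst e \<inter> ?U) \<subseteq> U" by (auto simp: chart_inverse[OF ec])
    qed
    then show "smooth_transition e ?d" by (simp add: smooth_transition_def o_def)
  qed
qed

end

context lagrangian_submersion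
begin

lemma extend_vector:
  obtains Z where "smooth_field A Z" "Z p = v"
proof -
  note cs = member_smooth_chart[OF chart_at(1)[of p]]
  obtain W K \<beta> where fr: "chart_frame A g nabla (chart_at A p) W K \<beta>" "snd (chart_at A p) p \<in> W"
    by (rule chart_frame_exists[OF cs chart_at(2)])
  interpret fr: chart_frame A g nabla "chart_at A p" W K \<beta> by (rule fr(1))
  show thesis
    by (rule that[OF fr.E_smooth, of "cmp (chart_at A p) p v"])
       (use fr.E_pt[OF fr(2)] chart_inverse(1)[OF smooth_chart_is_chart[OF cs] chart_at(2)]
          vec_cmp_inverse(1)[OF cs chart_at(2)] in simp)
qed

lemma P_sections: "smooth_field A X \<Longrightarrow> (\<lambda>q. P q (X q)) \<in> sections A V"
  using P_endomorphism P_in by (auto simp: sections_iff endomorphism_field_def)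

lemma Q_sections: "smooth_field A X \<Longrightarrow> (\<lambda>q. X q - P q (X q)) \<in> sections A H"
  using P_sections[of X] Q_in by (auto simp: sections_iff intro: smooth_field_diff)

text \<open>By metric compatibility the orthogonal complement of a totally geodesic distribution is invariant under
  differentiation along that distribution. So \<open>\<nabla>\<^sub>X\<close> preserves both distributions for every \<open>X\<close>, that is, it
  commutes with the projection.\<close>

lemma P_parallel:
  assumes geoV: "\<And>X Y p. X \<in> sections A V \<Longrightarrow> Y \<in> sections A V \<Longrightarrow> nabla X Y p \<in> V p"
    and geoH: "\<And>X Y p. X \<in> sections A H \<Longrightarrow> Y \<in> sections A H \<Longrightarrow> nabla X Y p \<in> H p"
    and X: "smooth_field A X" and Y: "smooth_field A Y"
  shows "nabla X (\<lambda>q. P q (Y q)) p = P p (nabla X Y p)"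
proof -
  have orth: "g p (nabla X Z p) (Y p) = - g p (Z p) (nabla X Y p)"
    if "smooth_field A X" "Z \<in> sections A V" "Y \<in> sections A H" for X Y Z p
  proof -
    have s: "smooth_field A Z" "smooth_field A Y" using that by (auto simp: sections_iff)
    have "g q (Z q) (Y q) = 0" for q using that by (auto simp: sections_iff H_iff)
    then have "mderiv A (\<lambda>q. g q (Z q) (Y q)) p (X p) = 0" by (simp add: mderiv_const)
    then show ?thesis using nabla_metric[OF that(1) s, of p] by linarith
  qed
  have VH: "nabla X Y p \<in> H p" if X: "X \<in> sections A V" and Y: "Y \<in> sections A H" for X Y p
    unfolding H_iff
  proof
    fix v assume v: "v \<in> V p"
    obtain Z where Z: "smooth_field A Z" "Z p = v" by (rule extend_vector)
    let ?Z = "\<lambda>q. P q (Z q)"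
    have "g p (nabla X ?Z p) (Y p) = 0"
      using geoV[OF X P_sections[OF Z(1)], of p] Y by (auto simp: sections_iff H_iff)
    moreover have "?Z p = v" using v P_id_iff by (simp add: Z(2))
    ultimately show "g p v (nabla X Y p) = 0"
      using orth[OF _ P_sections[OF Z(1)] Y, of X p] X by (simp add: sections_iff)
  qed
  have HV: "nabla X Y p \<in> V p" if X: "X \<in> sections A H" and Y: "Y \<in> sections A V" for X Y p
  proof -
    have "g p (nabla X Y p) w = 0" if w: "w \<in> H p" for w
    proof -
      obtain Z where Z: "smooth_field A Z" "Z p = w" by (rule extend_vector)
      let ?Z = "\<lambda>q. Z q - P q (Z q)"
      have "g p (Y p) (nabla X ?Z p) = 0"
        using geoH[OF X Q_sections[OF Z(1)], of p] Y by (auto simp: sections_iff H_iff)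
      moreover have "?Z p = w" using w P_zero_iff by (simp add: Z(2))
      ultimately show ?thesis using orth[OF _ Y Q_sections[OF Z(1)], of X p] X by (simp add: sections_iff)
    qed
    from this[OF Q_in[of "nabla X Y p" p]]
    have "g p (nabla X Y p - P p (nabla X Y p)) (nabla X Y p - P p (nabla X Y p)) = 0"
      using Q_in[of "nabla X Y p" p] P_in[of p "nabla X Y p"]
      by (simp add: linear_diff[OF metric_bilinear(1)] H_iff)
    then have "nabla X Y p - P p (nabla X Y p) = 0" using metric_pos[of _ p] by fastforce
    then have "P p (nabla X Y p) = nabla X Y p" by simp
    then show ?thesis by (simp only: P_id_iff)
  qed
  let ?PX = "\<lambda>q. P q (X q)" and ?QX = "\<lambda>q. X q - P q (X q)"
  let ?PY = "\<lambda>q. P q (Y q)" and ?QY = "\<lambda>q. Y q - P q (Y q)"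
  note s = P_sections[OF X] Q_sections[OF X] P_sections[OF Y] Q_sections[OF Y]
  then have sm: "smooth_field A ?PX" "smooth_field A ?QX" "smooth_field A ?PY" "smooth_field A ?QY"
    by (auto simp: sections_iff)
  have "nabla (\<lambda>q. ?PX q + ?QX q) ?PY p = nabla ?PX ?PY p + nabla ?QX ?PY p"
    by (rule nabla_add1[OF sm(1,2,3)])
  then have 1: "nabla X ?PY p \<in> V p"
    using geoV[OF s(1,3)] HV[OF s(2,3)] by (simp add: subspace_add[OF subspace_V])
  have "nabla (\<lambda>q. ?PX q + ?QX q) ?QY p = nabla ?PX ?QY p + nabla ?QX ?QY p"
    by (rule nabla_add1[OF sm(1,2,4)])
  then have 2: "nabla X ?QY p \<in> H p"
    using VH[OF s(1,4)] geoH[OF s(2,4)] by (simp add: subspace_add[OF subspace_H])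
  have "nabla X (\<lambda>q. ?PY q + ?QY q) p = nabla X ?PY p + nabla X ?QY p"
    by (rule nabla_add2[OF X sm(3,4)])
  then have "nabla X Y p - nabla X ?PY p \<in> H p" using 2 by simp
  then show ?thesis by (rule P_unique[OF 1, symmetric])
qed

text \<open>In flat coordinates the metric and the vertical projection have constant coefficients, so the coordinate
  space splits into two orthogonal subspaces and the metric is a product of constant metrics. Only the
  domain has to be shrunk to a product.\<close>

theorem geodesic_imp_locally_product:
  assumes geoV: "\<And>X Y p. X \<in> sections A V \<Longrightarrow> Y \<in> sections A V \<Longrightarrow> nabla X Y p \<in> V p"
    and geoH: "\<And>X Y p. X \<in> sections A H \<Longrightarrow> Y \<in> sections A H \<Longrightarrow> nabla X Y p \<in> H p"
  shows "locally_product A g V H"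
  unfolding locally_product_iff
proof
  fix p
  define c where "c = chart_at A p"
  have c: "smooth_chart A c" "p \<in> fst c" using chart_at member_smooth_chart by (auto simp: c_def)
  note cc = smooth_chart_is_chart[OF c(1)]
  define x0 where "x0 = snd c p"
  obtain W K \<beta> where fr: "chart_frame A g nabla c W K \<beta>" "x0 \<in> W"
    unfolding x0_def by (rule chart_frame_exists[OF c])
  interpret fr: chart_frame A g nabla c W K \<beta> by (rule fr(1))
  let ?J = "fr.endo J" and ?P = "fr.endo P"
  have P_par: "\<And>X Y p. smooth_field A X \<Longrightarrow> smooth_field A Y \<Longrightarrow> nabla X (\<lambda>q. P q (Y q)) p = P p (nabla X Y p)"
    by (rule P_parallel[OF geoV geoH])
  have vc: "vec c (fr.pt x) (cmp c (fr.pt x) v) = v" if "x \<in> W" for x v by (rule fr.vec_cmp[OF that])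
  have cv: "cmp c (fr.pt x) (vec c (fr.pt x) v) = v" if "x \<in> W" for x v
    by (rule vec_cmp_inverse(2)[OF c(1) fr.pt_W(1)[OF that]])
  interpret flat: parallel_lagrangian_splitting W fr.\<Gamma> fr.gm ?J ?P
  proof (intro parallel_lagrangian_splitting.intro parallel_lagrangian_splitting_axioms.intro)
    show "local_connection W fr.\<Gamma> fr.gm" by (rule fr.local_connection_axioms)
    show "fr.parallel_endo ?J" by (rule fr.parallel_endo_in_chart[OF J J_parallel])
    show "fr.parallel_endo ?P" by (rule fr.parallel_endo_in_chart[OF P_endomorphism P_par])
    fix x v a b assume x: "x \<in> W"
    note lc = vec_cmp_inverse(3)[OF c(1) fr.pt_W(1)[OF x]] and lv = vec_cmp_inverse(4)[OF c(1) fr.pt_W(1)[OF x]]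
    show "fr.gm x a b = fr.gm x b a" by (simp add: fr.gm_def metric_sym)
    show "?J x (?J x v) = - v"
      by (simp add: fr.endo_def vc[OF x] J_square linear_neg[OF lc] cv[OF x])
    have "P q (P q u) = P q u" for q u using P_in by (simp only: P_id_iff)
    then show "?P x (?P x v) = ?P x v" by (simp add: fr.endo_def vc[OF x])
    show "fr.gm x (?P x a) b = fr.gm x a (?P x b)"
      by (simp add: fr.gm_def fr.endo_def vc[OF x] P_selfadjoint)
    show "?P x (?J x v) = ?J x (v - ?P x v)"
      by (simp add: fr.endo_def vc[OF x] P_J linear_diff[OF lv])
  qed
  obtain r \<psi> where r: "0 < r" "ball x0 r \<subseteq> W" and \<psi>: "smooth_on (ball x0 r) \<psi>"
    and \<psi>_inj: "\<And>x. x \<in> ball x0 r \<Longrightarrow> inj (FD \<psi> x)"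
    and \<psi>_g: "\<And>x v w. x \<in> ball x0 r \<Longrightarrow> fr.gm x v w = fr.gm x0 (FD \<psi> x v) (FD \<psi> x w)"
    and \<psi>_P: "\<And>x v. x \<in> ball x0 r \<Longrightarrow> FD \<psi> x (?P x v) = ?P x0 (FD \<psi> x v)"
    by (rule flat.flat_coordinates[OF fr(2)]) (rule that; assumption)
  have x0r: "x0 \<in> ball x0 r" using r by simp
  obtain U1 T1 \<gamma> where U1: "open U1" "x0 \<in> U1" "U1 \<subseteq> ball x0 r" "open T1" "homeomorphism U1 T1 \<psi> \<gamma>" "smooth_on T1 \<gamma>"
    by (rule smooth_inverse_function[OF open_ball \<psi> x0r \<psi>_inj[OF x0r]]) (rule that; assumption)
  have hom: "\<And>x. x \<in> U1 \<Longrightarrow> \<gamma> (\<psi> x) = x" "\<And>x. x \<in> U1 \<Longrightarrow> \<psi> x \<in> T1" "\<And>y. y \<in> T1 \<Longrightarrow> \<psi> (\<gamma> y) = y" "\<And>y. y \<in> T1 \<Longrightarrow> \<gamma> y \<in> U1"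
    using U1(5) by (auto simp: homeomorphism_def)
  let ?\<pi> = "?P x0"
  have lin\<pi>: "linear ?\<pi>" using flat.P fr(2) by (simp add: fr.parallel_endo_def)
  have idem: "?\<pi> (?\<pi> v) = ?\<pi> v" for v by (rule flat.P_idem[OF fr(2)])
  have cont\<pi>: "continuous_on UNIV ?\<pi>" by (rule linear_continuous_on[OF linear_conv_bounded_linear[THEN iffD1, OF lin\<pi>]])
  define S1 where "S1 = {v. ?\<pi> v = v}"
  define S2 where "S2 = {v. ?\<pi> v = 0}"
  have S: "subspace S1" "subspace S2"
    by (auto simp: S1_def S2_def subspace_def linear_0[OF lin\<pi>] linear_add[OF lin\<pi>] linear_cmul[OF lin\<pi>])
  have S1_in: "?\<pi> v \<in> S1" and S2_in: "v - ?\<pi> v \<in> S2" for v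
    by (simp_all add: S1_def S2_def idem linear_diff[OF lin\<pi>])
  define y0 where "y0 = \<psi> x0"
  have y0: "y0 \<in> T1" using hom(2) U1(2) by (simp add: y0_def)
  obtain \<epsilon> where \<epsilon>: "\<epsilon> > 0" "ball y0 \<epsilon> \<subseteq> T1" using U1(4) y0 by (meson openE)
  (* Half the radius, because the two components of a point add up. *)
  define P1 where "P1 = S1 \<inter> ball (?\<pi> y0) (\<epsilon> / 2)"
  define P2 where "P2 = S2 \<inter> ball (y0 - ?\<pi> y0) (\<epsilon> / 2)"
  define T where "T = {x + y | x y. x \<in> P1 \<and> y \<in> P2}"
  have T_eq: "T = ?\<pi> -` ball (?\<pi> y0) (\<epsilon> / 2) \<inter> (\<lambda>y. y - ?\<pi> y) -` ball (y0 - ?\<pi> y0) (\<epsilon> / 2)"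
  proof (intro equalityI subsetI)
    fix y assume "y \<in> T"
    then obtain a b where ab: "a \<in> P1" "b \<in> P2" "y = a + b" by (auto simp: T_def)
    have "?\<pi> y = a" "y - ?\<pi> y = b" using ab by (auto simp: P1_def P2_def S1_def S2_def linear_add[OF lin\<pi>])
    then show "y \<in> ?\<pi> -` ball (?\<pi> y0) (\<epsilon> / 2) \<inter> (\<lambda>y. y - ?\<pi> y) -` ball (y0 - ?\<pi> y0) (\<epsilon> / 2)"
      using ab by (auto simp: P1_def P2_def)
  next
    fix y assume y: "y \<in> ?\<pi> -` ball (?\<pi> y0) (\<epsilon> / 2) \<inter> (\<lambda>y. y - ?\<pi> y) -` ball (y0 - ?\<pi> y0) (\<epsilon> / 2)"
    have "?\<pi> y \<in> P1" "y - ?\<pi> y \<in> P2" using y S1_in S2_in by (auto simp: P1_def P2_def)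
    moreover have "y = ?\<pi> y + (y - ?\<pi> y)" by simp
    ultimately show "y \<in> T" unfolding T_def by blast
  qed
  have T_open: "open T" unfolding T_eq
    by (intro open_Int open_vimage open_ball cont\<pi> continuous_on_diff continuous_on_id)
  have T_sub: "T \<subseteq> T1"
  proof
    fix y assume "y \<in> T"
    then have "dist (?\<pi> y0) (?\<pi> y) < \<epsilon> / 2" "dist (y0 - ?\<pi> y0) (y - ?\<pi> y) < \<epsilon> / 2" by (auto simp: T_eq)
    moreover have "norm (y0 - y) = norm ((?\<pi> y0 - ?\<pi> y) + ((y0 - ?\<pi> y0) - (y - ?\<pi> y)))" by simp
    ultimately have "dist y0 y < \<epsilon>"
      using norm_triangle_ineq[of "?\<pi> y0 - ?\<pi> y" "(y0 - ?\<pi> y0) - (y - ?\<pi> y)"]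
      unfolding dist_norm by linarith
    then show "y \<in> T1" using \<epsilon>(2) by auto
  qed
  have y0T: "y0 \<in> T" using \<epsilon>(1) by (simp add: T_eq)
  define U2 where "U2 = U1 \<inter> \<psi> -` T"
  have U2: "open U2"
    unfolding U2_def
    by (rule continuous_open_preimage[OF smooth_on_continuous[OF smooth_on_subset[OF \<psi> U1(3)]] U1(1) T_open])
  have x0U2: "x0 \<in> U2" using U1(2) y0T by (simp add: U2_def y0_def)
  have U2_sub: "U2 \<subseteq> ball x0 r" "U2 \<subseteq> W" "U2 \<subseteq> cimg c" using U1(3) r(2) fr.region(2) by (auto simp: U2_def)
  have hom2: "homeomorphism U2 T \<psi> \<gamma>"
  proof (rule homeomorphismI)
    show "continuous_on U2 \<psi>" by (rule smooth_on_continuous[OF smooth_on_subset[OF \<psi> U2_sub(1)]])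
    show "continuous_on T \<gamma>" by (rule smooth_on_continuous[OF smooth_on_subset[OF U1(6) T_sub]])
    show "\<psi> ` U2 \<subseteq> T" by (auto simp: U2_def)
    show "\<gamma> ` T \<subseteq> U2" using hom(3,4) T_sub by (auto simp: U2_def subset_iff)
    show "\<gamma> (\<psi> x) = x" if "x \<in> U2" for x using hom(1) that by (simp add: U2_def)
    show "\<psi> (\<gamma> y) = y" if "y \<in> T" for y using hom(3) that T_sub by blast
  qed
  let ?U = "fst c \<inter> snd c -` U2" and ?\<psi> = "\<lambda>p. \<psi> (snd c p)"
  note chart = smooth_chart_compose[OF c(1) U2 U2_sub(3) T_open hom2 smooth_on_subset[OF \<psi> U2_sub(1)] smooth_on_subset[OF U1(6) T_sub]]
  have m: "mderiv A ?\<psi> q v = FD \<psi> (snd c q) (cmp c q v)" if q: "q \<in> ?U" for q v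
  proof -
    have xq: "snd c q \<in> U2" "q \<in> fst c" using q by auto
    have eq: "\<psi> (snd c (fr.pt x)) = \<psi> x" if "x \<in> U2" for x
      using chart_inverse(3)[OF cc, of x] U2_sub(3) that by auto
    have d: "\<psi> differentiable (at (snd c q))" by (rule smooth_on_differentiable[OF \<psi>]) (use xq U2_sub(1) in blast)
    have "(\<lambda>x. \<psi> (snd c (fr.pt x))) differentiable (at (snd c q))"
      using d differentiable_cong_open[OF U2 xq(1), of "\<lambda>x. \<psi> (snd c (fr.pt x))" \<psi>] eq by blast
    from mderiv_in_chart[OF c(1) xq(2), of ?\<psi>, OF this]
    show ?thesis using FD_cong_open[OF U2 xq(1), of "\<lambda>x. \<psi> (snd c (fr.pt x))" \<psi>] eq by simp
  qed
  have at_q: "snd c q \<in> ball x0 r" "snd c q \<in> W" "fr.pt (snd c q) = q" if "q \<in> ?U" for q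
    using that U2_sub chart_inverse(1)[OF cc] by auto
  have mP: "?\<pi> (mderiv A ?\<psi> q v) = mderiv A ?\<psi> q (P q v)" if q: "q \<in> ?U" for q v
    unfolding m[OF q] using \<psi>_P[OF at_q(1)[OF q], of "cmp c q v"] vc[OF at_q(2)[OF q], of v] at_q(3)[OF q]
    by (simp add: fr.endo_def)
  have m_inj: "mderiv A ?\<psi> q v = mderiv A ?\<psi> q w \<longleftrightarrow> v = w" if q: "q \<in> ?U" for q v w
  proof
    assume "mderiv A ?\<psi> q v = mderiv A ?\<psi> q w"
    then have "cmp c q v = cmp c q w" unfolding m[OF q] by (rule injD[OF \<psi>_inj[OF at_q(1)[OF q]]])
    then have "vec c q (cmp c q v) = vec c q (cmp c q w)" by simp
    then show "v = w" using vec_cmp_inverse(1)[OF c(1)] q by simp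
  qed simp
  have m0: "mderiv A ?\<psi> q 0 = 0" if q: "q \<in> ?U" for q
  proof -
    have "linear (FD \<psi> (snd c q))" by (rule smooth_on_linear_FD[OF \<psi> at_q(1)[OF q]])
    moreover have "linear (cmp c q)" using q by (intro vec_cmp_inverse(3)[OF c(1)]) simp
    ultimately show ?thesis unfolding m[OF q] by (simp add: linear_0)
  qed
  have g_flat: "g q v w = fr.gm x0 (mderiv A ?\<psi> q v) (mderiv A ?\<psi> q w)" if q: "q \<in> ?U" for q v w
    unfolding m[OF q] \<psi>_g[OF at_q(1)[OF q], symmetric]
    using vc[OF at_q(2)[OF q]] at_q(3)[OF q] by (simp add: fr.gm_def)
  have cross: "fr.gm x0 a b = 0" "fr.gm x0 b a = 0" if "a \<in> S1" "b \<in> S2" for a b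
    using flat.P_selfadjoint[OF fr(2), of a b] that linear_0[OF fr.gm_linear(2)[OF fr(2)]]
      flat.gm_sym[OF fr(2), of a b] by (simp_all add: S1_def S2_def)
  have "product_chart A g V H ?U ?\<psi> S1 S2 P1 P2 (\<lambda>_. fr.gm x0) (\<lambda>_. fr.gm x0)"
    unfolding product_chart_def
  proof (intro conjI)
    show "smooth_chart A (?U, ?\<psi>)" by (rule chart(1))
    show "subspace S1" "subspace S2" by (rule S)+
    show "S1 \<inter> S2 = {0}" by (auto simp: S1_def S2_def linear_0[OF lin\<pi>])
    show "{a + b | a b. a \<in> S1 \<and> b \<in> S2} = UNIV"
    proof -
      have "v = ?\<pi> v + (v - ?\<pi> v)" for v by simp
      then show ?thesis using S1_in S2_in by blast
    qed
    show "openin (top_of_set S1) P1" "openin (top_of_set S2) P2"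
      by (auto simp: P1_def P2_def openin_open_Int)
    show "?\<psi> ` ?U = {x + y | x y. x \<in> P1 \<and> y \<in> P2}" using chart(2) by (simp only: T_def)
    show "\<forall>q\<in>?U. V q = {v. mderiv A ?\<psi> q v \<in> S1} \<and> H q = {v. mderiv A ?\<psi> q v \<in> S2}"
    proof (intro ballI conjI)
      fix q assume q: "q \<in> ?U"
      have "v \<in> V q \<longleftrightarrow> mderiv A ?\<psi> q v \<in> S1" for v
        using m_inj[OF q, of "P q v" v] mP[OF q, of v] P_id_iff[of q v] by (simp add: S1_def)
      then show "V q = {v. mderiv A ?\<psi> q v \<in> S1}" by blast
      have "v \<in> H q \<longleftrightarrow> mderiv A ?\<psi> q v \<in> S2" for v
        using m_inj[OF q, of "P q v" 0] mP[OF q, of v] P_zero_iff[of q v] m0[OF q] by (simp add: S2_def)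
      then show "H q = {v. mderiv A ?\<psi> q v \<in> S2}" by blast
    qed
    show "\<forall>q\<in>?U. \<forall>x\<in>P1. \<forall>y\<in>P2. \<forall>v w. \<forall>a\<in>S1. \<forall>a'\<in>S1. \<forall>b\<in>S2. \<forall>b'\<in>S2.
           ?\<psi> q = x + y \<longrightarrow> mderiv A ?\<psi> q v = a + b \<longrightarrow> mderiv A ?\<psi> q w = a' + b' \<longrightarrow>
           g q v w = fr.gm x0 a a' + fr.gm x0 b b'"
    proof (intro ballI allI impI)
      fix q v w a a' b b'
      assume *: "q \<in> ?U" "a \<in> S1" "a' \<in> S1" "b \<in> S2" "b' \<in> S2"
        "mderiv A ?\<psi> q v = a + b" "mderiv A ?\<psi> q w = a' + b'"
      show "g q v w = fr.gm x0 a a' + fr.gm x0 b b'"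
        unfolding g_flat[OF *(1)] *(6,7)
        by (simp add: linear_add[OF fr.gm_linear(1)[OF fr(2)]] linear_add[OF fr.gm_linear(2)[OF fr(2)]]
            cross[OF *(2,5)] cross[OF *(3,4)])
    qed
  qed
  moreover have "p \<in> ?U" using c(2) x0U2 by (simp add: x0_def)
  ultimately show "\<exists>U \<psi> S1 S2 P1 P2 h1 h2. p \<in> U \<and> product_chart A g V H U \<psi> S1 S2 P1 P2 h1 h2"
    by (intro exI conjI)
qed

end

theorem theorem5p2:
  fixes A :: "('m::{t2_space,second_countable_topology}, 'e::euclidean_space) chart set"
    and g :: "'m \<Rightarrow> 'e \<Rightarrow> 'e \<Rightarrow> real"
    and J :: "'m \<Rightarrow> 'e \<Rightarrow> 'e"
    and nabla :: "('m \<Rightarrow> 'e) \<Rightarrow> ('m \<Rightarrow> 'e) \<Rightarrow> 'm \<Rightarrow> 'e"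
    and B :: "('n::{t2_space,second_countable_topology}, 'f::euclidean_space) chart set"
    and g' :: "'n \<Rightarrow> 'f \<Rightarrow> 'f \<Rightarrow> real"
    and F :: "'m \<Rightarrow> 'n"
    and dil :: "'m \<Rightarrow> real"
  assumes "kaehler_manifold A g J nabla"
    and "smooth_atlas B" and "riemannian_metric B g'"
    and "conformal_lagrangian_submersion A g J B g' F dil"
  shows "locally_product A g (vertical A B F) (horizontal A g B F) \<longleftrightarrow>
    (\<forall>X\<in>sections A (horizontal A g B F). \<forall>Y\<in>sections A (horizontal A g B F). \<forall>p.
       oneill_A A g nabla B F X (\<lambda>q. J q (Y q)) p = 0) \<and>
    (\<forall>V\<in>sections A (vertical A B F). \<forall>W\<in>sections A (vertical A B F). \<forall>p.
       oneill_T A g nabla B F V (\<lambda>q. J q (W q)) p = 0)"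
proof -
  interpret lagrangian_submersion A g nabla B J F
  proof (intro lagrangian_submersion.intro lagrangian_submersion_axioms.intro levi_civita_manifold.intro
      levi_civita_manifold_axioms.intro manifold.intro)
    show "J p (J p v) = - v" for p v using assms(1) by (simp add: kaehler_manifold_def)
    show "nabla X (\<lambda>q. J q (Y q)) p = J p (nabla X Y p)" if "smooth_field A X" "smooth_field A Y" for X Y p
      using assms(1) that by (simp add: kaehler_manifold_def)
    show "J p ` vertical A B F p = horizontal A g B F p" for p
      using assms(4) by (simp add: conformal_lagrangian_submersion_def)
  qed (use assms in \<open>simp_all add: kaehler_manifold_def conformal_lagrangian_submersion_def\<close>)
  show ?thesis
  proof
    assume prod: "locally_product A g V H"
    show "(\<forall>X\<in>sections A H. \<forall>Y\<in>sections A H. \<forall>p. oneill_A A g nabla B F X (\<lambda>q. J q (Y q)) p = 0) \<and>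
      (\<forall>X\<in>sections A V. \<forall>W\<in>sections A V. \<forall>p. oneill_T A g nabla B F X (\<lambda>q. J q (W q)) p = 0)"
      using product_factor_geodesic[OF prod] product_factor_geodesic[OF locally_product_swap[OF prod]]
      by (simp add: oneill_A_zero_iff oneill_T_zero_iff)
  next
    assume "(\<forall>X\<in>sections A H. \<forall>Y\<in>sections A H. \<forall>p. oneill_A A g nabla B F X (\<lambda>q. J q (Y q)) p = 0) \<and>
      (\<forall>X\<in>sections A V. \<forall>W\<in>sections A V. \<forall>p. oneill_T A g nabla B F X (\<lambda>q. J q (W q)) p = 0)"
    then show "locally_product A g V H"
      by (intro geodesic_imp_locally_product) (simp_all add: oneill_A_zero_iff oneill_T_zero_iff)
  qed
qed

end
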